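(* Under the standing assumptions (A1)–(A8) and (B1)–(B4) of the context, let $\{\mathcal P_i\}_{i=1}^\infty$ be a sequence of nested partitions $\mathcal P_i=\{0=t_{0,i}<\dots<t_{N_i,i}=t_{\mathrm f}\}$, $\mathcal P_i\subset\mathcal P_{i+1}$, with $\delta_{ki}:=t_{k+1,i}-t_{k,i}$, $\bar\delta_i:=\max_k\delta_{ki}$, $\lim_{i\to\infty}\bar\delta_i=0$ and $(L_{\mathrm f}+L_{\mathrm h})\bar\delta_i<2$ for all $i$. Define the trapezoidally-discretized joint state-path and parameter log-posterior $\hat\ell_i:\mathcal W_n^2\times\mathbb R^q\times\mathbb R^m\to\overline{\mathbb R}$ by $\hat\ell_i(x,\zeta,\vartheta):=-\infty$ if $x\notin\mathrm{PL}(\mathcal P_i,\mathbb R^n)$ and, for $x\in\mathrm{PL}(\mathcal P_i,\mathbb R^n)$, $$\begin{aligned}\hat\ell_i(x,\zeta,\vartheta):={}&\ln\psi(y\mid x,\hat z_i,\vartheta)+\ln\pi(x(0),\zeta,\vartheta)\\&+\sum_{k=0}^{N_i-1}\ln\det\Big(\boldsymbol I-\tfrac12\nabla_{\mathrm x}f\big(t_{k+1,i},x(t_{k+1,i}),\hat z_i(t_{k+1,i}),\vartheta\big)\delta_{ki}\Big)\\&-\frac12\sum_{k=0}^{N_i-1}\delta_{ki}\Big|\boldsymbol G^{-1}\Big[\tfrac{x(t_{k+1,i})-x(t_{k,i})}{\delta_{ki}}-\tfrac12\hat f_{ki}-\tfrac12\hat f_{k+1,i}\Big]\Big|^2,\end{aligned}$$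 where $\hat f_{ki}:=f(t_{k,i},x(t_{k,i}),\hat z_i(t_{k,i}),\vartheta)$, $\hat h_{ki}:=h(t_{k,i},x(t_{k,i}),\hat z_i(t_{k,i}),\vartheta)$, and $\hat z_i\in\mathrm{PL}(\mathcal P_i,\mathbb R^q)$ is the unique solution of $\hat z_i(0)=\zeta$ and the implicit equations $\hat z_i(t)=\hat z_i(t_{k,i})+\frac12(t-t_{k,i})(\hat h_{ki}+\hat h_{k+1,i})$ for $t\in(t_{k,i},t_{k+1,i}]$. Define the continuous-time log-posterior $\ell:\mathcal W_n^2\times\mathbb R^q\times\mathbb R^m\to\overline{\mathbb R}$ by $$\ell(x,z_0,\theta):=\ln\psi(y\mid x,z,\theta)+\ln\pi(x(0),z_0,\theta)-\frac12\int_{\mathcal T}\Big|\boldsymbol G^{-1}\big[f(t,x(t),z(t),\theta)-\dot x(t)\big]\Big|^2dt-\frac12\int_{\mathcal T}\operatorname{div}_{\mathrm x}f(t,x(t),z(t),\theta)\,dt,$$ where $z\in\mathcal W_q^2$ solves $\dot z(t)=h(t,x(t),z(t),\theta)$, $z(0)=z_0$. Then $\hat\ell_i$ hypo-converges to $\ell$ as $i\to\infty$.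
   Context: Fix $t_{\mathrm f}>0$, $\mathcal T:=[0,t_{\mathrm f}]$, a probability space $(\Omega,\mathcal E,P)$ with a filtration $\{\mathcal E_t\}_{t\ge0}$, and an $n$-dimensional Wiener process $W$ with respect to it. $|\cdot|$ is the Euclidean norm and $\operatorname{supp}(P_\Theta)$ the topological support of the law of $\Theta$. The $\mathbb R^n$- and $\mathbb R^q$-valued processes $X,Z$ over $\mathcal T$ and the $\mathbb R^m$-valued random variable $\Theta$ satisfy $dX_t=f(t,X_t,Z_t,\Theta)\,dt+\boldsymbol G\,dW_t$, $dZ_t=h(t,X_t,Z_t,\Theta)\,dt$, with $f:\mathcal T\times\mathbb R^n\times\mathbb R^q\times\mathbb R^m\to\mathbb R^n$, $h:\mathcal T\times\mathbb R^n\times\mathbb R^q\times\mathbb R^m\to\mathbb R^q$, $\boldsymbol G\in\mathbb R^{n\times n}$. (A1) $X_0,Z_0,\Theta$ are $\mathcal E_0$-measurable. (A2) $X_0,Z_0,\Theta$ admit a continuous joint density $\pi:\mathbb R^n\times\mathbb R^q\times\mathbb R^m\to\mathbb R_{\ge0}$. (A3) $f$ and $h$ are uniformly continuous in all arguments on $\mathcal T\times\mathbb R^n\times\mathbb R^q\times\operatorname{supp}(P_\Theta)$. (A4) For each $\theta\in\operatorname{supp}(P_\Theta)$, $f$ and $h$ are Lipschitz in $(x,z)$, uniformly in $t$ (implied by (A8)). (A5) For all $t\in\mathcal T$ and $\theta\in\operatorname{supp}(P_\Theta)$, $f$ is twice differentiable in $x$ and differentiable in $t$ and $z$, with these first and second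 derivatives continuous in all arguments. (A6) $\boldsymbol G$ has full rank. (A7) $\mathrm E\big[\exp\big(\int_0^{t_{\mathrm f}}|\boldsymbol G^{-1}f(t,X_t,Z_t,\Theta)|^2dt\big)\big]<\infty$. (A8) There are $L_{\mathrm f},L_{\mathrm h}>0$ such that for all $t\in\mathcal T$, $x',x''\in\mathbb R^n$, $z',z''\in\mathbb R^q$, $\theta\in\operatorname{supp}(P_\Theta)$: $|f(t,x',z',\theta)-f(t,x'',z'',\theta)|\le L_{\mathrm f}(|x'-x''|+|z'-z''|)$ and $|h(t,x',z',\theta)-h(t,x'',z'',\theta)|\le L_{\mathrm h}(|x'-x''|+|z'-z''|)$. (B1) A random variable $Y$ with values in a metric space $\mathcal Y$ is observed, with observed value $y$. (B2) There are a measure $\nu$ on $\mathcal Y$ and $\psi\ge0$ with $P(Y\in\mathbb B\mid X=x,Z=z,\Theta=\theta)=\int_{\mathbb B}\psi(y'\mid x,z,\theta)\,d\nu(y')$ for all Borel $\mathbb B$, continuous paths $x,z$, and $\theta\in\mathbb R^m$. (B3) $(x,z,\theta)\mapsto\psi(y\mid x,z,\theta)$ is continuous (supremum norm on paths). (B4) $\mathrm E[\psi(y\mid X,Z,\Theta)]>0$. $\mathcal W_n^2$ is the Hilbert space of absolutely continuous functions $\mathcal T\to\mathbb R^n$ with square-integrable weak derivative, with norm $\|a\|_{\mathcal W_n^2}=(|a(0)|^2+\int_0^{t_{\mathrm f}}|\dot a(t)|^2dt)^{1/2}$; $\mathrm{PL}(\mathcal P,\mathbb R^n)$ is the space of continuous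 piecewise linear functions $\mathcal T\to\mathbb R^n$ with breaks over $\mathcal P$. $\nabla_{\mathrm x}f$ is the Jacobian and $\operatorname{div}_{\mathrm x}f$ its trace. $\ln0:=-\infty$, and $\hat\ell_i(x,\zeta,\vartheta)$ (resp. $\ell(x,z_0,\theta)$) is $-\infty$ whenever $\pi(x(0),\zeta,\vartheta)=0$ (resp. $\pi(x(0),z_0,\theta)=0$), in particular when $\vartheta$ (resp. $\theta$) is not in $\operatorname{supp}(P_\Theta)$. The space $\mathcal W_n^2\times\mathbb R^q\times\mathbb R^m$ carries the product topology. Hypo-convergence: functions $g_i:\mathcal X\to\overline{\mathbb R}$ on a first-countable space hypo-converge to $g$ iff (i) for every convergent sequence $u_i\to u$, $\limsup_ig_i(u_i)\le g(u)$; and (ii) for every $u\in\mathcal X$ there is a sequence $u_i\to u$ with $\liminf_ig_i(u_i)\ge g(u)$. *)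

theory Defs
  imports "HOL-Probability.Probability"
begin

definition topological_support :: "'a::topological_space measure \<Rightarrow> 'a set" where
  "topological_support \<mu> = {x. \<forall>U. open U \<longrightarrow> x \<in> U \<longrightarrow> emeasure \<mu> U > 0}"

text \<open>Standard \<open>n\<close>-dimensional Wiener process relative to the filtration \<open>(F t)\<close>, \<open>t \<ge> 0\<close>.\<close>

definition wiener_process ::
  "'w measure \<Rightarrow> (real \<Rightarrow> 'w measure) \<Rightarrow> (real \<Rightarrow> 'w \<Rightarrow> real^'n) \<Rightarrow> bool" where
  "wiener_process M F W \<longleftrightarrow>
     (\<forall>t\<ge>0. W t \<in> borel_measurable (F t)) \<and>
     (AE \<omega> in M. W 0 \<omega> = 0) \<and>
     (AE \<omega> in M. continuous_on {0..} (\<lambda>t. W t \<omega>)) \<and>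
     (\<forall>s t. 0 \<le> s \<longrightarrow> s < t \<longrightarrow>
        distributed M lborel (\<lambda>\<omega>. W t \<omega> - W s \<omega>)
          (\<lambda>x. ennreal (\<Prod>i\<in>UNIV. normal_density 0 (sqrt (t - s)) (x $ i))) \<and>
        prob_space.indep_set M (sets (F s))
          {(\<lambda>\<omega>. W t \<omega> - W s \<omega>) -` B \<inter> space M |B. B \<in> sets borel})"

text \<open>Paths over \<open>[0,tf]\<close> are represented by functions that are \<^const>\<open>undefined\<close> outside
  \<open>{0..tf}\<close>, so that equality of functions is equality of paths.\<close>

definition sample_path :: "real \<Rightarrow> (real \<Rightarrow> 'w \<Rightarrow> 'a) \<Rightarrow> 'w \<Rightarrow> real \<Rightarrow> 'a" where
  "sample_path tf X \<omega> = (\<lambda>t\<in>{0..tf}. X t \<omega>)"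

text \<open>Continuous paths over \<open>[0,tf]\<close> with the supremum metric.\<close>

definition cpaths :: "real \<Rightarrow> (real \<Rightarrow> 'a::metric_space) metric" where
  "cpaths tf = cfunspace (top_of_set {0..tf}) euclidean_metric"

definition path_topology ::
  "real \<Rightarrow> ((real \<Rightarrow> 'a::metric_space) \<times> (real \<Rightarrow> 'b::metric_space) \<times> 'c::topological_space) topology"
where
  "path_topology tf =
     prod_topology (mtopology_of (cpaths tf)) (prod_topology (mtopology_of (cpaths tf)) euclidean)"

definition path_borel ::
  "real \<Rightarrow> ((real \<Rightarrow> 'a::metric_space) \<times> (real \<Rightarrow> 'b::metric_space) \<times> 'c::topological_space) measure"
where
  "path_borel tf = sigma (topspace (path_topology tf)) {U. openin (path_topology tf) U}"

text \<open>\<open>K x z \<theta>\<close> is the conditional law \<open>P(Y \<in> \<cdot> | X = x, Z = z, \<Theta> = \<theta>)\<close>: a probability kernel on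
  the space of continuous paths and parameters which, evaluated at \<open>(X,Z,\<Theta>)\<close>, is a version of the
  conditional probability given the sigma-algebra generated by \<open>(X,Z,\<Theta>)\<close>.\<close>

definition conditional_law ::
  "'w measure \<Rightarrow> real \<Rightarrow> (real \<Rightarrow> 'w \<Rightarrow> 'a::metric_space) \<Rightarrow> (real \<Rightarrow> 'w \<Rightarrow> 'b::metric_space)
    \<Rightarrow> ('w \<Rightarrow> 'c::topological_space) \<Rightarrow> ('w \<Rightarrow> 'y::metric_space)
    \<Rightarrow> ((real \<Rightarrow> 'a) \<Rightarrow> (real \<Rightarrow> 'b) \<Rightarrow> 'c \<Rightarrow> 'y measure) \<Rightarrow> bool" where
  "conditional_law M tf X Z \<Theta> Y K \<longleftrightarrow>
     (\<lambda>(x, z, \<theta>). K x z \<theta>) \<in> path_borel tf \<rightarrow>\<^sub>M prob_algebra borel \<and>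
     (\<forall>B\<in>sets borel. AE \<omega> in M.
        emeasure (K (sample_path tf X \<omega>) (sample_path tf Z \<omega>) (\<Theta> \<omega>)) B =
        nn_cond_exp M
          (vimage_algebra (space M)
             (\<lambda>\<omega>'. (sample_path tf X \<omega>', sample_path tf Z \<omega>', \<Theta> \<omega>')) (path_borel tf))
          (\<lambda>\<omega>'. indicator B (Y \<omega>')) \<omega>)"

definition abs_continuous_path :: "real \<Rightarrow> (real \<Rightarrow> 'a::real_normed_vector) \<Rightarrow> bool" where
  "abs_continuous_path tf a \<longleftrightarrow>
     (\<forall>\<epsilon>>0. \<exists>\<delta>>0. \<forall>(n::nat) l r.
        (\<forall>k<n. 0 \<le> l k \<and> l k \<le> r k \<and> r k \<le> tf) \<longrightarrow>
        (\<forall>j<n. \<forall>k<n. j \<noteq> k \<longrightarrow> {l j<..<r j} \<inter> {l k<..<r k} = {}) \<longrightarrow>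
        (\<Sum>k<n. r k - l k) < \<delta> \<longrightarrow>
        (\<Sum>k<n. norm (a (r k) - a (l k))) < \<epsilon>)"

text \<open>\<open>g\<close> is a weak derivative of \<open>a\<close> on \<open>(0,tf)\<close>; test functions are the continuously
  differentiable ones with compact support in the open interval.\<close>

definition weak_derivative ::
  "real \<Rightarrow> (real \<Rightarrow> 'a::euclidean_space) \<Rightarrow> (real \<Rightarrow> 'a) \<Rightarrow> bool" where
  "weak_derivative tf a g \<longleftrightarrow>
     set_integrable lebesgue {0..tf} g \<and>
     (\<forall>\<phi> \<phi>' :: real \<Rightarrow> real.
        (\<forall>t. (\<phi> has_real_derivative \<phi>' t) (at t)) \<longrightarrow> continuous_on UNIV \<phi>' \<longrightarrow>
        (\<exists>K. compact K \<and> K \<subseteq> {0<..<tf} \<and> (\<forall>t. t \<notin> K \<longrightarrow> \<phi> t = 0)) \<longrightarrow>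
        (LINT t:{0..tf}|lebesgue. \<phi>' t *\<^sub>R a t) = - (LINT t:{0..tf}|lebesgue. \<phi> t *\<^sub>R g t))"

definition W2 :: "real \<Rightarrow> (real \<Rightarrow> 'a::euclidean_space) set" where
  "W2 tf = {a \<in> extensional {0..tf}. abs_continuous_path tf a \<and>
     (\<exists>g. weak_derivative tf a g \<and> set_integrable lebesgue {0..tf} (\<lambda>t. (norm (g t))\<^sup>2))}"

text \<open>The weak derivative is determined only almost everywhere; \<open>wderiv\<close> picks a representative
  and is used only under integrals.\<close>

definition wderiv :: "real \<Rightarrow> (real \<Rightarrow> 'a::euclidean_space) \<Rightarrow> real \<Rightarrow> 'a" where
  "wderiv tf a = (SOME g. weak_derivative tf a g)"

definition W2_norm :: "real \<Rightarrow> (real \<Rightarrow> 'a::euclidean_space) \<Rightarrow> real" where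
  "W2_norm tf a =
     sqrt ((norm (a 0))\<^sup>2 + (LINT t:{0..tf}|lebesgue. (norm (wderiv tf a t))\<^sup>2))"

definition W2_dist :: "real \<Rightarrow> (real \<Rightarrow> 'a::euclidean_space) \<Rightarrow> (real \<Rightarrow> 'a) \<Rightarrow> real" where
  "W2_dist tf a b = W2_norm tf (\<lambda>t\<in>{0..tf}. a t - b t)"

definition W2_topology :: "real \<Rightarrow> (real \<Rightarrow> 'a::euclidean_space) topology" where
  "W2_topology tf = Metric_space.mtopology (W2 tf) (W2_dist tf)"

text \<open>Sequential form of hypo-convergence; meant for first-countable \<open>\<X>\<close>.\<close>

definition hypo_converges :: "'a topology \<Rightarrow> (nat \<Rightarrow> 'a \<Rightarrow> ereal) \<Rightarrow> ('a \<Rightarrow> ereal) \<Rightarrow> bool" where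
  "hypo_converges \<X> g g' \<longleftrightarrow>
     (\<forall>u v. (\<forall>i. u i \<in> topspace \<X>) \<longrightarrow> limitin \<X> u v sequentially \<longrightarrow>
        limsup (\<lambda>i. g i (u i)) \<le> g' v) \<and>
     (\<forall>v\<in>topspace \<X>. \<exists>u. (\<forall>i. u i \<in> topspace \<X>) \<and> limitin \<X> u v sequentially \<and>
        g' v \<le> liminf (\<lambda>i. g i (u i)))"

text \<open>Natural logarithm with \<open>ln 0 = -\<infinity>\<close>; it is only meant for nonnegative arguments.\<close>

definition eln :: "real \<Rightarrow> ereal" where
  "eln r = (if r \<le> 0 then -\<infinity> else ereal (ln r))"

definition ode_path ::
  "real \<Rightarrow> (real \<Rightarrow> 'a \<Rightarrow> 'b::euclidean_space \<Rightarrow> 'c \<Rightarrow> 'b) \<Rightarrow> (real \<Rightarrow> 'a) \<Rightarrow> 'b \<Rightarrow> 'c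
    \<Rightarrow> real \<Rightarrow> 'b" where
  "ode_path tf h x z\<^sub>0 \<theta> =
     (THE z. z \<in> W2 tf \<and> z 0 = z\<^sub>0 \<and> weak_derivative tf z (\<lambda>t. h t (x t) (z t) \<theta>))"

definition log_posterior ::
  "real \<Rightarrow> (real \<Rightarrow> real^'n \<Rightarrow> real^'q \<Rightarrow> real^'m \<Rightarrow> real^'n)
    \<Rightarrow> (real \<Rightarrow> real^'n \<Rightarrow> real^'q \<Rightarrow> real^'m \<Rightarrow> real^'q)
    \<Rightarrow> real^'n^'n \<Rightarrow> (real^'n \<Rightarrow> real^'q \<Rightarrow> real^'m \<Rightarrow> real)
    \<Rightarrow> ('y \<Rightarrow> (real \<Rightarrow> real^'n) \<Rightarrow> (real \<Rightarrow> real^'q) \<Rightarrow> real^'m \<Rightarrow> real) \<Rightarrow> 'y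
    \<Rightarrow> (real \<Rightarrow> real^'n) \<times> (real^'q) \<times> (real^'m) \<Rightarrow> ereal" where
  "log_posterior tf f h G \<pi> \<psi> y = (\<lambda>(x, z\<^sub>0, \<theta>).
     if \<pi> (x 0) z\<^sub>0 \<theta> = 0 then -\<infinity>
     else let z = ode_path tf h x z\<^sub>0 \<theta> in
       eln (\<psi> y x z \<theta>) + eln (\<pi> (x 0) z\<^sub>0 \<theta>)
       - ereal (1/2 * (LINT t:{0..tf}|lebesgue.
           (norm (matrix_inv G *v (f t (x t) (z t) \<theta> - wderiv tf x t)))\<^sup>2))
       - ereal (1/2 * (LINT t:{0..tf}|lebesgue.
           trace (jacobian (\<lambda>\<xi>. f t \<xi> (z t) \<theta>) (at (x t))))))"

text \<open>A partition \<open>0 = \<tau> 0 < \<dots> < \<tau> N = tf\<close> is given by \<open>N\<close> and \<open>\<tau>\<close>; only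
  the values \<open>\<tau> 0, \<dots>, \<tau> N\<close> matter.\<close>

definition partition_of :: "real \<Rightarrow> nat \<Rightarrow> (nat \<Rightarrow> real) \<Rightarrow> bool" where
  "partition_of tf N \<tau> \<longleftrightarrow> \<tau> 0 = 0 \<and> \<tau> N = tf \<and> (\<forall>k<N. \<tau> k < \<tau> (Suc k))"

definition mesh :: "nat \<Rightarrow> (nat \<Rightarrow> real) \<Rightarrow> real" where
  "mesh N \<tau> = Max ((\<lambda>k. \<tau> (Suc k) - \<tau> k) ` {..<N})"

definition PL :: "real \<Rightarrow> nat \<Rightarrow> (nat \<Rightarrow> real) \<Rightarrow> (real \<Rightarrow> 'a::real_normed_vector) set" where
  "PL tf N \<tau> = {x \<in> extensional {0..tf}. continuous_on {0..tf} x \<and>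
     (\<forall>k<N. \<exists>a b. \<forall>t\<in>{\<tau> k..\<tau> (Suc k)}. x t = a + t *\<^sub>R b)}"

definition trapezoidal_path ::
  "real \<Rightarrow> (real \<Rightarrow> 'a \<Rightarrow> 'b::real_normed_vector \<Rightarrow> 'c \<Rightarrow> 'b) \<Rightarrow> nat \<Rightarrow> (nat \<Rightarrow> real)
    \<Rightarrow> (real \<Rightarrow> 'a) \<Rightarrow> 'b \<Rightarrow> 'c \<Rightarrow> real \<Rightarrow> 'b" where
  "trapezoidal_path tf h N \<tau> x \<zeta> \<theta> =
     (THE z. z \<in> PL tf N \<tau> \<and> z 0 = \<zeta> \<and>
        (\<forall>k<N. \<forall>t\<in>{\<tau> k<..\<tau> (Suc k)}.
           z t = z (\<tau> k) + (1/2 * (t - \<tau> k)) *\<^sub>R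
             (h (\<tau> k) (x (\<tau> k)) (z (\<tau> k)) \<theta> +
              h (\<tau> (Suc k)) (x (\<tau> (Suc k))) (z (\<tau> (Suc k))) \<theta>)))"

definition trapezoidal_log_posterior ::
  "real \<Rightarrow> (real \<Rightarrow> real^'n \<Rightarrow> real^'q \<Rightarrow> real^'m \<Rightarrow> real^'n)
    \<Rightarrow> (real \<Rightarrow> real^'n \<Rightarrow> real^'q \<Rightarrow> real^'m \<Rightarrow> real^'q)
    \<Rightarrow> real^'n^'n \<Rightarrow> (real^'n \<Rightarrow> real^'q \<Rightarrow> real^'m \<Rightarrow> real)
    \<Rightarrow> ('y \<Rightarrow> (real \<Rightarrow> real^'n) \<Rightarrow> (real \<Rightarrow> real^'q) \<Rightarrow> real^'m \<Rightarrow> real) \<Rightarrow> 'y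
    \<Rightarrow> nat \<Rightarrow> (nat \<Rightarrow> real)
    \<Rightarrow> (real \<Rightarrow> real^'n) \<times> (real^'q) \<times> (real^'m) \<Rightarrow> ereal" where
  "trapezoidal_log_posterior tf f h G \<pi> \<psi> y N \<tau> = (\<lambda>(x, \<zeta>, \<theta>).
     if x \<notin> PL tf N \<tau> \<or> \<pi> (x 0) \<zeta> \<theta> = 0 then -\<infinity>
     else
       let z = trapezoidal_path tf h N \<tau> x \<zeta> \<theta>;
           \<delta> = (\<lambda>k. \<tau> (Suc k) - \<tau> k);
           fh = (\<lambda>k. f (\<tau> k) (x (\<tau> k)) (z (\<tau> k)) \<theta>)
       in
       eln (\<psi> y x z \<theta>) + eln (\<pi> (x 0) \<zeta> \<theta>)
       + (\<Sum>k<N. eln (det (mat 1 - (1/2 * \<delta> k) *\<^sub>R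
             jacobian (\<lambda>\<xi>. f (\<tau> (Suc k)) \<xi> (z (\<tau> (Suc k))) \<theta>) (at (x (\<tau> (Suc k)))))))
       - ereal (1/2 * (\<Sum>k<N. \<delta> k *
             (norm (matrix_inv G *v
                ((x (\<tau> (Suc k)) - x (\<tau> k)) /\<^sub>R \<delta> k - (1/2) *\<^sub>R fh k - (1/2) *\<^sub>R fh (Suc k))))\<^sup>2)))"

end

theory Submission
  imports Defs
begin

text \<open>Why the discretized log-posteriors hypo-converge. Paths converge in the strong topology of the
  Sobolev space, so no term of the log-posterior is lost in a limit: along every sequence of
  piecewise linear paths, initial states and parameters that converges and on which the prior
  density \<open>\<pi>\<close> does not vanish, the discretized values actually converge to the
  continuous one (\<open>trapezoidal_log_posterior_tendsto\<close>). The inequality for the upper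
  limit follows: if it failed, it would fail along a subsequence of values bounded away from
  \<open>-\<infinity>\<close>, hence of piecewise linear paths with nonvanishing
  \<open>\<pi>\<close>. The recovery sequences exist because piecewise linear paths over the
  partitions that keep the initial value of a given path come arbitrarily close to it
  (\<open>PL_dense\<close>).

  The terms converge for the following reasons. Convergence in the Sobolev space implies uniform
  convergence (\<open>W2_dist_imp_sup_le\<close>), and a discrete Gronwall estimate carries this
  over to the auxiliary states: the trapezoidal solutions converge uniformly to the solution of the
  differential equation (\<open>trapezoidal_path_uniform_limit_ode_path\<close>). This settles the
  likelihood and the prior, both of which are continuous; the logarithm is continuous down to
  \<open>0\<close> as an extended real function, which covers the limits at which
  \<open>\<pi>\<close> or \<open>\<psi>\<close> vanishes. For a matrix \<open>J\<close> in a bounded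
  set, \<open>ln (det (I - (\<delta>/2) J)) = - (\<delta>/2) tr J + O(\<delta>\<^sup>2)\<close>, so
  the sum of log-determinants is a Riemann sum of \<open>- (1/2) div f\<close> up to an error of the
  order of the mesh (\<open>log_det_sum_tendsto\<close>). Finally, the difference quotients of a
  piecewise linear path are the values of its weak derivative, so the sum of squares is exactly an
  integral: it is the squared \<open>L\<^sup>2\<close>-norm of \<open>inverse(G) (x' - F)\<close>
  with \<open>F\<close> the step function of averaged drifts. Here the derivatives converge in
  \<open>L\<^sup>2\<close> by hypothesis and the drifts by dominated convergence.

  The regularity of \<open>f\<close> and \<open>h\<close> is available only for parameters in the
  support of the law of \<open>\<Theta>\<close>. A parameter with positive continuous density lies
  in it (\<open>density_pos_imp_in_support\<close>), and it is closed, so that limits stay inside.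

  The function space is built from weak derivatives tested against \<open>C\<^sup>1\<close>
  functions. Testing with smoothed indicators of intervals yields the fundamental theorem of
  calculus (\<open>weak_derivative_imp_integral\<close>), from which the uniqueness of the weak
  derivative, the metric axioms and the equivalence of the differential equation with a Volterra
  equation are derived.\<close>

section \<open>Partitions and step functions\<close>

text \<open>The cells are open on the left, as in the trapezoidal rule. Hence a step function vanishes at
  \<open>0\<close>, and identities between step functions hold on \<open>{0<..T}\<close> only.\<close>

definition step_fun :: "nat \<Rightarrow> (nat \<Rightarrow> real) \<Rightarrow> (nat \<Rightarrow> 'a::real_vector) \<Rightarrow> real \<Rightarrow> 'a" where
  "step_fun N \<tau> c t = (\<Sum>k<N. indicator {\<tau> k<..\<tau> (Suc k)} t *\<^sub>R c k)"

lemma partition_mono: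
  assumes "partition_of T N \<tau>" "i \<le> j" "j \<le> N"
  shows "\<tau> i \<le> \<tau> j"
  using assms(2,3)
proof (induction j rule: dec_induct)
  case (step n)
  then have "\<tau> i \<le> \<tau> n" "\<tau> n < \<tau> (Suc n)" using assms(1) by (auto simp: partition_of_def)
  then show ?case by simp
qed simp

lemma partition_range:
  assumes "partition_of T N \<tau>" "k \<le> N"
  shows "0 \<le> \<tau> k" "\<tau> k \<le> T"
  using partition_mono[OF assms(1), of 0 k] partition_mono[OF assms(1), of k N] assms
  by (auto simp: partition_of_def)

lemma partition_cell_exists:
  assumes "partition_of T N \<tau>" "t \<in> {0<..T}"
  obtains k where "k < N" "t \<in> {\<tau> k<..\<tau> (Suc k)}"
proof -
  define k where "k = (LEAST k. t \<le> \<tau> k)"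
  have ex: "t \<le> \<tau> N" using assms by (auto simp: partition_of_def)
  have 1: "t \<le> \<tau> k" unfolding k_def using ex by (rule LeastI)
  have 2: "k \<le> N" unfolding k_def using ex by (rule Least_le)
  have "k \<noteq> 0" using 1 assms by (auto simp: partition_of_def intro!: Nat.gr0I)
  then obtain j where j: "k = Suc j" by (cases k) auto
  have "\<not> t \<le> \<tau> j" using not_less_Least[of j "\<lambda>k. t \<le> \<tau> k"] j k_def by auto
  with 1 2 j show thesis by (intro that[of j]) auto
qed

lemma step_fun_on_cell:
  assumes "partition_of T N \<tau>" "k < N" "t \<in> {\<tau> k<..\<tau> (Suc k)}"
  shows "step_fun N \<tau> c t = c k"
proof -
  have "t \<notin> {\<tau> j<..\<tau> (Suc j)}" if "j < N" "j \<noteq> k" for j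
    using that assms partition_mono[OF assms(1), of "Suc j" k] partition_mono[OF assms(1), of "Suc k" j]
    by (cases "j < k") auto
  then have "step_fun N \<tau> c t = (\<Sum>j<N. if j = k then c k else 0)"
    unfolding step_fun_def using assms(3) by (intro sum.cong) auto
  also have "\<dots> = c k" using assms(2) by simp
  finally show ?thesis .
qed

lemma step_fun_comp:
  assumes "partition_of T N \<tau>" "t \<in> {0<..T}"
  shows "\<phi> (step_fun N \<tau> c t) = step_fun N \<tau> (\<lambda>k. \<phi> (c k)) t"
  by (metis partition_cell_exists[OF assms] step_fun_on_cell[OF assms(1)])

lemma step_fun_has_integral:
  fixes c :: "nat \<Rightarrow> 'a::euclidean_space"
  assumes "partition_of T N \<tau>"
  shows "(step_fun N \<tau> c has_integral (\<Sum>k<N. (\<tau> (Suc k) - \<tau> k) *\<^sub>R c k)) {0..T}"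
  unfolding step_fun_def
proof (rule has_integral_sum)
  fix k assume "k \<in> {..<N}"
  then have k: "0 \<le> \<tau> k" "\<tau> k \<le> \<tau> (Suc k)" "\<tau> (Suc k) \<le> T"
    using partition_range[OF assms] partition_mono[OF assms, of k "Suc k"] by auto
  have "((\<lambda>t. c k) has_integral (\<tau> (Suc k) - \<tau> k) *\<^sub>R c k) {\<tau> k..\<tau> (Suc k)}"
    using has_integral_const_real[of "c k" "\<tau> k" "\<tau> (Suc k)"] k by simp
  then have "((\<lambda>t. if t \<in> {\<tau> k..\<tau> (Suc k)} then c k else 0) has_integral (\<tau> (Suc k) - \<tau> k) *\<^sub>R c k) {0..T}"
    using k by (subst has_integral_restrict) auto
  then show "((\<lambda>t. indicator {\<tau> k<..\<tau> (Suc k)} t *\<^sub>R c k) has_integral (\<tau> (Suc k) - \<tau> k) *\<^sub>R c k) {0..T}"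
    by (rule has_integral_spike[rotated 2, of _ _ _ "{\<tau> k}"]) (auto simp: indicator_def)
qed simp

lemma step_fun_absolutely_integrable:
  fixes c :: "nat \<Rightarrow> 'a::euclidean_space"
  assumes "partition_of T N \<tau>"
  shows "step_fun N \<tau> c absolutely_integrable_on {0..T}"
proof (rule absolutely_integrable_onI)
  show "step_fun N \<tau> c integrable_on {0..T}"
    using step_fun_has_integral[OF assms] by (auto simp: integrable_on_def)
  have "step_fun N \<tau> (\<lambda>k. norm (c k)) integrable_on {0..T}"
    using step_fun_has_integral[OF assms] unfolding integrable_on_def by blast
  then show "(\<lambda>t. norm (step_fun N \<tau> c t)) integrable_on {0..T}"
    by (rule integrable_spike[of _ _ "{0}"]) (auto simp: step_fun_comp[OF assms])
qed

lemma cell_le_mesh: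
  assumes "k < N"
  shows "\<tau> (Suc k) - \<tau> k \<le> mesh N \<tau>"
  unfolding mesh_def using assms by (intro Max_ge) auto

text \<open>Reduces pointwise limits of step functions to limits of ordinary sequences: \<open>k i\<close> is the cell
  around \<open>t\<close> in the \<open>i\<close>-th partition, and the mesh bounds its distance from \<open>t\<close>.\<close>

lemma step_fun_endpoints_tendsto:
  assumes P: "\<And>i. partition_of T (N i) (\<tau> i)" and m: "(\<lambda>i. mesh (N i) (\<tau> i)) \<longlonglongrightarrow> 0"
    and t: "t \<in> {0<..T}"
  obtains k where "\<And>i. k i < N i" "\<And>i. t \<in> {\<tau> i (k i)<..\<tau> i (Suc (k i))}"
     "(\<lambda>i. \<tau> i (k i)) \<longlonglongrightarrow> t" "(\<lambda>i. \<tau> i (Suc (k i))) \<longlonglongrightarrow> t"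
proof -
  have "\<forall>i. \<exists>k. k < N i \<and> t \<in> {\<tau> i k<..\<tau> i (Suc k)}"
    using partition_cell_exists[OF P t] by metis
  then obtain k where k: "\<And>i. k i < N i" "\<And>i. t \<in> {\<tau> i (k i)<..\<tau> i (Suc (k i))}" by metis
  have b: "\<tau> i (Suc (k i)) - \<tau> i (k i) \<le> mesh (N i) (\<tau> i)" for i
    by (rule cell_le_mesh[OF k(1)])
  have "(\<lambda>i. \<tau> i (k i)) \<longlonglongrightarrow> t"
  proof (rule Lim_transform2[OF tendsto_const])
    show "(\<lambda>i. t - \<tau> i (k i)) \<longlonglongrightarrow> 0"
    proof (rule Lim_null_comparison[OF _ m], rule always_eventually, rule allI)
      fix i show "norm (t - \<tau> i (k i)) \<le> mesh (N i) (\<tau> i)" using b[of i] k(2)[of i] by auto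
    qed
  qed
  moreover have "(\<lambda>i. \<tau> i (Suc (k i))) \<longlonglongrightarrow> t"
  proof (rule Lim_transform2[OF tendsto_const])
    show "(\<lambda>i. t - \<tau> i (Suc (k i))) \<longlonglongrightarrow> 0"
    proof (rule Lim_null_comparison[OF _ m], rule always_eventually, rule allI)
      fix i show "norm (t - \<tau> i (Suc (k i))) \<le> mesh (N i) (\<tau> i)" using b[of i] k(2)[of i] by auto
    qed
  qed
  ultimately show thesis using that k by blast
qed

lemma step_fun_sample_tendsto:
  fixes c :: "real \<Rightarrow> 'a::real_normed_vector"
  assumes P: "\<And>i. partition_of T (N i) (\<tau> i)" and m: "(\<lambda>i. mesh (N i) (\<tau> i)) \<longlonglongrightarrow> 0"
    and c: "continuous_on {0..T} c" and t: "t \<in> {0<..T}"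
  shows "(\<lambda>i. step_fun (N i) (\<tau> i) (\<lambda>k. c (\<tau> i k)) t) \<longlonglongrightarrow> c t"
proof -
  obtain k where k: "\<And>i. k i < N i" "\<And>i. t \<in> {\<tau> i (k i)<..\<tau> i (Suc (k i))}" "(\<lambda>i. \<tau> i (k i)) \<longlonglongrightarrow> t"
    using step_fun_endpoints_tendsto[OF P m t] by metis
  have "(\<lambda>i. c (\<tau> i (k i))) \<longlonglongrightarrow> c t"
    using partition_range[OF P less_imp_le[OF k(1)]] t
    by (intro continuous_on_tendsto_compose[OF c k(3)]) (auto intro!: always_eventually)
  moreover have "step_fun (N i) (\<tau> i) (\<lambda>k. c (\<tau> i k)) t = c (\<tau> i (k i))" for i
    using step_fun_on_cell[OF P k(1,2)] by fast
  ultimately show ?thesis by simp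
qed

lemma step_fun_norm_le:
  fixes c :: "nat \<Rightarrow> 'a::real_normed_vector"
  assumes "partition_of T N \<tau>" "\<And>k. k < N \<Longrightarrow> norm (c k) \<le> B" "0 \<le> B" "t \<in> {0..T}"
  shows "norm (step_fun N \<tau> c t) \<le> B"
proof (cases "t = 0")
  case True
  have "step_fun N \<tau> c 0 = 0"
    unfolding step_fun_def using partition_range[OF assms(1)]
    by (intro sum.neutral ballI) (auto simp: indicator_def not_less less_imp_le)
  then show ?thesis using assms(3) True by simp
next
  case False
  then have "t \<in> {0<..T}" using assms(4) by auto
  then obtain k where "k < N" "t \<in> {\<tau> k<..\<tau> (Suc k)}" using partition_cell_exists[OF assms(1)] by metis
  then show ?thesis using step_fun_on_cell[OF assms(1), of k t c] assms(2)[of k] by simp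
qed

section \<open>Square-integrable functions on an interval\<close>

definition square_integrable :: "real \<Rightarrow> (real \<Rightarrow> 'a::euclidean_space) \<Rightarrow> bool" where
  "square_integrable T g \<longleftrightarrow>
     g \<in> borel_measurable (lebesgue_on {0..T}) \<and> (\<lambda>t. (norm (g t))\<^sup>2) integrable_on {0..T}"

definition sq_integral :: "real \<Rightarrow> (real \<Rightarrow> 'a::euclidean_space) \<Rightarrow> real" where
  "sq_integral T g = integral {0..T} (\<lambda>t. (norm (g t))\<^sup>2)"

lemma square_integrableD_absolutely:
  assumes "square_integrable T g"
  shows "g absolutely_integrable_on {0..T}"
proof (rule measurable_bounded_by_integrable_imp_absolutely_integrable)
  show "g \<in> borel_measurable (lebesgue_on {0..T})" using assms by (simp add: square_integrable_def)
  show "(\<lambda>t. 1 + (norm (g t))\<^sup>2) integrable_on {0..T}"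
    using assms by (intro integrable_add) (auto simp: square_integrable_def)
  fix t show "norm (g t) \<le> 1 + (norm (g t))\<^sup>2"
    proof -
    have "0 \<le> (norm (g t) - 1)\<^sup>2" by simp
    also have "\<dots> = 1 + (norm (g t))\<^sup>2 - 2 * norm (g t)" by (simp add: power2_eq_square algebra_simps)
    finally show ?thesis using norm_ge_zero[of "g t"] by linarith
  qed
qed simp

lemma square_integrable_dominated:
  assumes "g \<in> borel_measurable (lebesgue_on {0..T})" "k integrable_on {0..T}"
    "\<And>t. t \<in> {0..T} \<Longrightarrow> (norm (g t))\<^sup>2 \<le> k t"
  shows "square_integrable T g"
  unfolding square_integrable_def
proof
  show "(\<lambda>t. (norm (g t))\<^sup>2) integrable_on {0..T}"
    by (rule measurable_bounded_by_integrable_imp_integrable[OF _ assms(2)]) (use assms in auto)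
qed fact

lemma square_integrable_bounded:
  assumes "g \<in> borel_measurable (lebesgue_on {0..T})" "\<And>t. t \<in> {0..T} \<Longrightarrow> norm (g t) \<le> B"
  shows "square_integrable T g"
  by (rule square_integrable_dominated[OF assms(1), of "\<lambda>t. B\<^sup>2"]) (use assms in \<open>auto intro!: power_mono\<close>)

lemma square_integrable_continuous:
  assumes "continuous_on {0..T} g"
  shows "square_integrable T g"
proof -
  have "bounded (g ` {0..T})" by (intro compact_imp_bounded compact_continuous_image assms) auto
  then obtain B where "\<And>t. t \<in> {0..T} \<Longrightarrow> norm (g t) \<le> B" unfolding bounded_iff by blast
  then show ?thesis
    by (intro square_integrable_bounded continuous_imp_measurable_on_sets_lebesgue assms) auto
qed

lemma norm_add_sq_le:
  fixes a b :: "'a::real_inner"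
  assumes "s > 0"
  shows "(norm (a + b))\<^sup>2 \<le> (1 + s) * (norm a)\<^sup>2 + (1 + 1/s) * (norm b)\<^sup>2"
proof -
  have "0 \<le> (norm (s *\<^sub>R a - b))\<^sup>2 / s" using assms by simp
  also have "\<dots> = s * (norm a)\<^sup>2 + (1/s) * (norm b)\<^sup>2 - 2 * (a \<bullet> b)"
    using assms unfolding power2_norm_eq_inner
    by (simp add: inner_diff_left inner_diff_right inner_commute field_simps)
  finally show ?thesis
    unfolding power2_norm_eq_inner by (simp add: inner_add_left inner_add_right inner_commute algebra_simps)
qed

lemma square_integrable_add:
  assumes "square_integrable T u" "square_integrable T v"
  shows "square_integrable T (\<lambda>t. u t + v t)"
proof (rule square_integrable_dominated)
  show "(\<lambda>t. u t + v t) \<in> borel_measurable (lebesgue_on {0..T})"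
    using assms by (auto simp: square_integrable_def)
  show "(\<lambda>t. (1 + 1) * (norm (u t))\<^sup>2 + (1 + 1/1) * (norm (v t))\<^sup>2) integrable_on {0..T}"
    using assms unfolding square_integrable_def by (intro integrable_add integrable_on_mult_right) auto
qed (rule norm_add_sq_le, simp)

lemma square_integrable_linear:
  assumes "square_integrable T u" "bounded_linear A"
  shows "square_integrable T (\<lambda>t. A (u t))"
proof -
  interpret bounded_linear A by fact
  obtain C where C: "\<And>v. norm (A v) \<le> norm v * C" using bounded by blast
  show ?thesis
  proof (rule square_integrable_dominated)
    show "(\<lambda>t. A (u t)) \<in> borel_measurable (lebesgue_on {0..T})"
      using assms(1) borel_measurable_continuous_onI[OF linear_continuous_on[OF assms(2)]]
      by (auto simp: square_integrable_def)
    show "(\<lambda>t. (norm (u t))\<^sup>2 * C\<^sup>2) integrable_on {0..T}"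
      using assms(1) unfolding square_integrable_def by (intro integrable_on_mult_left) auto
    show "(norm (A (u t)))\<^sup>2 \<le> (norm (u t))\<^sup>2 * C\<^sup>2" for t
      using power_mono[OF C[of "u t"], of 2] by (simp add: power_mult_distrib)
  qed
qed

lemma square_integrable_diff:
  assumes "square_integrable T u" "square_integrable T v"
  shows "square_integrable T (\<lambda>t. u t - v t)"
  using square_integrable_add[OF assms(1) square_integrable_linear[OF assms(2) bounded_linear_minus[OF bounded_linear_ident]]]
  by simp

lemma sq_integral_nonneg:
  "0 \<le> sq_integral T g"
  unfolding sq_integral_def
  by (metis (no_types, lifting) integral_nonneg not_integrable_integral order_refl zero_le_power2)

text \<open>The parametric form of Minkowski's inequality: minimizing the right-hand side over \<open>s\<close> gives
  the triangle inequality for the square roots.\<close>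

lemma sq_integral_add_le:
  assumes "square_integrable T u" "square_integrable T v" "s > 0"
  shows "sq_integral T (\<lambda>t. u t + v t) \<le> (1 + s) * sq_integral T u + (1 + 1/s) * sq_integral T v"
proof -
  have i1: "(\<lambda>t. (1 + s) * (norm (u t))\<^sup>2) integrable_on {0..T}"
    by (rule integrable_on_mult_right) (use assms in \<open>simp add: square_integrable_def\<close>)
  have i2: "(\<lambda>t. (1 + 1/s) * (norm (v t))\<^sup>2) integrable_on {0..T}"
    by (rule integrable_on_mult_right) (use assms in \<open>simp add: square_integrable_def\<close>)
  note i = i1 i2
  have "sq_integral T (\<lambda>t. u t + v t) \<le> integral {0..T} (\<lambda>t. (1 + s) * (norm (u t))\<^sup>2 + (1 + 1/s) * (norm (v t))\<^sup>2)"
    unfolding sq_integral_def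
  proof (rule integral_le)
    show "(\<lambda>t. (norm (u t + v t))\<^sup>2) integrable_on {0..T}"
      using square_integrable_add[OF assms(1,2)] by (simp add: square_integrable_def)
  qed (use i assms in \<open>auto intro: integrable_add norm_add_sq_le\<close>)
  also have "\<dots> = (1 + s) * sq_integral T u + (1 + 1/s) * sq_integral T v"
    unfolding sq_integral_def by (subst integral_add[OF i]) simp
  finally show ?thesis .
qed

text \<open>The inequality of arithmetic and geometric means takes the place of Cauchy-Schwarz; a good choice
  of \<open>s\<close> is of the size of the norm of \<open>g\<close>.\<close>

lemma integral_norm_le_sq_integral:
  assumes "square_integrable T g" "s > 0" "0 \<le> T"
  shows "integral {0..T} (\<lambda>t. norm (g t)) \<le> (s * T + sq_integral T g / s) / 2"
proof -
  have i: "(\<lambda>t. (norm (g t))\<^sup>2) integrable_on {0..T}" using assms by (simp add: square_integrable_def)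
  have "integral {0..T} (\<lambda>t. norm (g t)) \<le> integral {0..T} (\<lambda>t. s / 2 + (norm (g t))\<^sup>2 * (1 / (2 * s)))"
  proof (rule integral_le)
    show "(\<lambda>t. norm (g t)) integrable_on {0..T}"
      using square_integrableD_absolutely[OF assms(1)] by (simp add: absolutely_integrable_on_def)
    show "(\<lambda>t. s / 2 + (norm (g t))\<^sup>2 * (1 / (2 * s))) integrable_on {0..T}"
      using i by (intro integrable_add integrable_on_mult_left) auto
    fix t
    have "0 \<le> (norm (g t) - s)\<^sup>2 / (2 * s)" using assms by simp
    then show "norm (g t) \<le> s / 2 + (norm (g t))\<^sup>2 * (1 / (2 * s))"
      using assms(2) by (simp add: power2_eq_square field_simps)
  qed
  also have "\<dots> = (s * T + sq_integral T g / s) / 2"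
    unfolding sq_integral_def using i assms
    by (subst integral_add) (auto intro: integrable_on_mult_left simp: field_simps)
  finally show ?thesis .
qed

lemma dominated_convergence_negligible:
  fixes f :: "nat \<Rightarrow> 'n::euclidean_space \<Rightarrow> 'm::euclidean_space"
  assumes "negligible N" and f: "\<And>k. f k integrable_on S" and h: "h integrable_on S"
    and le: "\<And>k x. x \<in> S - N \<Longrightarrow> norm (f k x) \<le> h x"
    and conv: "\<And>x. x \<in> S - N \<Longrightarrow> (\<lambda>k. f k x) \<longlonglongrightarrow> g x"
  shows "g integrable_on S" "(\<lambda>k. integral S (f k)) \<longlonglongrightarrow> integral S g"
proof -
  have n1: "negligible {x \<in> S - (S - N). F x \<noteq> 0}" for F :: "_ \<Rightarrow> 'm"
    by (rule negligible_subset[OF assms(1)]) auto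
  have n2: "negligible {x \<in> (S - N) - S. F x \<noteq> 0}" for F :: "_ \<Rightarrow> 'm"
    by (rule negligible_subset[OF assms(1)]) auto
  have n1': "negligible {x \<in> S - (S - N). h x \<noteq> 0}"
    by (rule negligible_subset[OF assms(1)]) auto
  have e: "F integrable_on (S - N) \<longleftrightarrow> F integrable_on S" for F :: "_ \<Rightarrow> 'm"
    using integrable_spike_set[OF _ n1 n2] integrable_spike_set[OF _ n2 n1] by metis
  have e': "integral (S - N) F = integral S F" for F :: "_ \<Rightarrow> 'm"
    using integral_spike_set[OF n1 n2] integral_spike_set[OF n2 n1] by metis
  have h': "h integrable_on (S - N)"
    by (rule integrable_spike_set[OF h n1']) (rule negligible_subset[OF assms(1)], auto)
  have f': "f k integrable_on (S - N)" for k using f e by blast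
  from dominated_convergence[OF f' h' le conv]
  show "g integrable_on S" "(\<lambda>k. integral S (f k)) \<longlonglongrightarrow> integral S g"
    using e e' by auto
qed

text \<open>The radial retraction onto the closed ball of radius \<open>M\<close>. Unlike a cut-off by an indicator
  function it is continuous, so it can be applied to continuous approximants.\<close>

definition radial_clip :: "real \<Rightarrow> 'a::real_normed_vector \<Rightarrow> 'a" where
  "radial_clip M v = (M / max M (norm v)) *\<^sub>R v"

lemma norm_radial_clip: "M > 0 \<Longrightarrow> norm (radial_clip M v) \<le> M"
  by (auto simp: radial_clip_def field_simps max_def)

lemma norm_radial_clip_le: "M > 0 \<Longrightarrow> norm (radial_clip M v) \<le> norm v"
  by (auto simp: radial_clip_def field_simps max_def intro: mult_right_mono)

lemma radial_clip_eq: "M > 0 \<Longrightarrow> norm v \<le> M \<Longrightarrow> radial_clip M v = v"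
  by (auto simp: radial_clip_def max_def)

lemma continuous_on_radial_clip: "M > 0 \<Longrightarrow> continuous_on S (radial_clip M)"
  unfolding radial_clip_def by (intro continuous_intros) (auto simp: max_def)

text \<open>A measurable function is almost everywhere a limit of continuous functions. Clipping these
  preserves their limit and makes them uniformly bounded, as dominated convergence demands.\<close>

lemma bounded_measurable_limit_continuous:
  fixes g :: "real \<Rightarrow> 'a::euclidean_space"
  assumes "g \<in> borel_measurable (lebesgue_on {0..T})" "M > 0" "\<And>t. t \<in> {0..T} \<Longrightarrow> norm (g t) \<le> M"
  obtains N c where "negligible N" "\<And>n::nat. continuous_on UNIV (c n)" "\<And>n t. norm (c n t) \<le> M"
    "\<And>t. t \<in> {0..T} - N \<Longrightarrow> (\<lambda>n. c n t) \<longlonglongrightarrow> g t"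
proof -
  have "g measurable_on {0..T}" using assms(1) by (subst measurable_on_iff_borel_measurable) auto
  then obtain N d where N: "negligible N" and d: "\<And>n::nat. continuous_on UNIV (d n)"
    and lim: "\<And>t. t \<notin> N \<Longrightarrow> (\<lambda>n. d n t) \<longlonglongrightarrow> (if t \<in> {0..T} then g t else 0)"
    unfolding measurable_on_def by metis
  show thesis
  proof (rule that[OF N])
    show "continuous_on UNIV (\<lambda>t. radial_clip M (d n t))" for n
      by (rule continuous_on_compose2[OF continuous_on_radial_clip[OF assms(2)] d]) auto
    show "norm (radial_clip M (d n t)) \<le> M" for n t by (rule norm_radial_clip[OF assms(2)])
    fix t assume t: "t \<in> {0..T} - N"
    then have "(\<lambda>n. d n t) \<longlonglongrightarrow> g t" using lim[of t] by auto
    then have "(\<lambda>n. radial_clip M (d n t)) \<longlonglongrightarrow> radial_clip M (g t)"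
      by (rule continuous_on_tendsto_compose[OF continuous_on_radial_clip[OF assms(2), of UNIV]]) auto
    then show "(\<lambda>n. radial_clip M (d n t)) \<longlonglongrightarrow> g t"
      using radial_clip_eq[OF assms(2) assms(3)[of t]] t by simp
  qed
qed

lemma uniform_partition:
  assumes "T > 0"
  shows "partition_of T (Suc n) (\<lambda>k. real k * T / real (Suc n))"
    and "(\<lambda>n. mesh (Suc n) (\<lambda>k. real k * T / real (Suc n))) \<longlonglongrightarrow> 0"
proof -
  show "partition_of T (Suc n) (\<lambda>k. real k * T / real (Suc n))"
    using assms by (auto simp: partition_of_def divide_strict_right_mono)
  have "mesh (Suc n) (\<lambda>k. real k * T / real (Suc n)) = T / real (Suc n)" for n
  proof -
    have "real (Suc k) * T / real (Suc n) - real k * T / real (Suc n) = T / real (Suc n)" for k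
      by (simp add: diff_divide_distrib[symmetric] algebra_simps)
    then have "(\<lambda>k. real (Suc k) * T / real (Suc n) - real k * T / real (Suc n)) ` {..<Suc n} = {T / real (Suc n)}"
      by auto
    then show ?thesis unfolding mesh_def by simp
  qed
  then show "(\<lambda>n. mesh (Suc n) (\<lambda>k. real k * T / real (Suc n))) \<longlonglongrightarrow> 0"
    using LIMSEQ_Suc[OF lim_const_over_n[of T]] by simp
qed

text \<open>The integral of \<open>u\<close> vanishes over every interval, so \<open>u\<close> is orthogonal to step functions,
  by dominated convergence to continuous functions, and then to \<open>sgn u\<close>, which is a limit of
  bounded continuous functions. Hence \<open>norm u\<close> has integral \<open>0\<close>.\<close>

lemma negligible_if_integrals_vanish:
  fixes u :: "real \<Rightarrow> 'a::euclidean_space"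
  assumes T: "T > 0" and u: "u absolutely_integrable_on {0..T}"
    and 0: "\<And>t. t \<in> {0..T} \<Longrightarrow> integral {0..t} u = 0"
  shows "\<exists>N. negligible N \<and> (\<forall>t \<in> {0..T} - N. u t = 0)"
proof -
  have um: "u \<in> borel_measurable (lebesgue_on {0..T})"
    using u by (intro absolutely_integrable_imp_borel_measurable) auto
  have ui: "u integrable_on {0..T}" and nui: "(\<lambda>t. norm (u t)) integrable_on {0..T}"
    using u by (auto simp: absolutely_integrable_on_def)
  have cell: "(u has_integral 0) {a..b}" if "0 \<le> a" "a \<le> b" "b \<le> T" for a b
  proof -
    have "integral {0..a} u + integral {a..b} u = integral {0..b} u"
      using that by (intro Henstock_Kurzweil_Integration.integral_combine integrable_subinterval_real[OF ui]) auto
    then have "integral {a..b} u = 0" using 0[of a] 0[of b] that by auto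
    moreover have "u integrable_on {a..b}" by (rule integrable_subinterval_real[OF ui]) (use that in auto)
    ultimately show ?thesis by (metis integrable_integral)
  qed
  have step: "((\<lambda>t. u t \<bullet> step_fun N \<tau> c t) has_integral 0) {0..T}" if P: "partition_of T N \<tau>" for N \<tau> c
  proof -
    have "((\<lambda>t. \<Sum>k<N. indicator {\<tau> k<..\<tau> (Suc k)} t * (u t \<bullet> c k)) has_integral (\<Sum>k<N. 0)) {0..T}"
    proof (rule has_integral_sum)
      fix k assume "k \<in> {..<N}"
      then have k: "0 \<le> \<tau> k" "\<tau> k \<le> \<tau> (Suc k)" "\<tau> (Suc k) \<le> T"
        using partition_range[OF P] partition_mono[OF P, of k "Suc k"] by auto
      have "((\<lambda>t. u t \<bullet> c k) has_integral 0) {\<tau> k..\<tau> (Suc k)}"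
        using has_integral_linear[OF cell[OF k] bounded_linear_inner_left[of "c k"]] by (simp add: o_def)
      then have "((\<lambda>t. if t \<in> {\<tau> k..\<tau> (Suc k)} then u t \<bullet> c k else 0) has_integral 0) {0..T}"
        using k by (subst has_integral_restrict) auto
      then show "((\<lambda>t. indicator {\<tau> k<..\<tau> (Suc k)} t * (u t \<bullet> c k)) has_integral 0) {0..T}"
        by (rule has_integral_spike[rotated 2, of _ _ _ "{\<tau> k}"]) (auto simp: indicator_def)
    qed simp
    then show ?thesis by (simp add: step_fun_def inner_sum_right)
  qed
  have cont: "(\<lambda>t. u t \<bullet> c t) integrable_on {0..T}" "integral {0..T} (\<lambda>t. u t \<bullet> c t) = 0" 
    if c: "continuous_on {0..T} c" and B: "\<And>t. t \<in> {0..T} \<Longrightarrow> norm (c t) \<le> B" for c B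
  proof -
    have B0: "0 \<le> B" using B[of 0] T norm_ge_zero[of "c 0"] by (smt (verit) atLeastAtMost_iff)
    define N where "N = (\<lambda>n. Suc n)"
    define \<tau> where "\<tau> = (\<lambda>n k. real k * T / real (Suc n))"
    have P: "\<And>n. partition_of T (N n) (\<tau> n)" and m: "(\<lambda>n. mesh (N n) (\<tau> n)) \<longlonglongrightarrow> 0"
      unfolding N_def \<tau>_def using uniform_partition[OF T] by auto
    define g where "g = (\<lambda>n t. u t \<bullet> step_fun (N n) (\<tau> n) (\<lambda>k. c (\<tau> n k)) t)"
    have gi: "(g n has_integral 0) {0..T}" for n unfolding g_def by (rule step[OF P])
    have gin: "g n integrable_on {0..T}" for n using gi by blast
    have bd: "norm (g n t) \<le> norm (u t) * B" if "t \<in> {0..T} - {0}" for n t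
    proof -
      have "norm (step_fun (N n) (\<tau> n) (\<lambda>k. c (\<tau> n k)) t) \<le> B"
        by (rule step_fun_norm_le[OF P _ B0]) (use that partition_range[OF P] B in auto)
      then show ?thesis unfolding g_def
        using Cauchy_Schwarz_ineq2 mult_left_mono norm_ge_zero order_trans by (metis real_norm_def)
    qed
    have lim: "(\<lambda>n. g n t) \<longlonglongrightarrow> u t \<bullet> c t" if "t \<in> {0..T} - {0}" for t
      unfolding g_def by (intro tendsto_inner tendsto_const step_fun_sample_tendsto[OF P m c]) (use that in auto)
    have hi: "(\<lambda>t. norm (u t) * B) integrable_on {0..T}" using nui by (rule integrable_on_mult_left)
    note dc = dominated_convergence_negligible[OF negligible_sing gin hi bd lim]
    show "(\<lambda>t. u t \<bullet> c t) integrable_on {0..T}" by (rule dc(1))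
    have "(\<lambda>k. integral {0..T} (g k)) \<longlonglongrightarrow> integral {0..T} (\<lambda>t. u t \<bullet> c t)" by (rule dc(2))
    moreover have "integral {0..T} (g k) = 0" for k using gi by (rule integral_unique)
    ultimately show "integral {0..T} (\<lambda>t. u t \<bullet> c t) = 0" by (simp add: LIMSEQ_const_iff)
  qed
  have int_u: "integrable lebesgue (\<lambda>t. indicator {0..T} t *\<^sub>R u t)"
    using u by (simp add: set_integrable_def)
  have "(\<lambda>t. sgn (u t)) \<in> borel_measurable (lebesgue_on {0..T})"
    unfolding sgn_div_norm using um by measurable
  then obtain N c where N: "negligible N" and c: "\<And>n::nat. continuous_on UNIV (c n)" "\<And>n t. norm (c n t) \<le> 1"
    "\<And>t. t \<in> {0..T} - N \<Longrightarrow> (\<lambda>n. c n t) \<longlonglongrightarrow> sgn (u t)"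
    by (rule bounded_measurable_limit_continuous[of _ _ 1]) (auto simp: norm_sgn)
  have ci: "(\<lambda>t. u t \<bullet> c n t) integrable_on {0..T}" "integral {0..T} (\<lambda>t. u t \<bullet> c n t) = 0" for n
    using cont[OF continuous_on_subset[OF c(1) subset_UNIV] c(2)] by auto
  have bd: "norm (u t \<bullet> c n t) \<le> norm (u t)" if "t \<in> {0..T} - N" for n t
    using Cauchy_Schwarz_ineq2[of "u t" "c n t"] mult_left_le[OF c(2)[of n t], of "norm (u t)"] by auto
  have lim: "(\<lambda>n. u t \<bullet> c n t) \<longlonglongrightarrow> norm (u t)" if "t \<in> {0..T} - N" for t
  proof -
    have "(\<lambda>n. u t \<bullet> c n t) \<longlonglongrightarrow> u t \<bullet> sgn (u t)" by (intro tendsto_inner tendsto_const c(3) that)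
    moreover have "u t \<bullet> sgn (u t) = norm (u t)"
      by (cases "u t = 0") (auto simp: sgn_div_norm dot_square_norm power2_eq_square)
    ultimately show ?thesis by simp
  qed
  have "(\<lambda>n. integral {0..T} (\<lambda>t. u t \<bullet> c n t)) \<longlonglongrightarrow> integral {0..T} (\<lambda>t. norm (u t))"
    by (rule dominated_convergence_negligible(2)[OF N ci(1) nui bd lim])
  then have "integral {0..T} (\<lambda>t. norm (u t)) = 0" using ci(2) by (simp add: LIMSEQ_const_iff)
  moreover have "(LINT t:{0..T}|lebesgue. norm (u t)) = integral {0..T} (\<lambda>t. norm (u t))"
    by (intro set_lebesgue_integral_eq_integral(2) set_integrable_norm u)
  ultimately have "(LINT t|lebesgue. norm (indicator {0..T} t *\<^sub>R u t)) = 0"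
    by (simp add: set_lebesgue_integral_def)
  then have ae: "AE t in lebesgue. norm (indicator {0..T} t *\<^sub>R u t) = 0"
    using integrable_norm[OF int_u] by (subst (asm) integral_nonneg_eq_0_iff_AE) auto
  then have "AE t in lebesgue. indicator {0..T} t *\<^sub>R u t = 0" by simp
  then obtain N where N: "N \<in> null_sets lebesgue" "{t \<in> space lebesgue. \<not> indicator {0..T} t *\<^sub>R u t = 0} \<subseteq> N"
    by (rule AE_E3) auto
  then show ?thesis by (intro exI[of _ N]) (auto simp: negligible_iff_null_sets indicator_def)
qed

lemma sq_integral_tendsto_0:
  assumes "negligible N" "\<And>k::nat. square_integrable T (d k)" "w integrable_on {0..T}"
    "\<And>k t. t \<in> {0..T} - N \<Longrightarrow> (norm (d k t))\<^sup>2 \<le> w t"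
    "\<And>t. t \<in> {0..T} - N \<Longrightarrow> (\<lambda>k. d k t) \<longlonglongrightarrow> 0"
  shows "(\<lambda>k. sq_integral T (d k)) \<longlonglongrightarrow> 0"
proof -
  have "(\<lambda>k. sq_integral T (d k)) \<longlonglongrightarrow> integral {0..T} (\<lambda>t. 0::real)"
    unfolding sq_integral_def
  proof (rule dominated_convergence_negligible(2)[OF assms(1) _ assms(3)])
    show "(\<lambda>t. (norm (d k t))\<^sup>2) integrable_on {0..T}" for k
      using assms(2) by (simp add: square_integrable_def)
    show "norm ((norm (d k t))\<^sup>2) \<le> w t" if "t \<in> {0..T} - N" for k t
      using assms(4)[OF that] by simp
    show "(\<lambda>k. (norm (d k t))\<^sup>2) \<longlonglongrightarrow> 0" if "t \<in> {0..T} - N" for t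
      using tendsto_power[OF tendsto_norm[OF assms(5)[OF that]], of 2] by simp
  qed
  then show ?thesis by simp
qed

lemma square_integrable_step_fun:
  assumes "partition_of T N \<tau>" "0 \<le> T"
  shows "square_integrable T (step_fun N \<tau> c)"
proof (rule square_integrable_bounded)
  show "step_fun N \<tau> c \<in> borel_measurable (lebesgue_on {0..T})"
    using step_fun_absolutely_integrable[OF assms(1)] by (intro absolutely_integrable_imp_borel_measurable) auto
  have *: "norm (c k) \<le> (\<Sum>j<N. norm (c j))" if "k < N" for k
    using that by (intro member_le_sum) auto
  show "norm (step_fun N \<tau> c t) \<le> (\<Sum>j<N. norm (c j))" if "t \<in> {0..T}" for t
    by (rule step_fun_norm_le[OF assms(1) * _ that]) (auto intro: sum_nonneg)
qed

text \<open>Three successive approximations: clip \<open>g\<close> to a bounded function, replace that by a continuous one,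
  and sample the latter at the left endpoints of the cells. Only the last one depends on \<open>i\<close>.\<close>

lemma step_fun_dense:
  fixes g :: "real \<Rightarrow> 'a::euclidean_space"
  assumes P: "\<And>i. partition_of T (N i) (\<tau> i)" and m: "(\<lambda>i. mesh (N i) (\<tau> i)) \<longlonglongrightarrow> 0" and T: "T > 0"
    and g: "square_integrable T g" and e: "\<epsilon> > 0"
  shows "\<forall>\<^sub>F i in sequentially. \<exists>c. sq_integral T (\<lambda>t. g t - step_fun (N i) (\<tau> i) c t) < \<epsilon>"
proof -
  have gm: "g \<in> borel_measurable (lebesgue_on {0..T})" and gi: "(\<lambda>t. (norm (g t))\<^sup>2) integrable_on {0..T}"
    using g by (auto simp: square_integrable_def)
  define G where "G = (\<lambda>n t. radial_clip (real (Suc n)) (g t))"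
  have Gm: "G n \<in> borel_measurable (lebesgue_on {0..T})" for n
    unfolding G_def
    by (rule measurable_compose[OF gm borel_measurable_continuous_onI]) (rule continuous_on_radial_clip, simp)
  have Gb: "norm (G n t) \<le> real (Suc n)" for n t unfolding G_def by (rule norm_radial_clip) simp
  have Gs: "square_integrable T (G n)" for n by (rule square_integrable_bounded[OF Gm Gb])
  have "(\<lambda>n. sq_integral T (\<lambda>t. g t - G n t)) \<longlonglongrightarrow> 0"
  proof (rule sq_integral_tendsto_0[OF negligible_empty])
    show "square_integrable T (\<lambda>t. g t - G n t)" for n by (rule square_integrable_diff[OF g Gs])
    show "(\<lambda>t. (norm (g t))\<^sup>2 * 4) integrable_on {0..T}" by (rule integrable_on_mult_left[OF gi])
    show "(norm (g t - G n t))\<^sup>2 \<le> (norm (g t))\<^sup>2 * 4" for n t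
    proof -
      have "norm (g t - G n t) \<le> norm (g t) + norm (G n t)" by (rule norm_triangle_ineq4)
      also have "\<dots> \<le> norm (g t) * 2" using norm_radial_clip_le[of "real (Suc n)" "g t"] by (simp add: G_def)
      finally show ?thesis using power_mono[of "norm (g t - G n t)" "norm (g t) * 2" 2] by (simp add: power_mult_distrib)
    qed
    fix t
    obtain n0 where n0: "norm (g t) \<le> real n0" using real_arch_simple by blast
    have "g t - G n t = 0" if "n \<ge> n0" for n
      using radial_clip_eq[of "real (Suc n)" "g t"] n0 that by (simp add: G_def)
    then show "(\<lambda>n. g t - G n t) \<longlonglongrightarrow> 0"
      by (intro tendsto_eventually) (auto simp: eventually_sequentially)
  qed
  then have "\<forall>\<^sub>F n in sequentially. sq_integral T (\<lambda>t. g t - G n t) < \<epsilon> / 16"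
    by (rule order_tendstoD(2)) (use e in simp)
  then obtain n where n: "sq_integral T (\<lambda>t. g t - G n t) < \<epsilon> / 16"
    by (auto simp: eventually_sequentially)
  define M where "M = real (Suc n)"
  have M: "M > 0" unfolding M_def by simp
  obtain E c where E: "negligible E" and c: "\<And>j::nat. continuous_on UNIV (c j)" "\<And>j t. norm (c j t) \<le> M"
    "\<And>t. t \<in> {0..T} - E \<Longrightarrow> (\<lambda>j. c j t) \<longlonglongrightarrow> G n t"
    using bounded_measurable_limit_continuous[OF Gm M] Gb unfolding M_def by metis
  have cs: "square_integrable T (c j)" for j
    by (rule square_integrable_continuous) (rule continuous_on_subset[OF c(1) subset_UNIV])
  have "(\<lambda>j. sq_integral T (\<lambda>t. G n t - c j t)) \<longlonglongrightarrow> 0"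
  proof (rule sq_integral_tendsto_0[OF E])
    show "square_integrable T (\<lambda>t. G n t - c j t)" for j by (rule square_integrable_diff[OF Gs cs])
    show "(\<lambda>t. (2 * M)\<^sup>2) integrable_on {0..T}" by (rule integrable_const_ivl)
    show "(norm (G n t - c j t))\<^sup>2 \<le> (2 * M)\<^sup>2" for j t
    proof (rule power_mono)
      show "norm (G n t - c j t) \<le> 2 * M"
        using norm_triangle_ineq4[of "G n t" "c j t"] Gb[of n t, folded M_def] c(2)[of j t] by linarith
    qed simp
    show "(\<lambda>j. G n t - c j t) \<longlonglongrightarrow> 0" if "t \<in> {0..T} - E" for t
      using tendsto_diff[OF tendsto_const c(3)[OF that], of "G n t"] by simp
  qed
  then have "\<forall>\<^sub>F j in sequentially. sq_integral T (\<lambda>t. G n t - c j t) < \<epsilon> / 16"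
    by (rule order_tendstoD(2)) (use e in simp)
  then obtain j where j: "sq_integral T (\<lambda>t. G n t - c j t) < \<epsilon> / 16"
    by (auto simp: eventually_sequentially)
  define S where "S = (\<lambda>i. step_fun (N i) (\<tau> i) (\<lambda>k. c j (\<tau> i k)))"
  have Ss: "square_integrable T (S i)" for i unfolding S_def by (rule square_integrable_step_fun[OF P]) (use T in simp)
  have "(\<lambda>i. sq_integral T (\<lambda>t. c j t - S i t)) \<longlonglongrightarrow> 0"
  proof (rule sq_integral_tendsto_0[OF negligible_sing])
    show "square_integrable T (\<lambda>t. c j t - S i t)" for i by (rule square_integrable_diff[OF cs Ss])
    show "(\<lambda>t. (2 * M)\<^sup>2) integrable_on {0..T}" by (rule integrable_const_ivl)
    show "(norm (c j t - S i t))\<^sup>2 \<le> (2 * M)\<^sup>2" if "t \<in> {0..T} - {0}" for i t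
    proof (rule power_mono)
      have "norm (S i t) \<le> M" unfolding S_def
        by (rule step_fun_norm_le[OF P c(2)]) (use M that in auto)
      then show "norm (c j t - S i t) \<le> 2 * M"
        using norm_triangle_ineq4[of "c j t" "S i t"] c(2)[of j t] by linarith
    qed simp
    show "(\<lambda>i. c j t - S i t) \<longlonglongrightarrow> 0" if t: "t \<in> {0..T} - {0}" for t
    proof -
      have "(\<lambda>i. S i t) \<longlonglongrightarrow> c j t" unfolding S_def
        by (rule step_fun_sample_tendsto[OF P m continuous_on_subset[OF c(1) subset_UNIV]]) (use t in auto)
      from tendsto_diff[OF tendsto_const this, of "c j t"] show ?thesis by simp
    qed
  qed
  then have "\<forall>\<^sub>F i in sequentially. sq_integral T (\<lambda>t. c j t - S i t) < \<epsilon> / 16"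
    by (rule order_tendstoD(2)) (use e in simp)
  then show ?thesis
  proof (rule eventually_mono)
    fix i assume i: "sq_integral T (\<lambda>t. c j t - S i t) < \<epsilon> / 16"
    have "sq_integral T (\<lambda>t. (G n t - c j t) + (c j t - S i t))
        \<le> (1 + 1) * sq_integral T (\<lambda>t. G n t - c j t) + (1 + 1/1) * sq_integral T (\<lambda>t. c j t - S i t)"
      by (rule sq_integral_add_le[OF square_integrable_diff[OF Gs cs] square_integrable_diff[OF cs Ss]]) simp
    moreover have "sq_integral T (\<lambda>t. (g t - G n t) + (G n t - S i t))
        \<le> (1 + 1) * sq_integral T (\<lambda>t. g t - G n t) + (1 + 1/1) * sq_integral T (\<lambda>t. G n t - S i t)"
      by (rule sq_integral_add_le[OF square_integrable_diff[OF g Gs] square_integrable_diff[OF Gs Ss]]) simp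
    ultimately have "sq_integral T (\<lambda>t. g t - S i t) < \<epsilon>" using n j i e by simp
    then show "\<exists>c. sq_integral T (\<lambda>t. g t - step_fun (N i) (\<tau> i) c t) < \<epsilon>" unfolding S_def by blast
  qed
qed

section \<open>Weak derivatives\<close>

text \<open>A quadratic spline that rises from \<open>0\<close> to \<open>1\<close> on the unit interval. It is \<open>C\<^sup>1\<close>, so
  differences of rescaled translates are admissible test functions that approximate indicators of
  intervals; its derivative \<open>hat\<close> is an approximate identity.\<close>

definition smooth_step :: "real \<Rightarrow> real" where
  "smooth_step u = 2 * ((max 0 u)\<^sup>2 - 2 * (max 0 (u - 1/2))\<^sup>2 + (max 0 (u - 1))\<^sup>2)"

definition hat :: "real \<Rightarrow> real" where
  "hat u = 4 * (max 0 u - 2 * max 0 (u - 1/2) + max 0 (u - 1))"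

lemma DERIV_max_0_sq: "((\<lambda>u::real. (max 0 u)\<^sup>2) has_real_derivative 2 * max 0 u) (at u)"
proof -
  consider "u < 0" | "u > 0" | "u = 0" by linarith
  then show ?thesis
  proof cases
    case 1
    have "((\<lambda>u::real. 0) has_real_derivative 2 * max 0 u) (at u)" using 1 by auto
    then show ?thesis
      by (rule DERIV_cong_ev[THEN iffD1, rotated 3])
         (use 1 eventually_nhds_in_open[of "{..<0}" u] in \<open>auto elim!: eventually_mono\<close>)
  next
    case 2
    have "((\<lambda>u::real. u\<^sup>2) has_real_derivative 2 * max 0 u) (at u)"
      using 2 by (auto intro!: derivative_eq_intros)
    then show ?thesis
      by (rule DERIV_cong_ev[THEN iffD1, rotated 3])
         (use 2 eventually_nhds_in_open[of "{0<..}" u] in \<open>auto elim!: eventually_mono\<close>)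
  next
    case 3
    have "(\<lambda>h::real. (max 0 h)\<^sup>2 / h) \<midarrow>0\<rightarrow> 0"
    proof (rule Lim_null_comparison)
      show "\<forall>\<^sub>F h::real in at 0. norm ((max 0 h)\<^sup>2 / h) \<le> \<bar>h\<bar>"
        by (intro always_eventually) (auto simp: max_def power2_eq_square)
      show "(\<lambda>h::real. \<bar>h\<bar>) \<midarrow>0\<rightarrow> 0" using tendsto_rabs[of "\<lambda>h. h" 0 "at 0"] by simp
    qed
    then show ?thesis unfolding DERIV_def 3 by simp
  qed
qed

lemma DERIV_smooth_step: "(smooth_step has_real_derivative hat u) (at u)"
proof -
  have *: "((\<lambda>u::real. (max 0 (u - c))\<^sup>2) has_real_derivative 2 * max 0 (u - c)) (at u)" for c
  proof -
    have "((\<lambda>u. u - c) has_real_derivative 1) (at u)" by (auto intro!: derivative_eq_intros)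
    from DERIV_chain2[OF DERIV_max_0_sq this] show ?thesis by simp
  qed
  have "((\<lambda>u. 2 * ((max 0 u)\<^sup>2 - 2 * (max 0 (u - 1/2))\<^sup>2 + (max 0 (u - 1))\<^sup>2))
      has_real_derivative 2 * (2 * max 0 u - 2 * (2 * max 0 (u - 1/2)) + 2 * max 0 (u - 1))) (at u)"
    by (intro DERIV_cmult DERIV_add DERIV_diff * DERIV_max_0_sq)
  then show ?thesis unfolding smooth_step_def[abs_def] hat_def by (simp add: algebra_simps)
qed

lemma continuous_on_hat: "continuous_on S hat"
  unfolding hat_def by (intro continuous_intros)

lemma smooth_step_0: "u \<le> 0 \<Longrightarrow> smooth_step u = 0"
  by (simp add: smooth_step_def max_def)

lemma smooth_step_1: "u \<ge> 1 \<Longrightarrow> smooth_step u = 1"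
  by (simp add: smooth_step_def max_def) (simp add: power2_eq_square algebra_simps)

lemma hat_nonneg: "0 \<le> hat u"
  by (auto simp: hat_def max_def)

lemma hat_0: "u \<le> 0 \<or> u \<ge> 1 \<Longrightarrow> hat u = 0"
  by (auto simp: hat_def max_def)

lemma smooth_step_bounds: "0 \<le> smooth_step u" "smooth_step u \<le> 1"
proof -
  have mono: "smooth_step a \<le> smooth_step b" if "a \<le> b" for a b
    by (rule DERIV_nonneg_imp_nondecreasing[OF that]) (use DERIV_smooth_step hat_nonneg in blast)
  show "0 \<le> smooth_step u" using mono[of "min u 0" u] smooth_step_0[of "min u 0"] by simp
  show "smooth_step u \<le> 1" using mono[of u "max u 1"] smooth_step_1[of "max u 1"] by simp
qed

lemma DERIV_smooth_step_scaled:
  "((\<lambda>r. smooth_step (c * (r - s))) has_real_derivative c * hat (c * (r - s))) (at r)"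
proof -
  have "((\<lambda>r. c * (r - s)) has_real_derivative c) (at r)" by (auto intro!: derivative_eq_intros)
  from DERIV_chain2[OF DERIV_smooth_step this] show ?thesis by (simp add: mult.commute)
qed

text \<open>The kernel \<open>n * hat (n * (r - s))\<close> is nonnegative, has integral \<open>1\<close> and is supported in
  \<open>{s..s + 1/n}\<close>.\<close>

lemma hat_concentrates:
  fixes a :: "real \<Rightarrow> 'a::euclidean_space"
  assumes a: "continuous_on {0..T} a" and s: "0 < s" "s < T"
  shows "(\<lambda>n. integral {0..T} (\<lambda>r. (real n * hat (real n * (r - s))) *\<^sub>R a r)) \<longlonglongrightarrow> a s"
proof (rule LIMSEQ_I)
  fix e :: real assume e: "e > 0"
  obtain d where d: "d > 0" "\<And>r. r \<in> {0..T} \<Longrightarrow> dist r s < d \<Longrightarrow> dist (a r) (a s) < e / 2"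
    using a s e unfolding continuous_on_iff by (metis atLeastAtMost_iff half_gt_zero less_imp_le)
  obtain n0 :: nat where n0: "1 / d + 1 / (T - s) < real n0" using reals_Archimedean2 by blast
  show "\<exists>n0. \<forall>n\<ge>n0. norm (integral {0..T} (\<lambda>r. (real n * hat (real n * (r - s))) *\<^sub>R a r) - a s) < e"
  proof (intro exI allI impI)
    fix n :: nat assume "n \<ge> n0"
    then have nd: "1 / d + 1 / (T - s) < real n" using n0 by linarith
    have p: "0 < 1 / d" "0 < 1 / (T - s)" using d s by auto
    have n1: "1 / d < real n" "1 / (T - s) < real n" using nd p by linarith+
    then have n: "real n > 0" "1 / real n < d" "1 < real n * (T - s)"
    proof -
      show n0: "real n > 0" using n1 p by linarith
      show "1 / real n < d" using n1(1) n0 d(1) by (simp add: divide_less_eq mult.commute)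
      show "1 < real n * (T - s)" using n1(2) s by (simp add: divide_less_eq mult.commute)
    qed
    define k where "k = (\<lambda>r. real n * hat (real n * (r - s)))"
    have kc: "continuous_on {0..T} k" unfolding k_def
      by (intro continuous_intros continuous_on_compose2[OF continuous_on_hat[of UNIV]]) auto
    have "(k has_integral smooth_step (real n * (T - s)) - smooth_step (real n * (0 - s))) {0..T}"
      unfolding k_def
      by (rule fundamental_theorem_of_calculus)
         (use s DERIV_smooth_step_scaled in \<open>auto simp: has_real_derivative_iff_has_vector_derivative[symmetric] intro: DERIV_subset\<close>)
    moreover have "smooth_step (real n * (T - s)) = 1" using n by (intro smooth_step_1) auto
    moreover have "smooth_step (real n * (0 - s)) = 0" using n s by (intro smooth_step_0) auto
    ultimately have k1: "(k has_integral 1) {0..T}" by simp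
    have i1: "(\<lambda>r. k r *\<^sub>R a r) integrable_on {0..T}" 
      by (intro integrable_continuous_real continuous_intros kc a)
    have i2: "((\<lambda>r. k r *\<^sub>R a s) has_integral a s) {0..T}"
      using has_integral_linear[OF k1 bounded_linear_scaleR_left[of "a s"]] by (simp add: o_def)
    have "norm (integral {0..T} (\<lambda>r. k r *\<^sub>R a r - k r *\<^sub>R a s)) \<le> integral {0..T} (\<lambda>r. k r * (e / 2))"
    proof (rule integral_norm_bound_integral)
      show "(\<lambda>r. k r *\<^sub>R a r - k r *\<^sub>R a s) integrable_on {0..T}" using i1 has_integral_integrable[OF i2] by (rule integrable_diff)
      show "(\<lambda>r. k r * (e / 2)) integrable_on {0..T}" by (rule integrable_on_mult_left[OF has_integral_integrable[OF k1]])
      fix r assume r: "r \<in> {0..T}"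
      have k0: "0 \<le> k r" unfolding k_def using n hat_nonneg by (intro mult_nonneg_nonneg) auto
      show "norm (k r *\<^sub>R a r - k r *\<^sub>R a s) \<le> k r * (e / 2)"
      proof (cases "k r = 0")
        case False
        then have "\<not> (real n * (r - s) \<le> 0 \<or> real n * (r - s) \<ge> 1)" using hat_0 unfolding k_def by auto
        then have "0 < r - s" "r - s < 1 / real n" using n by (auto simp: field_simps zero_less_mult_iff)
        then have "dist r s < d" using n by (simp add: dist_real_def)
        then have "dist (a r) (a s) < e / 2" using d r by blast
        then have "k r * norm (a r - a s) \<le> k r * (e / 2)"
          using k0 by (intro mult_left_mono) (auto simp: dist_norm)
        then show ?thesis using k0 by (simp add: scaleR_diff_right[symmetric])
      qed simp
    qed
    also have "\<dots> = e / 2" using integral_unique[OF has_integral_mult_left[OF k1, of "e/2"]] by simp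
    also have "integral {0..T} (\<lambda>r. k r *\<^sub>R a r - k r *\<^sub>R a s) = integral {0..T} (\<lambda>r. k r *\<^sub>R a r) - a s"
      using integral_diff[OF i1 has_integral_integrable[OF i2]] integral_unique[OF i2] by simp
    finally show "norm (integral {0..T} (\<lambda>r. (real n * hat (real n * (r - s))) *\<^sub>R a r) - a s) < e"
      using e unfolding k_def by linarith
  qed
qed

lemma absolutely_integrable_imp_integrable_subinterval:
  fixes g :: "real \<Rightarrow> 'a::euclidean_space"
  assumes "g absolutely_integrable_on {0..T}" "0 \<le> a" "b \<le> T"
  shows "g integrable_on {a..b}"
proof -
  have "g integrable_on {0..T}" using assms(1) unfolding absolutely_integrable_on_def by blast
  then show ?thesis by (rule integrable_subinterval_real) (use assms in auto)
qed

lemma absolutely_integrable_bounded_scaleR: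
  fixes g :: "real \<Rightarrow> 'a::euclidean_space"
  assumes g: "g absolutely_integrable_on {0..T}" and k: "continuous_on {0..T} k"
  shows "(\<lambda>t. k t *\<^sub>R g t) absolutely_integrable_on {0..T}"
proof -
  have "bounded (k ` {0..T})" by (intro compact_imp_bounded compact_continuous_image k) auto
  then obtain B where B: "\<And>t. t \<in> {0..T} \<Longrightarrow> \<bar>k t\<bar> \<le> B" unfolding bounded_iff real_norm_def by blast
  show ?thesis
  proof (rule measurable_bounded_by_integrable_imp_absolutely_integrable)
    show "(\<lambda>t. k t *\<^sub>R g t) \<in> borel_measurable (lebesgue_on {0..T})"
      by (intro borel_measurable_scaleR continuous_imp_measurable_on_sets_lebesgue k
          absolutely_integrable_imp_borel_measurable g) auto
    show "(\<lambda>t. B * norm (g t)) integrable_on {0..T}"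
      using g by (intro integrable_on_mult_right) (simp add: absolutely_integrable_on_def)
    show "norm (k t *\<^sub>R g t) \<le> B * norm (g t)" if "t \<in> {0..T}" for t
      using B[OF that] by (simp add: mult_right_mono)
  qed simp
qed

lemma absolutely_integrable_test_function:
  fixes g :: "real \<Rightarrow> 'a::euclidean_space" and \<phi> :: "real \<Rightarrow> real"
  assumes "\<forall>t. (\<phi> has_real_derivative \<phi>' t) (at t)" and "g absolutely_integrable_on {0..T}"
  shows "(\<lambda>t. \<phi> t *\<^sub>R g t) absolutely_integrable_on {0..T}"
proof (rule absolutely_integrable_bounded_scaleR[OF assms(2)])
  show "continuous_on {0..T} \<phi>"
    by (rule DERIV_continuous_on) (use assms(1) in \<open>blast intro: has_field_derivative_at_within\<close>)
qed

text \<open>Tested against smoothed indicators \<open>p n\<close> of \<open>{s..t}\<close>, the defining identity turns into the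
  fundamental theorem of calculus: the derivatives \<open>p' n\<close> concentrate at \<open>s\<close> and \<open>t\<close>, and the
  \<open>p n\<close> converge boundedly.\<close>

lemma weak_derivative_imp_integral_interior:
  fixes a :: "real \<Rightarrow> 'a::euclidean_space"
  assumes w: "weak_derivative T a g" and a: "continuous_on {0..T} a" and st: "0 < s" "s < t" "t < T"
  shows "a t - a s = integral {s..t} g"
proof -
  have g: "g absolutely_integrable_on {0..T}" using w by (simp add: weak_derivative_def)
  \<comment> \<open>Beyond \<open>n0\<close> the support of \<open>p n\<close>, contained in \<open>{s..t + 1/n}\<close>, lies inside the open interval.\<close>
  obtain n0 :: nat where n0: "1 / (T - t) < real n0" using reals_Archimedean2 by blast
  define p where "p = (\<lambda>n r. smooth_step (real n * (r - s)) - smooth_step (real n * (r - t)))"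
  define p' where "p' = (\<lambda>n r. real n * hat (real n * (r - s)) - real n * hat (real n * (r - t)))"
  have dp: "(p n has_real_derivative p' n r) (at r)" for n r
    unfolding p_def p'_def by (intro DERIV_diff DERIV_smooth_step_scaled)
  have kc: "continuous_on S (\<lambda>r. real n * hat (real n * (r - s)))" for n s S
    by (intro continuous_intros continuous_on_compose2[OF continuous_on_hat[of UNIV]]) auto
  have p'c: "continuous_on S (p' n)" for n S
    unfolding p'_def by (intro continuous_on_diff kc)
  have pc: "continuous_on S (p n)" for n S
    by (rule DERIV_continuous_on) (use dp in \<open>blast intro: has_field_derivative_at_within\<close>)
  have weak: "integral {0..T} (\<lambda>r. p' n r *\<^sub>R a r) = - integral {0..T} (\<lambda>r. p n r *\<^sub>R g r)" if n: "n \<ge> n0" for n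
  proof -
    have n': "1 / (T - t) < real n" using n0 n by linarith
    moreover have "0 < 1 / (T - t)" using st by simp
    ultimately have np0: "0 < real n" by linarith
    then have np: "0 < real n" "1 < real n * (T - t)" using n' st by (simp_all add: divide_less_eq mult.commute)
    have "(LINT r:{0..T}|lebesgue. p' n r *\<^sub>R a r) = - (LINT r:{0..T}|lebesgue. p n r *\<^sub>R g r)"
    proof (rule w[unfolded weak_derivative_def, THEN conjunct2, rule_format])
      show "(p n has_real_derivative p' n r) (at r)" for r by (rule dp)
      show "continuous_on UNIV (p' n)" by (rule p'c)
      show "\<exists>K. compact K \<and> K \<subseteq> {0<..<T} \<and> (\<forall>r. r \<notin> K \<longrightarrow> p n r = 0)"
      proof (intro exI[of _ "{s..t + 1 / real n}"] conjI allI impI)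
        have "1 / real n < T - t" using np by (simp add: divide_less_eq mult.commute)
        then show "{s..t + 1 / real n} \<subseteq> {0<..<T}" using st by auto
        fix r assume "r \<notin> {s..t + 1 / real n}"
        then consider "r < s" | "r > t + 1 / real n" by force
        then show "p n r = 0"
        proof cases
          case 1
          then have "real n * (r - s) \<le> 0" "real n * (r - t) \<le> 0"
            using st by (intro mult_nonneg_nonpos; simp)+
          then show ?thesis unfolding p_def by (simp add: smooth_step_0)
        next
          case 2
          then have "1 / real n \<le> r - t" by simp
          then have "1 \<le> real n * (r - t)" using np0 by (simp add: divide_le_eq mult.commute)
          moreover have "real n * (r - t) \<le> real n * (r - s)" using st by (intro mult_left_mono) auto
          ultimately show ?thesis unfolding p_def by (simp add: smooth_step_1)
        qed
      qed simp
    qed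
    moreover have "(\<lambda>r. p' n r *\<^sub>R a r) absolutely_integrable_on {0..T}"
      by (intro absolutely_integrable_continuous_real continuous_intros p'c a)
    moreover have "(\<lambda>r. p n r *\<^sub>R g r) absolutely_integrable_on {0..T}"
      by (intro absolutely_integrable_bounded_scaleR g pc)
    ultimately show ?thesis by (simp add: set_lebesgue_integral_eq_integral(2))
  qed
  have "(\<lambda>n. integral {0..T} (\<lambda>r. (real n * hat (real n * (r - s))) *\<^sub>R a r)
       - integral {0..T} (\<lambda>r. (real n * hat (real n * (r - t))) *\<^sub>R a r)) \<longlonglongrightarrow> a s - a t"
    by (intro tendsto_diff hat_concentrates a) (use st in auto)
  moreover have "integral {0..T} (\<lambda>r. p' n r *\<^sub>R a r) = integral {0..T} (\<lambda>r. (real n * hat (real n * (r - s))) *\<^sub>R a r)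
       - integral {0..T} (\<lambda>r. (real n * hat (real n * (r - t))) *\<^sub>R a r)" for n
  proof -
    have i: "(\<lambda>r. (real n * hat (real n * (r - s))) *\<^sub>R a r) integrable_on {0..T}" for s
      by (intro integrable_continuous_real continuous_on_scaleR kc a)
    show ?thesis unfolding p'_def scaleR_diff_left by (rule integral_diff[OF i i])
  qed
  ultimately have L: "(\<lambda>n. integral {0..T} (\<lambda>r. p' n r *\<^sub>R a r)) \<longlonglongrightarrow> a s - a t" by simp
  have "(\<lambda>n. integral {0..T} (\<lambda>r. p n r *\<^sub>R g r)) \<longlonglongrightarrow> integral {0..T} (\<lambda>r. if r \<in> {s<..t} then g r else 0)"
  proof (rule dominated_convergence(2))
    show "(\<lambda>r. p n r *\<^sub>R g r) integrable_on {0..T}" for n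
      using absolutely_integrable_bounded_scaleR[OF g pc] by (simp add: absolutely_integrable_on_def)
    show "(\<lambda>r. norm (g r)) integrable_on {0..T}" using g by (simp add: absolutely_integrable_on_def)
    show "norm (p n r *\<^sub>R g r) \<le> norm (g r)" for n r
    proof -
      have "\<bar>p n r\<bar> \<le> 1" unfolding p_def
        using smooth_step_bounds[of "real n * (r - s)"] smooth_step_bounds[of "real n * (r - t)"] by linarith
      then show ?thesis by (simp add: mult_left_le_one_le)
    qed
    have one: "\<exists>n1. \<forall>n\<ge>n1. smooth_step (real n * d) = 1" if "d > 0" for d
    proof -
      obtain n1 :: nat where "1 / d < real n1" using reals_Archimedean2 by blast
      then have "1 \<le> real n * d" if "n \<ge> n1" for n
      proof -
        have "1 / d \<le> real n" using \<open>1 / d < real n1\<close> that by linarith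
        then show ?thesis using \<open>d > 0\<close> by (simp add: divide_le_eq)
      qed
      then show ?thesis using smooth_step_1 by blast
    qed
    fix r assume "r \<in> {0..T}"
    consider "r \<le> s" | "s < r" "r \<le> t" | "t < r" by linarith
    then show "(\<lambda>n. p n r *\<^sub>R g r) \<longlonglongrightarrow> (if r \<in> {s<..t} then g r else 0)"
    proof cases
      case 1
      have "p n r = 0" for n
      proof -
        have "real n * (r - s) \<le> 0" "real n * (r - t) \<le> 0"
          using 1 st by (intro mult_nonneg_nonpos; simp)+
        then show ?thesis unfolding p_def by (simp add: smooth_step_0)
      qed
      then show ?thesis using 1 by simp
    next
      case 2
      then obtain n1 where n1: "\<And>n. n \<ge> n1 \<Longrightarrow> smooth_step (real n * (r - s)) = 1"
        using one[of "r - s"] by force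
      have n2: "smooth_step (real n * (r - t)) = 0" for n
        using 2 by (intro smooth_step_0 mult_nonneg_nonpos; simp)
      show ?thesis
        by (intro tendsto_eventually eventually_sequentiallyI[of n1]) (use 2 n1 n2 in \<open>simp add: p_def\<close>)
    next
      case 3
      then have "r - s > 0" "r - t > 0" using st by auto
      then obtain n1 n2 where n: "\<And>n. n \<ge> n1 \<Longrightarrow> smooth_step (real n * (r - s)) = 1"
          "\<And>n. n \<ge> n2 \<Longrightarrow> smooth_step (real n * (r - t)) = 1"
        using one by meson
      show ?thesis
        by (intro tendsto_eventually eventually_sequentiallyI[of "max n1 n2"]) (use 3 n in \<open>simp add: p_def\<close>)
    qed
  qed
  also have "integral {0..T} (\<lambda>r. if r \<in> {s<..t} then g r else 0) = integral {0..T} (\<lambda>r. if r \<in> {s..t} then g r else 0)"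
    by (rule integral_spike[of "{s}"]) auto
  also have "\<dots> = integral {s..t} g"
  proof (rule integral_unique)
    have "g integrable_on {s..t}"
      by (rule absolutely_integrable_imp_integrable_subinterval[OF g]) (use st in auto)
    from integrable_integral[OF this]
    show "((\<lambda>r. if r \<in> {s..t} then g r else 0) has_integral integral {s..t} g) {0..T}"
      using st by (subst has_integral_restrict) auto
  qed
  finally have "(\<lambda>n. - integral {0..T} (\<lambda>r. p n r *\<^sub>R g r)) \<longlonglongrightarrow> - integral {s..t} g" by (rule tendsto_minus)
  then have "(\<lambda>n. integral {0..T} (\<lambda>r. p' n r *\<^sub>R a r)) \<longlonglongrightarrow> - integral {s..t} g"
    by (rule Lim_transform_eventually) (intro eventually_sequentiallyI[of n0], simp add: weak)
  from LIMSEQ_unique[OF L this] have "- (a s - a t) = integral {s..t} g" by simp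
  then show ?thesis by simp
qed

lemma weak_derivative_imp_integral:
  fixes a :: "real \<Rightarrow> 'a::euclidean_space"
  assumes w: "weak_derivative T a g" and a: "continuous_on {0..T} a" and T: "T > 0" and t: "t \<in> {0..T}"
  shows "a t = a 0 + integral {0..t} g"
proof -
  have g: "g absolutely_integrable_on {0..T}" using w by (simp add: weak_derivative_def)
  then have gi: "g integrable_on {0..T}" by (simp add: absolutely_integrable_on_def)
  define F where "F = (\<lambda>t. a t - integral {0..t} g)"
  have cl: "closure {0<..<T} = {0..T}" using T by (rule closure_greaterThanLessThan)
  have Fc: "continuous_on (closure {0<..<T}) F"
    unfolding F_def cl by (intro continuous_on_diff a indefinite_integral_continuous_1 gi)
  have "F r = F (T/2)" if r: "r \<in> {0<..<T}" for r
  proof -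
    have *: "F r = F q" if "0 < r" "r < q" "q < T" for r q
    proof -
      have "a q - a r = integral {r..q} g" by (rule weak_derivative_imp_integral_interior[OF w a that])
      then have e1: "a q = integral {r..q} g + a r" by (simp only: diff_eq_eq)
      have e2: "integral {0..q} g = integral {0..r} g + integral {r..q} g"
        using that by (intro Henstock_Kurzweil_Integration.integral_combine[symmetric] integrable_subinterval_real[OF gi]) auto
      show ?thesis unfolding F_def e1 e2 by simp
    qed
    consider "r < T/2" | "r = T/2" | "T/2 < r" by linarith
    then show ?thesis
    proof cases
      case 1 then show ?thesis using *[of r "T/2"] r T by simp
    next
      case 3 then show ?thesis using *[of "T/2" r] r T by simp
    next
      case 2 then show ?thesis by (rule arg_cong)
    qed
  qed
  then have const: "F x = F (T/2)" if "x \<in> {0..T}" for x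
    by (rule continuous_constant_on_closure[OF Fc, unfolded cl, OF _ that])
  have "F t = F 0" using const[OF t] const[of 0] T by simp
  then show ?thesis unfolding F_def by (simp add: diff_eq_eq)
qed

lemma weak_derivative_unique:
  fixes a :: "real \<Rightarrow> 'a::euclidean_space"
  assumes w: "weak_derivative T a g" "weak_derivative T a g'" and T: "T > 0"
  shows "\<exists>N. negligible N \<and> (\<forall>t \<in> {0..T} - N. g t = g' t)"
proof -
  have g: "g absolutely_integrable_on {0..T}" "g' absolutely_integrable_on {0..T}"
    using w by (auto simp: weak_derivative_def)
  have d: "(\<lambda>t. g t - g' t) absolutely_integrable_on {0..T}" using g by (rule set_integral_diff(1))
  \<comment> \<open>The difference is a weak derivative of the zero path.\<close>
  have z: "weak_derivative T (\<lambda>_. 0) (\<lambda>t. g t - g' t)"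
    unfolding weak_derivative_def
  proof (intro conjI allI impI d)
    fix \<phi> \<phi>' :: "real \<Rightarrow> real"
    assume 1: "\<forall>t. (\<phi> has_real_derivative \<phi>' t) (at t)" and 2: "continuous_on UNIV \<phi>'"
      and 3: "\<exists>K. compact K \<and> K \<subseteq> {0<..<T} \<and> (\<forall>t. t \<notin> K \<longrightarrow> \<phi> t = 0)"
    have "(LINT t:{0..T}|lebesgue. \<phi> t *\<^sub>R g t) = (LINT t:{0..T}|lebesgue. \<phi> t *\<^sub>R g' t)"
    proof -
      have "- (LINT t:{0..T}|lebesgue. \<phi> t *\<^sub>R g t) = (LINT t:{0..T}|lebesgue. \<phi>' t *\<^sub>R a t)"
        using w(1)[unfolded weak_derivative_def] 1 2 3 by simp
      also have "\<dots> = - (LINT t:{0..T}|lebesgue. \<phi> t *\<^sub>R g' t)"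
        using w(2)[unfolded weak_derivative_def] 1 2 3 by simp
      finally show ?thesis by simp
    qed
    then have "(LINT t:{0..T}|lebesgue. \<phi> t *\<^sub>R (g t - g' t)) = 0"
      unfolding scaleR_diff_right
      by (subst set_integral_diff(2)) (simp_all add: absolutely_integrable_test_function[OF 1] g)
    then show "(LINT t:{0..T}|lebesgue. \<phi>' t *\<^sub>R 0) = - (LINT t:{0..T}|lebesgue. \<phi> t *\<^sub>R (g t - g' t))"
      by (simp add: set_lebesgue_integral_def)
  qed
  have "\<exists>N. negligible N \<and> (\<forall>t \<in> {0..T} - N. g t - g' t = 0)"
    by (rule negligible_if_integrals_vanish[OF T d])
       (use weak_derivative_imp_integral[OF z continuous_on_const T] in simp)
  then show ?thesis by simp
qed

lemma weak_derivative_uminus: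
  fixes a :: "real \<Rightarrow> 'a::euclidean_space"
  assumes w: "weak_derivative T a g" and b: "\<And>t. t \<in> {0..T} \<Longrightarrow> b t = - a t"
  shows "weak_derivative T b (\<lambda>t. - g t)"
  unfolding weak_derivative_def
proof (intro conjI allI impI)
  show "(\<lambda>t. - g t) absolutely_integrable_on {0..T}"
    using w by (simp add: weak_derivative_def set_integrable_def)
  fix \<phi> \<phi>' :: "real \<Rightarrow> real"
  assume 1: "\<forall>t. (\<phi> has_real_derivative \<phi>' t) (at t)" and 2: "continuous_on UNIV \<phi>'"
    and 3: "\<exists>K. compact K \<and> K \<subseteq> {0<..<T} \<and> (\<forall>t. t \<notin> K \<longrightarrow> \<phi> t = 0)"
  have "(LINT t:{0..T}|lebesgue. \<phi>' t *\<^sub>R b t) = (LINT t:{0..T}|lebesgue. - (\<phi>' t *\<^sub>R a t))"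
    by (rule set_lebesgue_integral_cong) (use b in auto)
  also have "\<dots> = - (LINT t:{0..T}|lebesgue. \<phi>' t *\<^sub>R a t)"
    by (simp add: set_lebesgue_integral_def)
  also have "\<dots> = (LINT t:{0..T}|lebesgue. \<phi> t *\<^sub>R g t)"
    using w 1 2 3 unfolding weak_derivative_def by simp
  also have "\<dots> = - (LINT t:{0..T}|lebesgue. \<phi> t *\<^sub>R (- g t))"
    by (simp add: set_lebesgue_integral_def)
  finally show "(LINT t:{0..T}|lebesgue. \<phi>' t *\<^sub>R b t) = - (LINT t:{0..T}|lebesgue. \<phi> t *\<^sub>R (- g t))" .
qed

text \<open>Integration by parts: \<open>\<phi> *\<^sub>R a\<close> vanishes at both ends and is an antiderivative of
  \<open>\<phi>' *\<^sub>R a + \<phi> *\<^sub>R g\<close> off the finite set \<open>E\<close>.\<close>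

lemma weak_derivative_piecewise_C1:
  fixes a :: "real \<Rightarrow> 'a::euclidean_space"
  assumes a: "continuous_on {0..T} a" and E: "finite E" and T: "T \<ge> 0"
    and d: "\<And>t. t \<in> {0<..<T} - E \<Longrightarrow> (a has_vector_derivative g t) (at t)"
    and g: "g absolutely_integrable_on {0..T}"
  shows "weak_derivative T a g"
  unfolding weak_derivative_def
proof (intro conjI allI impI g)
  fix \<phi> \<phi>' :: "real \<Rightarrow> real"
  assume dphi: "\<forall>t. (\<phi> has_real_derivative \<phi>' t) (at t)" and c: "continuous_on UNIV \<phi>'"
    and "\<exists>K. compact K \<and> K \<subseteq> {0<..<T} \<and> (\<forall>t. t \<notin> K \<longrightarrow> \<phi> t = 0)"
  then have e: "\<phi> 0 = 0" "\<phi> T = 0" by (metis greaterThanLessThan_iff less_irrefl subsetD)+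
  have phic: "continuous_on {0..T} \<phi>"
    by (rule DERIV_continuous_on) (use dphi in \<open>blast intro: has_field_derivative_at_within\<close>)
  have "((\<lambda>t. \<phi>' t *\<^sub>R a t + \<phi> t *\<^sub>R g t) has_integral (\<phi> T *\<^sub>R a T - \<phi> 0 *\<^sub>R a 0)) {0..T}"
  proof (rule fundamental_theorem_of_calculus_interior_strong[OF E T])
    show "continuous_on {0..T} (\<lambda>t. \<phi> t *\<^sub>R a t)" by (intro continuous_intros phic a)
    fix t assume t: "t \<in> {0<..<T} - E"
    have "((\<lambda>t. \<phi> t *\<^sub>R a t) has_vector_derivative \<phi> t *\<^sub>R g t + \<phi>' t *\<^sub>R a t) (at t)"
      by (rule has_vector_derivative_scaleR) (use dphi d[OF t] in auto)
    then show "((\<lambda>t. \<phi> t *\<^sub>R a t) has_vector_derivative \<phi>' t *\<^sub>R a t + \<phi> t *\<^sub>R g t) (at t)"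
      by (simp add: add.commute)
  qed
  then have s: "((\<lambda>t. \<phi>' t *\<^sub>R a t + \<phi> t *\<^sub>R g t) has_integral 0) {0..T}" using e by simp
  have i1: "(\<lambda>t. \<phi>' t *\<^sub>R a t) absolutely_integrable_on {0..T}"
    by (intro absolutely_integrable_continuous_real continuous_intros continuous_on_subset[OF c] a) auto
  have i2: "(\<lambda>t. \<phi> t *\<^sub>R g t) absolutely_integrable_on {0..T}"
    by (intro absolutely_integrable_bounded_scaleR g phic)
  have "integral {0..T} (\<lambda>t. \<phi>' t *\<^sub>R a t) + integral {0..T} (\<lambda>t. \<phi> t *\<^sub>R g t) = 0"
    using integral_unique[OF s] i1 i2 by (subst (asm) integral_add) (auto simp: absolutely_integrable_on_def)
  then show "(LINT t:{0..T}|lebesgue. \<phi>' t *\<^sub>R a t) = - (LINT t:{0..T}|lebesgue. \<phi> t *\<^sub>R g t)"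
    using i1 i2 by (simp add: set_lebesgue_integral_eq_integral(2) eq_neg_iff_add_eq_0)
qed

lemma weak_derivative_diff:
  fixes a b :: "real \<Rightarrow> 'a::euclidean_space"
  assumes wa: "weak_derivative T a g" and wb: "weak_derivative T b g'"
    and ac: "continuous_on {0..T} a" and bc: "continuous_on {0..T} b"
  shows "weak_derivative T (\<lambda>t\<in>{0..T}. a t - b t) (\<lambda>t. g t - g' t)"
  unfolding weak_derivative_def
proof (intro conjI allI impI)
  have g: "g absolutely_integrable_on {0..T}" "g' absolutely_integrable_on {0..T}"
    using wa wb by (auto simp: weak_derivative_def)
  then show "(\<lambda>t. g t - g' t) absolutely_integrable_on {0..T}" by (rule set_integral_diff(1))
  fix \<phi> \<phi>' :: "real \<Rightarrow> real"
  assume 1: "\<forall>t. (\<phi> has_real_derivative \<phi>' t) (at t)" and 2: "continuous_on UNIV \<phi>'"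
    and 3: "\<exists>K. compact K \<and> K \<subseteq> {0<..<T} \<and> (\<forall>t. t \<notin> K \<longrightarrow> \<phi> t = 0)"
  have i1: "(\<lambda>t. \<phi>' t *\<^sub>R u t) absolutely_integrable_on {0..T}" if "continuous_on {0..T} u" for u :: "real \<Rightarrow> 'a"
    by (intro absolutely_integrable_continuous_real continuous_intros continuous_on_subset[OF 2] that) auto
  have i2: "(\<lambda>t. \<phi> t *\<^sub>R g t) absolutely_integrable_on {0..T}" "(\<lambda>t. \<phi> t *\<^sub>R g' t) absolutely_integrable_on {0..T}"
    by (intro absolutely_integrable_test_function[OF 1] g)+
  have "(LINT t:{0..T}|lebesgue. \<phi>' t *\<^sub>R (\<lambda>t\<in>{0..T}. a t - b t) t)
      = (LINT t:{0..T}|lebesgue. \<phi>' t *\<^sub>R a t - \<phi>' t *\<^sub>R b t)"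
    by (rule set_lebesgue_integral_cong) (auto simp: scaleR_diff_right)
  also have "\<dots> = (LINT t:{0..T}|lebesgue. \<phi>' t *\<^sub>R a t) - (LINT t:{0..T}|lebesgue. \<phi>' t *\<^sub>R b t)"
    by (rule set_integral_diff(2)[OF i1[OF ac] i1[OF bc]])
  also have "\<dots> = - ((LINT t:{0..T}|lebesgue. \<phi> t *\<^sub>R g t) - (LINT t:{0..T}|lebesgue. \<phi> t *\<^sub>R g' t))"
    using wa wb 1 2 3 unfolding weak_derivative_def by simp
  also have "\<dots> = - (LINT t:{0..T}|lebesgue. \<phi> t *\<^sub>R (g t - g' t))"
    unfolding scaleR_diff_right by (subst set_integral_diff(2)[OF i2]) simp
  finally show "(LINT t:{0..T}|lebesgue. \<phi>' t *\<^sub>R (\<lambda>t\<in>{0..T}. a t - b t) t) = - (LINT t:{0..T}|lebesgue. \<phi> t *\<^sub>R (g t - g' t))" .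
qed

section \<open>The space of paths with square-integrable weak derivative\<close>

lemma abs_continuous_path_imp_continuous:
  fixes a :: "real \<Rightarrow> 'a::euclidean_space"
  assumes "abs_continuous_path T a"
  shows "continuous_on {0..T} a"
  unfolding continuous_on_iff
proof (intro ballI allI impI)
  fix s e :: real assume s: "s \<in> {0..T}" and e: "0 < e"
  then obtain d where d: "d > 0" and *: "\<And>(n::nat) l r.
        (\<forall>k<n. 0 \<le> l k \<and> l k \<le> r k \<and> r k \<le> T) \<Longrightarrow>
        (\<forall>j<n. \<forall>k<n. j \<noteq> k \<longrightarrow> {l j<..<r j} \<inter> {l k<..<r k} = {}) \<Longrightarrow>
        (\<Sum>k<n. r k - l k) < d \<Longrightarrow> (\<Sum>k<n. norm (a (r k) - a (l k))) < e"
    using assms[unfolded abs_continuous_path_def, rule_format, OF e] by blast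
  show "\<exists>d>0. \<forall>t\<in>{0..T}. dist t s < d \<longrightarrow> dist (a t) (a s) < e"
  proof (intro exI[of _ d] conjI d ballI impI)
    fix t assume t: "t \<in> {0..T}" "dist t s < d"
    have "(\<Sum>k<(1::nat). norm (a (max s t) - a (min s t))) < e"
      by (rule *) (use s t in \<open>auto simp: dist_real_def\<close>)
    then show "dist (a t) (a s) < e"
      by (auto simp: dist_norm max_def min_def norm_minus_commute split: if_splits)
  qed
qed

lemma abs_continuous_path_diff:
  fixes a b :: "real \<Rightarrow> 'a::euclidean_space"
  assumes "abs_continuous_path T a" "abs_continuous_path T b"
  shows "abs_continuous_path T (\<lambda>t\<in>{0..T}. a t - b t)"
  unfolding abs_continuous_path_def
proof (intro allI impI)
  fix e :: real assume e: "e > 0"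
  let ?P = "\<lambda>(n::nat) l r. (\<forall>k<n. 0 \<le> l k \<and> l k \<le> r k \<and> r k \<le> T) \<and>
        (\<forall>j<n. \<forall>k<n. j \<noteq> k \<longrightarrow> {l j<..<r j} \<inter> {l k<..<r k} = {})"
  obtain d1 where d1: "d1 > 0" and 1: "\<And>n l r. ?P n l r \<Longrightarrow> (\<Sum>k<n. r k - l k) < d1 \<Longrightarrow> (\<Sum>k<n. norm (a (r k) - a (l k))) < e/2"
    using assms(1)[unfolded abs_continuous_path_def, rule_format, of "e/2"] e by auto
  obtain d2 where d2: "d2 > 0" and 2: "\<And>n l r. ?P n l r \<Longrightarrow> (\<Sum>k<n. r k - l k) < d2 \<Longrightarrow> (\<Sum>k<n. norm (b (r k) - b (l k))) < e/2"
    using assms(2)[unfolded abs_continuous_path_def, rule_format, of "e/2"] e by auto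
  let ?c = "\<lambda>t\<in>{0..T}. a t - b t"
  show "\<exists>d>0. \<forall>(n::nat) l r. (\<forall>k<n. 0 \<le> l k \<and> l k \<le> r k \<and> r k \<le> T) \<longrightarrow>
        (\<forall>j<n. \<forall>k<n. j \<noteq> k \<longrightarrow> {l j<..<r j} \<inter> {l k<..<r k} = {}) \<longrightarrow>
        (\<Sum>k<n. r k - l k) < d \<longrightarrow> (\<Sum>k<n. norm (?c (r k) - ?c (l k))) < e"
  proof (intro exI[of _ "min d1 d2"] conjI allI impI)
    fix n :: nat and l r :: "nat \<Rightarrow> real"
    assume A: "\<forall>k<n. 0 \<le> l k \<and> l k \<le> r k \<and> r k \<le> T"
      "\<forall>j<n. \<forall>k<n. j \<noteq> k \<longrightarrow> {l j<..<r j} \<inter> {l k<..<r k} = {}" "(\<Sum>k<n. r k - l k) < min d1 d2"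
    have "(\<Sum>k<n. norm (?c (r k) - ?c (l k))) \<le> (\<Sum>k<n. norm (a (r k) - a (l k)) + norm (b (r k) - b (l k)))"
    proof (rule sum_mono)
      fix k assume "k \<in> {..<n}"
      then have k: "l k \<in> {0..T}" "r k \<in> {0..T}" using A(1) by (auto intro: order_trans)
      have "?c (r k) - ?c (l k) = (a (r k) - a (l k)) - (b (r k) - b (l k))" using k by simp
      then show "norm (?c (r k) - ?c (l k)) \<le> norm (a (r k) - a (l k)) + norm (b (r k) - b (l k))"
        by (metis norm_triangle_ineq4)
    qed
    also have "\<dots> < e" unfolding sum.distrib using 1[of n l r] 2[of n l r] A by auto
    finally show "(\<Sum>k<n. norm (?c (r k) - ?c (l k))) < e" .
  qed (use d1 d2 in auto)
qed

lemma abs_continuous_path_lipschitz: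
  fixes a :: "real \<Rightarrow> 'a::euclidean_space"
  assumes L: "\<And>s t. 0 \<le> s \<Longrightarrow> s \<le> t \<Longrightarrow> t \<le> T \<Longrightarrow> norm (a t - a s) \<le> L * (t - s)" and "L \<ge> 0"
  shows "abs_continuous_path T a"
  unfolding abs_continuous_path_def
proof (intro allI impI)
  fix e :: real assume e: "e > 0"
  show "\<exists>d>0. \<forall>(n::nat) l r. (\<forall>k<n. 0 \<le> l k \<and> l k \<le> r k \<and> r k \<le> T) \<longrightarrow>
        (\<forall>j<n. \<forall>k<n. j \<noteq> k \<longrightarrow> {l j<..<r j} \<inter> {l k<..<r k} = {}) \<longrightarrow>
        (\<Sum>k<n. r k - l k) < d \<longrightarrow> (\<Sum>k<n. norm (a (r k) - a (l k))) < e"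
  proof (intro exI[of _ "e / (L + 1)"] conjI allI impI)
    fix n :: nat and l r :: "nat \<Rightarrow> real"
    assume A: "\<forall>k<n. 0 \<le> l k \<and> l k \<le> r k \<and> r k \<le> T" "(\<Sum>k<n. r k - l k) < e / (L + 1)"
    have "(\<Sum>k<n. norm (a (r k) - a (l k))) \<le> (\<Sum>k<n. (L + 1) * (r k - l k))"
    proof (rule sum_mono)
      fix k assume "k \<in> {..<n}"
      then have k: "0 \<le> l k" "l k \<le> r k" "r k \<le> T" using A(1) by auto
      have "norm (a (r k) - a (l k)) \<le> L * (r k - l k)" by (rule L[OF k])
      also have "\<dots> \<le> (L + 1) * (r k - l k)" using k by (intro mult_right_mono) auto
      finally show "norm (a (r k) - a (l k)) \<le> (L + 1) * (r k - l k)" .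
    qed
    also have "\<dots> = (L + 1) * (\<Sum>k<n. r k - l k)" by (simp add: sum_distrib_left)
    also have "\<dots> < e" using A(2) \<open>L \<ge> 0\<close> by (simp add: field_simps)
    finally show "(\<Sum>k<n. norm (a (r k) - a (l k))) < e" .
  qed (use e \<open>L \<ge> 0\<close> in auto)
qed

lemma square_integrable_iff:
  fixes g :: "real \<Rightarrow> 'a::euclidean_space"
  shows "square_integrable T g \<longleftrightarrow> g absolutely_integrable_on {0..T} \<and> (\<lambda>t. (norm (g t))\<^sup>2) absolutely_integrable_on {0..T}"
proof
  assume g: "square_integrable T g"
  then show "g absolutely_integrable_on {0..T} \<and> (\<lambda>t. (norm (g t))\<^sup>2) absolutely_integrable_on {0..T}"
    using square_integrableD_absolutely[OF g] unfolding square_integrable_def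
    by (auto intro: nonnegative_absolutely_integrable_1)
next
  assume g: "g absolutely_integrable_on {0..T} \<and> (\<lambda>t. (norm (g t))\<^sup>2) absolutely_integrable_on {0..T}"
  then have "(\<lambda>t. (norm (g t))\<^sup>2) integrable_on {0..T}" unfolding absolutely_integrable_on_def by blast
  then show "square_integrable T g"
    using g absolutely_integrable_imp_borel_measurable[where f=g and S="{0..T}"] unfolding square_integrable_def by auto
qed

lemma lebesgue_integral_norm_sq:
  assumes "square_integrable T g"
  shows "(LINT t:{0..T}|lebesgue. (norm (g t))\<^sup>2) = sq_integral T g"
  unfolding sq_integral_def
  by (rule set_lebesgue_integral_eq_integral(2)) (use assms in \<open>auto simp: square_integrable_iff\<close>)

lemma set_lebesgue_integral_spike:
  fixes f g :: "real \<Rightarrow> real"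
  assumes "negligible N" "\<And>t. t \<in> S - N \<Longrightarrow> f t = g t"
  shows "(LINT t:S|lebesgue. f t) = (LINT t:S|lebesgue. g t)"
proof (cases "f absolutely_integrable_on S")
  case True
  then have "g absolutely_integrable_on S"
    by (rule absolutely_integrable_spike[OF _ assms(1)]) (use assms(2) in simp)
  moreover have "integral S f = integral S g"
    by (rule integral_spike[OF assms(1)]) (use assms(2) in simp)
  ultimately show ?thesis using True by (simp add: set_lebesgue_integral_eq_integral(2))
next
  case False
  then have "\<not> g absolutely_integrable_on S"
    using absolutely_integrable_spike[OF _ assms(1), where f=g and g=f and T=S] assms(2) by blast
  with False show ?thesis
    unfolding set_integrable_def set_lebesgue_integral_def by (simp add: not_integrable_integral_eq)
qed

lemma square_integrable_spike:
  assumes "square_integrable T g" "negligible N" "\<And>t. t \<in> {0..T} - N \<Longrightarrow> g' t = g t"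
  shows "square_integrable T g'" "sq_integral T g' = sq_integral T g"
proof -
  have "g' absolutely_integrable_on {0..T}"
    by (rule absolutely_integrable_spike[OF _ assms(2,3)]) (use assms(1) in \<open>auto simp: square_integrable_iff\<close>)
  moreover have "(\<lambda>t. (norm (g' t))\<^sup>2) absolutely_integrable_on {0..T}"
    by (rule absolutely_integrable_spike[OF _ assms(2), where f="\<lambda>t. (norm (g t))\<^sup>2"]) (use assms in \<open>auto simp: square_integrable_iff\<close>)
  ultimately show "square_integrable T g'" by (simp add: square_integrable_iff)
  show "sq_integral T g' = sq_integral T g" unfolding sq_integral_def
    by (rule integral_spike[OF assms(2)]) (use assms(3) in auto)
qed

text \<open>Turns the parametric form of Minkowski's inequality into the triangle inequality: the optimal
  parameter is \<open>sqrt B / sqrt A\<close>, or a limit of parameters if \<open>A\<close> or \<open>B\<close> is \<open>0\<close>.\<close>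

lemma sqrt_le_sqrt_add_sqrt:
  fixes A B C :: real
  assumes "A \<ge> 0" "B \<ge> 0" "\<And>s. s > 0 \<Longrightarrow> C \<le> (1 + s) * A + (1 + 1/s) * B"
  shows "sqrt C \<le> sqrt A + sqrt B"
proof (cases "A = 0 \<or> B = 0")
  case False
  then have AB: "A > 0" "B > 0" using assms by auto
  have "C \<le> (1 + sqrt B / sqrt A) * A + (1 + 1/(sqrt B / sqrt A)) * B"
    using AB by (intro assms(3)) auto
  also have "\<dots> = A + B + sqrt B * (A / sqrt A) + sqrt A * (B / sqrt B)"
    by (simp add: algebra_simps)
  also have "\<dots> = (sqrt A + sqrt B)\<^sup>2"
    using AB by (simp add: real_div_sqrt power2_sum)
  finally show ?thesis using AB by (intro real_le_lsqrt) auto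
next
  case True
  have "C \<le> A + B"
  proof (rule field_le_epsilon)
    fix e :: real assume e: "e > 0"
    show "C \<le> A + B + e"
    proof (cases "A = 0")
      case True
      have "C \<le> (1 + 1 / ((B + 1) / e)) * B" using assms(3)[of "(B + 1) / e"] e assms(2) True by simp
      also have "\<dots> \<le> B + e" using e assms(2) by (simp add: field_simps)
      finally show ?thesis using True by simp
    next
      case False
      then have "B = 0" using \<open>A = 0 \<or> B = 0\<close> by blast
      then have "C \<le> (1 + e / (A + 1)) * A" using assms(3)[of "e / (A + 1)"] e assms(1) by simp
      also have "\<dots> \<le> A + e" using e assms(1) by (simp add: field_simps)
      finally show ?thesis using \<open>B = 0\<close> by simp
    qed
  qed
  then have "sqrt C \<le> sqrt (A + B)" by simp
  then show ?thesis using True by auto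
qed

definition slope :: "(nat \<Rightarrow> real) \<Rightarrow> (real \<Rightarrow> 'a::real_vector) \<Rightarrow> nat \<Rightarrow> 'a" where
  "slope \<tau> x k = (x (\<tau> (Suc k)) - x (\<tau> k)) /\<^sub>R (\<tau> (Suc k) - \<tau> k)"

context
  fixes T :: real
  assumes T: "T > 0"
begin

lemma W2_D:
  fixes a :: "real \<Rightarrow> 'a::euclidean_space"
  assumes "a \<in> W2 T"
  shows "continuous_on {0..T} a" "weak_derivative T a (wderiv T a)" "square_integrable T (wderiv T a)"
    and "a \<in> extensional {0..T}" "abs_continuous_path T a"
proof -
  show c: "continuous_on {0..T} a" using assms abs_continuous_path_imp_continuous by (auto simp: W2_def)
  obtain g where g: "weak_derivative T a g" "(\<lambda>t. (norm (g t))\<^sup>2) absolutely_integrable_on {0..T}"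
    using assms by (auto simp: W2_def)
  show w: "weak_derivative T a (wderiv T a)" unfolding wderiv_def by (rule someI[of _ g]) (rule g)
  obtain N where N: "negligible N" "\<forall>t\<in>{0..T} - N. wderiv T a t = g t"
    using weak_derivative_unique[OF w g(1) T] by blast
  have "square_integrable T g" using g by (auto simp: square_integrable_iff weak_derivative_def)
  then show "square_integrable T (wderiv T a)"
    by (rule square_integrable_spike[OF _ N(1)]) (use N in auto)
qed (use assms in \<open>auto simp: W2_def\<close>)

lemma wderiv_spike:
  fixes a :: "real \<Rightarrow> 'a::euclidean_space"
  assumes "weak_derivative T a g"
  obtains N where "negligible N" "\<And>t. t \<in> {0..T} - N \<Longrightarrow> wderiv T a t = g t"
proof -
  have "weak_derivative T a (wderiv T a)" unfolding wderiv_def by (rule someI[of _ g]) (rule assms)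
  from weak_derivative_unique[OF this assms T] obtain N where N: "negligible N" "\<forall>t\<in>{0..T} - N. wderiv T a t = g t" by blast
  show thesis by (rule that[OF N(1)]) (use N(2) in blast)
qed

lemma W2_I:
  fixes a :: "real \<Rightarrow> 'a::euclidean_space"
  assumes "a \<in> extensional {0..T}" "abs_continuous_path T a" "weak_derivative T a g" "square_integrable T g"
  shows "a \<in> W2 T"
  using assms unfolding W2_def square_integrable_iff by auto

lemma W2_diff:
  fixes a b :: "real \<Rightarrow> 'a::euclidean_space"
  assumes "a \<in> W2 T" "b \<in> W2 T"
  shows "(\<lambda>t\<in>{0..T}. a t - b t) \<in> W2 T"
  using W2_D[OF assms(1)] W2_D[OF assms(2)]
  by (intro W2_I[of _ "\<lambda>t. wderiv T a t - wderiv T b t"] abs_continuous_path_diff weak_derivative_diff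
      square_integrable_diff) auto

text \<open>The chosen weak derivative of a difference agrees with the difference of the chosen weak derivatives
  almost everywhere, which is enough under the integral.\<close>

lemma W2_dist_eq:
  fixes a b :: "real \<Rightarrow> 'a::euclidean_space"
  assumes "a \<in> W2 T" "b \<in> W2 T"
  shows "W2_dist T a b = sqrt ((norm (a 0 - b 0))\<^sup>2 + sq_integral T (\<lambda>t. wderiv T a t - wderiv T b t))"
proof -
  note A = W2_D[OF assms(1)] and B = W2_D[OF assms(2)] and C = W2_D[OF W2_diff[OF assms]]
  obtain N where N: "negligible N" 
    "\<And>t. t \<in> {0..T} - N \<Longrightarrow> wderiv T (\<lambda>t\<in>{0..T}. a t - b t) t = wderiv T a t - wderiv T b t"
    by (rule wderiv_spike[OF weak_derivative_diff[OF A(2) B(2) A(1) B(1)]], blast)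
  have "sq_integral T (wderiv T (\<lambda>t\<in>{0..T}. a t - b t)) = sq_integral T (\<lambda>t. wderiv T a t - wderiv T b t)"
    by (rule square_integrable_spike(2)[OF square_integrable_diff[OF A(3) B(3)] N])
  then show ?thesis
    unfolding W2_dist_def W2_norm_def lebesgue_integral_norm_sq[OF C(3)] using T by simp
qed

lemma W2_integral:
  fixes a :: "real \<Rightarrow> 'a::euclidean_space"
  assumes "a \<in> W2 T" "t \<in> {0..T}"
  shows "a t = a 0 + integral {0..t} (wderiv T a)"
  by (rule weak_derivative_imp_integral[OF W2_D(2,1)[OF assms(1)] T assms(2)])

text \<open>The Sobolev embedding into the continuous functions. The bound \<open>r\<close> is kept positive so that it
  can serve as the parameter in \<open>integral_norm_le_sq_integral\<close>.\<close>

lemma W2_dist_imp_sup_le: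
  fixes a b :: "real \<Rightarrow> 'a::euclidean_space"
  assumes ab: "a \<in> W2 T" "b \<in> W2 T" and r: "W2_dist T a b \<le> r" "r > 0" and t: "t \<in> {0..T}"
  shows "norm (a t - b t) \<le> (2 + T) * r"
proof -
  note A = W2_D[OF ab(1)] and B = W2_D[OF ab(2)]
  let ?g = "\<lambda>t. wderiv T a t - wderiv T b t"
  have S: "square_integrable T ?g" by (rule square_integrable_diff[OF A(3) B(3)])
  have "(norm (a 0 - b 0))\<^sup>2 + sq_integral T ?g \<le> r\<^sup>2"
    using r unfolding W2_dist_eq[OF ab] by (simp add: real_sqrt_le_iff' sqrt_le_D)
  then have 1: "(norm (a 0 - b 0))\<^sup>2 \<le> r\<^sup>2" and 2: "sq_integral T ?g \<le> r\<^sup>2"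
    using sq_integral_nonneg[of T ?g] zero_le_power2[of "norm (a 0 - b 0)"] by linarith+
  from 1 have 1: "norm (a 0 - b 0) \<le> r" using r by (simp add: power2_le_iff_abs_le)
  have ai: "wderiv T a integrable_on {0..t}" "wderiv T b integrable_on {0..t}"
    using t by (auto intro!: absolutely_integrable_imp_integrable_subinterval[where T=T] square_integrableD_absolutely A(3) B(3))
  have ni: "(\<lambda>t. norm (?g t)) integrable_on {0..T}" and gi: "?g integrable_on {0..T}"
    using square_integrableD_absolutely[OF S] by (auto simp: absolutely_integrable_on_def)
  have "norm (integral {0..t} ?g) \<le> integral {0..t} (\<lambda>t. norm (?g t))"
    using t by (intro integral_norm_bound_integral integrable_subinterval_real[OF ni] integrable_subinterval_real[OF gi]) auto
  also have "\<dots> \<le> integral {0..T} (\<lambda>t. norm (?g t))"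
    using ni t by (intro integral_subset_le integrable_subinterval_real[OF ni]) auto
  also have "\<dots> \<le> (r * T + sq_integral T ?g / r) / 2"
    by (rule integral_norm_le_sq_integral[OF S]) (use r T in auto)
  also have "\<dots> \<le> (r * T + r\<^sup>2 / r) / 2"
    using 2 r by (intro divide_right_mono add_left_mono) auto
  also have "\<dots> \<le> (1 + T) * r" using r T by (simp add: power2_eq_square field_simps)
  finally have 3: "norm (integral {0..t} ?g) \<le> (1 + T) * r" .
  have "a t - b t = (a 0 - b 0) + integral {0..t} ?g"
    unfolding integral_diff[OF ai] using W2_integral[OF ab(1) t] W2_integral[OF ab(2) t] by simp
  then have "norm (a t - b t) \<le> norm (a 0 - b 0) + norm (integral {0..t} ?g)"
    by (metis norm_triangle_ineq)
  also have "\<dots> \<le> r + (1 + T) * r" using 1 3 by (rule add_mono)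
  finally show ?thesis by (simp add: algebra_simps)
qed

text \<open>The distance of a metric space is required to be symmetric off the carrier as well. If \<open>a - b\<close> has no weak
  derivative, neither has \<open>b - a\<close>, and the choice operator returns the same value for both.\<close>

lemma W2_dist_commute:
  fixes a b :: "real \<Rightarrow> 'a::euclidean_space"
  shows "W2_dist T a b = W2_dist T b a"
proof -
  define u where "u = (\<lambda>t\<in>{0..T}. a t - b t)"
  define v where "v = (\<lambda>t\<in>{0..T}. b t - a t)"
  have uv: "v t = - u t" "u t = - v t" if "t \<in> {0..T}" for t using that by (auto simp: u_def v_def)
  have n0: "norm (u 0) = norm (v 0)" using T by (simp add: u_def v_def norm_minus_commute)
  have "(LINT t:{0..T}|lebesgue. (norm (wderiv T u t))\<^sup>2) = (LINT t:{0..T}|lebesgue. (norm (wderiv T v t))\<^sup>2)"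
  proof (cases "\<exists>g. weak_derivative T u g")
    case True
    then have "weak_derivative T u (wderiv T u)" unfolding wderiv_def by (rule someI_ex)
    then have "weak_derivative T v (\<lambda>t. - wderiv T u t)" by (rule weak_derivative_uminus) (rule uv)
    then obtain N where N: "negligible N" "\<And>t. t \<in> {0..T} - N \<Longrightarrow> wderiv T v t = - wderiv T u t"
      by (rule wderiv_spike, blast)
    show ?thesis by (rule set_lebesgue_integral_spike[OF N(1)]) (use N(2) in simp)
  next
    case False
    then have "\<not> weak_derivative T v g" for g using weak_derivative_uminus[of T v g u] uv by blast
    with False have "weak_derivative T u = weak_derivative T v" by (intro ext) blast
    then have "wderiv T u = wderiv T v" unfolding wderiv_def by simp
    then show ?thesis by simp
  qed
  then show ?thesis unfolding W2_dist_def W2_norm_def using n0 unfolding u_def v_def by simp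
qed

lemma Metric_space_W2: "Metric_space (W2 T :: (real \<Rightarrow> 'a::euclidean_space) set) (W2_dist T)"
proof
  show "0 \<le> W2_dist T a b" for a b :: "real \<Rightarrow> 'a"
  proof -
    have "0 \<le> (LINT t:{0..T}|lebesgue. (norm (wderiv T (\<lambda>t\<in>{0..T}. a t - b t) t))\<^sup>2)"
      unfolding set_lebesgue_integral_def by (rule Bochner_Integration.integral_nonneg) simp
    then show ?thesis unfolding W2_dist_def W2_norm_def by simp
  qed
next
  show "W2_dist T a b = W2_dist T b a" for a b :: "real \<Rightarrow> 'a" by (rule W2_dist_commute)
next
  fix a b :: "real \<Rightarrow> 'a" assume ab: "a \<in> W2 T" "b \<in> W2 T"
  show "W2_dist T a b = 0 \<longleftrightarrow> a = b"
  proof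
    assume 0: "W2_dist T a b = 0"
    have "a t = b t" if t: "t \<in> {0..T}" for t
    proof -
      have "norm (a t - b t) \<le> 0 + e" if "e > 0" for e
      proof -
        have "(2 + T) * (e / (2 + T)) = e" using T by simp
        then show ?thesis using W2_dist_imp_sup_le[OF ab _ _ t, of "e / (2 + T)"] 0 that T by simp
      qed
      then have "norm (a t - b t) \<le> 0" by (rule field_le_epsilon)
      then show ?thesis by simp
    qed
    then show "a = b" using W2_D(4)[OF ab(1)] W2_D(4)[OF ab(2)] by (intro extensionalityI) auto
  next
    assume "a = b" then show "W2_dist T a b = 0"
      unfolding W2_dist_eq[OF ab] by (simp add: sq_integral_def)
  qed
next
  fix a b c :: "real \<Rightarrow> 'a" assume abc: "a \<in> W2 T" "b \<in> W2 T" "c \<in> W2 T"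
  note A = W2_D(3)[OF abc(1)] and B = W2_D(3)[OF abc(2)] and C = W2_D(3)[OF abc(3)]
  show "W2_dist T a c \<le> W2_dist T a b + W2_dist T b c"
    unfolding W2_dist_eq[OF abc(1,3)] W2_dist_eq[OF abc(1,2)] W2_dist_eq[OF abc(2,3)]
  proof (rule sqrt_le_sqrt_add_sqrt)
    fix s :: real assume s: "s > 0"
    have "(norm ((a 0 - b 0) + (b 0 - c 0)))\<^sup>2 \<le> (1 + s) * (norm (a 0 - b 0))\<^sup>2 + (1 + 1/s) * (norm (b 0 - c 0))\<^sup>2"
      by (rule norm_add_sq_le[OF s])
    moreover have "sq_integral T (\<lambda>t. (wderiv T a t - wderiv T b t) + (wderiv T b t - wderiv T c t))
       \<le> (1 + s) * sq_integral T (\<lambda>t. wderiv T a t - wderiv T b t) + (1 + 1/s) * sq_integral T (\<lambda>t. wderiv T b t - wderiv T c t)"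
      by (rule sq_integral_add_le[OF square_integrable_diff[OF A B] square_integrable_diff[OF B C] s])
    ultimately show "(norm (a 0 - c 0))\<^sup>2 + sq_integral T (\<lambda>t. wderiv T a t - wderiv T c t)
      \<le> (1 + s) * ((norm (a 0 - b 0))\<^sup>2 + sq_integral T (\<lambda>t. wderiv T a t - wderiv T b t))
       + (1 + 1/s) * ((norm (b 0 - c 0))\<^sup>2 + sq_integral T (\<lambda>t. wderiv T b t - wderiv T c t))"
      by (simp add: algebra_simps)
  qed (auto intro: add_nonneg_nonneg sq_integral_nonneg)
qed

lemma topspace_W2_topology: "topspace (W2_topology T) = W2 T"
  unfolding W2_topology_def using Metric_space.topspace_mtopology[OF Metric_space_W2] .

lemma limitin_W2_iff:
  fixes u :: "nat \<Rightarrow> real \<Rightarrow> 'a::euclidean_space"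
  assumes "\<And>i. u i \<in> W2 T" 
  shows "limitin (W2_topology T) u v sequentially \<longleftrightarrow> v \<in> W2 T \<and> (\<lambda>i. W2_dist T (u i) v) \<longlonglongrightarrow> 0"
  unfolding W2_topology_def Metric_space.limitin_metric_dist_null[OF Metric_space_W2] using assms by simp

lemma W2_tendsto_imp_uniform_limit:
  fixes u :: "nat \<Rightarrow> real \<Rightarrow> 'a::euclidean_space"
  assumes u: "\<And>i. u i \<in> W2 T" and v: "v \<in> W2 T" and lim: "(\<lambda>i. W2_dist T (u i) v) \<longlonglongrightarrow> 0"
  shows "uniform_limit {0..T} u v sequentially"
proof (rule uniform_limitI)
  fix e :: real assume e: "e > 0"
  define e' where "e' = e / 2"
  define r where "r = e' / (2 + T)"
  have "(2 + T) * r = e'" using T by (simp add: r_def)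
  then have r: "r > 0" "(2 + T) * r < e" using e T by (auto simp: r_def e'_def)
  have "\<forall>\<^sub>F i in sequentially. W2_dist T (u i) v < r"
    by (rule order_tendstoD(2)[OF lim r(1)])
  then show "\<forall>\<^sub>F i in sequentially. \<forall>t\<in>{0..T}. dist (u i t) (v t) < e"
  proof (rule eventually_mono, intro ballI)
    fix i t assume "W2_dist T (u i) v < r" "t \<in> {0..T}"
    then show "dist (u i t) (v t) < e"
      using W2_dist_imp_sup_le[OF u v, of i r t] r by (simp add: dist_norm)
  qed
qed

lemma W2_tendsto_imp_wderiv_tendsto:
  fixes u :: "nat \<Rightarrow> real \<Rightarrow> 'a::euclidean_space"
  assumes u: "\<And>i. u i \<in> W2 T" and v: "v \<in> W2 T" and lim: "(\<lambda>i. W2_dist T (u i) v) \<longlonglongrightarrow> 0"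
  shows "(\<lambda>i. sq_integral T (\<lambda>t. wderiv T (u i) t - wderiv T v t)) \<longlonglongrightarrow> 0"
proof (rule Lim_null_comparison)
  show "(\<lambda>i. (W2_dist T (u i) v)\<^sup>2) \<longlonglongrightarrow> 0" using tendsto_power[OF lim, of 2] by simp
  show "\<forall>\<^sub>F i in sequentially. norm (sq_integral T (\<lambda>t. wderiv T (u i) t - wderiv T v t)) \<le> (W2_dist T (u i) v)\<^sup>2"
    unfolding W2_dist_eq[OF u v] by (intro always_eventually) (simp add: sq_integral_nonneg)
qed


lemma PL_affine_on_cell:
  assumes P: "partition_of T N \<tau>" and x: "x \<in> PL T N \<tau>" and k: "k < N" and t: "t \<in> {\<tau> k..\<tau> (Suc k)}"
  shows "x t = x (\<tau> k) + (t - \<tau> k) *\<^sub>R ((x (\<tau> (Suc k)) - x (\<tau> k)) /\<^sub>R (\<tau> (Suc k) - \<tau> k))"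
proof -
  have lt: "\<tau> k < \<tau> (Suc k)" using P k by (auto simp: partition_of_def)
  obtain a b where ab: "\<And>t. t \<in> {\<tau> k..\<tau> (Suc k)} \<Longrightarrow> x t = a + t *\<^sub>R b" using x k by (auto simp: PL_def)
  have "x (\<tau> k) = a + \<tau> k *\<^sub>R b" "x (\<tau> (Suc k)) = a + \<tau> (Suc k) *\<^sub>R b" using ab lt by auto
  moreover from this have "(x (\<tau> (Suc k)) - x (\<tau> k)) /\<^sub>R (\<tau> (Suc k) - \<tau> k) = b"
    using lt by (simp add: scaleR_diff_left[symmetric])
  ultimately show ?thesis using ab[OF t] by (simp add: algebra_simps)
qed

lemma PL_weak_derivative:
  fixes x :: "real \<Rightarrow> 'a::euclidean_space"
  assumes P: "partition_of T N \<tau>" and x: "x \<in> PL T N \<tau>"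
  shows "weak_derivative T x (step_fun N \<tau> (slope \<tau> x))"
proof (rule weak_derivative_piecewise_C1[of _ _ "\<tau> ` {..N}"])
  fix t assume t: "t \<in> {0<..<T} - \<tau> ` {..N}"
  then obtain k where k: "k < N" "t \<in> {\<tau> k<..\<tau> (Suc k)}" using partition_cell_exists[OF P, of t] by auto
  with t have tk: "t \<in> {\<tau> k<..<\<tau> (Suc k)}"
    by (metis DiffD2 Suc_leI atMost_iff greaterThanAtMost_iff greaterThanLessThan_iff image_eqI less_eq_real_def)
  have "((\<lambda>t. x (\<tau> k) + (t - \<tau> k) *\<^sub>R slope \<tau> x k) has_vector_derivative slope \<tau> x k) (at t)"
    by (auto intro!: derivative_eq_intros)
  then have "(x has_vector_derivative slope \<tau> x k) (at t)"
    by (rule has_vector_derivative_transform_within_open[of _ _ _ "{\<tau> k<..<\<tau> (Suc k)}"])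
       (use tk in \<open>auto intro!: PL_affine_on_cell[OF P x k(1), folded slope_def, symmetric]\<close>)
  then show "(x has_vector_derivative step_fun N \<tau> (slope \<tau> x) t) (at t)"
    by (simp add: step_fun_on_cell[OF P k])
qed (use x T step_fun_absolutely_integrable[OF P] in \<open>auto simp: PL_def\<close>)

lemma step_fun_integral_lipschitz:
  fixes c :: "nat \<Rightarrow> 'a::euclidean_space"
  assumes P: "partition_of T N \<tau>" and B: "\<And>k. k < N \<Longrightarrow> norm (c k) \<le> B" "0 \<le> B" and st: "0 \<le> s" "s \<le> t" "t \<le> T"
  shows "norm (integral {0..t} (step_fun N \<tau> c) - integral {0..s} (step_fun N \<tau> c)) \<le> B * (t - s)"
proof -
  have i: "step_fun N \<tau> c integrable_on {0..T}"
    using step_fun_absolutely_integrable[OF P] by (auto simp: absolutely_integrable_on_def)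
  have "integral {0..s} (step_fun N \<tau> c) + integral {s..t} (step_fun N \<tau> c) = integral {0..t} (step_fun N \<tau> c)"
    using st by (intro Henstock_Kurzweil_Integration.integral_combine integrable_subinterval_real[OF i]) auto
  then have "integral {0..t} (step_fun N \<tau> c) - integral {0..s} (step_fun N \<tau> c) = integral {s..t} (step_fun N \<tau> c)"
    by (simp add: algebra_simps)
  also have "norm \<dots> \<le> integral {s..t} (\<lambda>_. B)"
    using st by (intro integral_norm_bound_integral integrable_subinterval_real[OF i])
       (auto intro!: step_fun_norm_le[OF P B])
  also have "\<dots> = B * (t - s)" using st by (simp add: mult.commute)
  finally show ?thesis .
qed

lemma PL_subset_W2: 
  assumes P: "partition_of T N \<tau>"
  shows "PL T N \<tau> \<subseteq> (W2 T :: (real \<Rightarrow> 'a::euclidean_space) set)"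
proof
  fix x :: "real \<Rightarrow> 'a" assume x: "x \<in> PL T N \<tau>"
  note w = PL_weak_derivative[OF P x]
  have c: "continuous_on {0..T} x" using x by (simp add: PL_def)
  define B where "B = (\<Sum>k<N. norm (slope \<tau> x k))"
  have B: "norm (slope \<tau> x k) \<le> B" if "k < N" for k unfolding B_def using that by (intro member_le_sum) auto
  have B0: "0 \<le> B" unfolding B_def by (intro sum_nonneg) auto
  show "x \<in> W2 T"
  proof (rule W2_I[OF _ _ w])
    show "abs_continuous_path T x"
    proof (rule abs_continuous_path_lipschitz[OF _ B0])
      fix s t assume st: "0 \<le> s" "s \<le> t" "t \<le> T"
      have "x t - x s = integral {0..t} (step_fun N \<tau> (slope \<tau> x)) - integral {0..s} (step_fun N \<tau> (slope \<tau> x))"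
        using weak_derivative_imp_integral[OF w c T, of t] weak_derivative_imp_integral[OF w c T, of s] st by simp
      also have "norm \<dots> \<le> B * (t - s)" by (rule step_fun_integral_lipschitz[OF P B B0 st])
      finally show "norm (x t - x s) \<le> B * (t - s)" .
    qed
  qed (use x square_integrable_step_fun[OF P] T in \<open>auto simp: PL_def\<close>)
qed

text \<open>The converse of \<open>PL_weak_derivative\<close>: step functions are the derivatives of piecewise linear
  paths.\<close>

lemma PL_primitive:
  fixes c :: "nat \<Rightarrow> 'a::euclidean_space" and v :: 'a
  assumes P: "partition_of T N \<tau>"
  defines "p \<equiv> (\<lambda>t\<in>{0..T}. v + integral {0..t} (step_fun N \<tau> c))"
  shows "p \<in> PL T N \<tau>" "weak_derivative T p (step_fun N \<tau> c)"
    and "\<And>k t. k < N \<Longrightarrow> t \<in> {\<tau> k..\<tau> (Suc k)} \<Longrightarrow> p t = p (\<tau> k) + (t - \<tau> k) *\<^sub>R c k"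
proof -
  have i: "step_fun N \<tau> c integrable_on {0..T}"
    using step_fun_absolutely_integrable[OF P] by (auto simp: absolutely_integrable_on_def)
  have "continuous_on {0..T} (\<lambda>t. v + integral {0..t} (step_fun N \<tau> c))"
    by (intro continuous_intros indefinite_integral_continuous_1 i)
  then have pc: "continuous_on {0..T} p"
    unfolding p_def by (subst continuous_on_cong[OF refl restrict_apply']) auto
  have aff: "p t = p (\<tau> k) + (t - \<tau> k) *\<^sub>R c k" if k: "k < N" and t: "t \<in> {\<tau> k..\<tau> (Suc k)}" for k t
  proof -
    have r: "0 \<le> \<tau> k" "\<tau> (Suc k) \<le> T" using partition_range[OF P] k by auto
    have "integral {0..\<tau> k} (step_fun N \<tau> c) + integral {\<tau> k..t} (step_fun N \<tau> c) = integral {0..t} (step_fun N \<tau> c)"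
      using t r by (intro Henstock_Kurzweil_Integration.integral_combine integrable_subinterval_real[OF i]) auto
    moreover have "integral {\<tau> k..t} (step_fun N \<tau> c) = integral {\<tau> k..t} (\<lambda>_. c k)"
      by (rule integral_spike[of "{\<tau> k}"]) (use t in \<open>auto intro!: step_fun_on_cell[OF P k, symmetric]\<close>)
    moreover have "integral {\<tau> k..t} (\<lambda>_. c k) = (t - \<tau> k) *\<^sub>R c k" using t by simp
    ultimately show ?thesis using t r by (simp add: p_def algebra_simps)
  qed
  then show "\<And>k t. k < N \<Longrightarrow> t \<in> {\<tau> k..\<tau> (Suc k)} \<Longrightarrow> p t = p (\<tau> k) + (t - \<tau> k) *\<^sub>R c k" .
  show pPL: "p \<in> PL T N \<tau>"
    unfolding PL_def
  proof (intro CollectI conjI allI impI pc)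
    show "p \<in> extensional {0..T}" unfolding p_def by simp
    fix k assume k: "k < N"
    show "\<exists>a b. \<forall>t\<in>{\<tau> k..\<tau> (Suc k)}. p t = a + t *\<^sub>R b"
      by (rule exI[of _ "p (\<tau> k) - \<tau> k *\<^sub>R c k"], rule exI[of _ "c k"]) (use aff[OF k] in \<open>auto simp: algebra_simps\<close>)
  qed
  have "slope \<tau> p k = c k" if k: "k < N" for k
  proof -
    have lt: "\<tau> k < \<tau> (Suc k)" using P k by (auto simp: partition_of_def)
    show ?thesis using aff[OF k, of "\<tau> (Suc k)"] lt by (simp add: slope_def)
  qed
  then have "step_fun N \<tau> (slope \<tau> p) = step_fun N \<tau> c" unfolding step_fun_def by (intro ext sum.cong) auto
  then show "weak_derivative T p (step_fun N \<tau> c)" using PL_weak_derivative[OF P pPL] by simp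
qed

text \<open>The paths \<open>u i\<close> almost minimize the distance to \<open>x\<close> among the admissible ones; the density of
  step functions in \<open>L\<^sup>2\<close> shows that the infimum tends to \<open>0\<close>. This replaces an explicit
  projection onto the step functions.\<close>

lemma PL_dense:
  fixes x :: "real \<Rightarrow> 'a::euclidean_space"
  assumes P: "\<And>i. partition_of T (N i) (\<tau> i)" and m: "(\<lambda>i. mesh (N i) (\<tau> i)) \<longlonglongrightarrow> 0" and x: "x \<in> W2 T"
  obtains u where "\<And>i. u i \<in> PL T (N i) (\<tau> i)" "\<And>i. u i 0 = x 0" "(\<lambda>i. W2_dist T (u i) x) \<longlonglongrightarrow> 0"
proof -
  define D where "D = (\<lambda>i. (\<lambda>u. W2_dist T u x) ` {u \<in> PL T (N i) (\<tau> i). u 0 = x 0})"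
  have nn: "0 \<le> W2_dist T u x" for u using Metric_space.nonneg[OF Metric_space_W2] .
  have bb: "bdd_below (D i)" for i unfolding D_def using nn by (intro bdd_belowI[of _ 0]) auto
  have prim: "\<exists>p\<in>{u \<in> PL T (N i) (\<tau> i). u 0 = x 0}. W2_dist T p x = sqrt (sq_integral T (\<lambda>t. wderiv T x t - step_fun (N i) (\<tau> i) c t))"
    for i c
  proof -
    define p where "p = (\<lambda>t\<in>{0..T}. x 0 + integral {0..t} (step_fun (N i) (\<tau> i) c))"
    note p = PL_primitive[OF P[of i], where v="x 0" and c=c, folded p_def]
    have p0: "p 0 = x 0" using T by (simp add: p_def)
    have pW: "p \<in> W2 T" using PL_subset_W2[OF P] p(1) by blast
    obtain E where E: "negligible E" "\<And>t. t \<in> {0..T} - E \<Longrightarrow> wderiv T p t = step_fun (N i) (\<tau> i) c t"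
      using wderiv_spike[OF p(2)] by blast
    have "sq_integral T (\<lambda>t. wderiv T p t - wderiv T x t) = sq_integral T (\<lambda>t. step_fun (N i) (\<tau> i) c t - wderiv T x t)"
      by (rule square_integrable_spike(2)[OF square_integrable_diff[OF square_integrable_step_fun[OF P] W2_D(3)[OF x]] E(1)])
         (use T E in auto)
    also have "\<dots> = sq_integral T (\<lambda>t. wderiv T x t - step_fun (N i) (\<tau> i) c t)"
      unfolding sq_integral_def by (simp add: norm_minus_commute)
    finally have "W2_dist T p x = sqrt (sq_integral T (\<lambda>t. wderiv T x t - step_fun (N i) (\<tau> i) c t))"
      unfolding W2_dist_eq[OF pW x] using p0 by simp
    then show ?thesis using p(1) p0 by blast
  qed
  have ne: "D i \<noteq> {}" for i using prim[of i "\<lambda>_. 0"] unfolding D_def by blast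
  have "\<exists>u. u \<in> PL T (N i) (\<tau> i) \<and> u 0 = x 0 \<and> W2_dist T u x < Inf (D i) + 1 / real (Suc i)" for i
  proof -
    have "\<exists>d\<in>D i. d < Inf (D i) + 1 / real (Suc i)"
      by (subst cInf_less_iff[OF ne bb, symmetric]) simp
    then show ?thesis unfolding D_def by auto
  qed
  then obtain u where u: "\<And>i. u i \<in> PL T (N i) (\<tau> i)" "\<And>i. u i 0 = x 0"
    "\<And>i. W2_dist T (u i) x < Inf (D i) + 1 / real (Suc i)" by metis
  have "(\<lambda>i. Inf (D i)) \<longlonglongrightarrow> 0"
  proof (rule tendstoI)
    fix e :: real assume e: "e > 0"
    have "\<forall>\<^sub>F i in sequentially. \<exists>c. sq_integral T (\<lambda>t. wderiv T x t - step_fun (N i) (\<tau> i) c t) < e\<^sup>2"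
      by (rule step_fun_dense[OF P m T W2_D(3)[OF x]]) (use e in simp)
    then show "\<forall>\<^sub>F i in sequentially. dist (Inf (D i)) 0 < e"
    proof (rule eventually_mono)
      fix i assume "\<exists>c. sq_integral T (\<lambda>t. wderiv T x t - step_fun (N i) (\<tau> i) c t) < e\<^sup>2"
      then obtain c where c: "sq_integral T (\<lambda>t. wderiv T x t - step_fun (N i) (\<tau> i) c t) < e\<^sup>2" by blast
      then have "sqrt (sq_integral T (\<lambda>t. wderiv T x t - step_fun (N i) (\<tau> i) c t)) < e"
        using e by (intro real_less_lsqrt) auto
      moreover obtain p where "p \<in> {u \<in> PL T (N i) (\<tau> i). u 0 = x 0}"
        "W2_dist T p x = sqrt (sq_integral T (\<lambda>t. wderiv T x t - step_fun (N i) (\<tau> i) c t))"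
        using prim[of i c] by blast
      ultimately obtain d where "d \<in> D i" "d < e" unfolding D_def by (metis (no_types, lifting) imageI)
      then have "Inf (D i) < e" using cInf_lower[OF _ bb] by (meson le_less_trans)
      moreover have "0 \<le> Inf (D i)" by (rule cInf_greatest[OF ne]) (use nn in \<open>auto simp: D_def\<close>)
      ultimately show "dist (Inf (D i)) 0 < e" by simp
    qed
  qed
  moreover have "(\<lambda>i. 1 / real (Suc i)) \<longlonglongrightarrow> 0" using LIMSEQ_Suc[OF lim_1_over_n] by simp
  ultimately have "(\<lambda>i. Inf (D i) + 1 / real (Suc i)) \<longlonglongrightarrow> 0 + 0" by (rule tendsto_add)
  then have lim: "(\<lambda>i. Inf (D i) + 1 / real (Suc i)) \<longlonglongrightarrow> 0" by simp
  have "(\<lambda>i. W2_dist T (u i) x) \<longlonglongrightarrow> 0"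
  proof (rule Lim_null_comparison[OF always_eventually lim], rule allI)
    show "norm (W2_dist T (u i) x) \<le> Inf (D i) + 1 / real (Suc i)" for i
      using u(3)[of i] nn[of "u i"] by (simp only: real_norm_def abs_of_nonneg less_imp_le)
  qed
  then show thesis by (rule that[OF u(1,2)])
qed

end

section \<open>The differential equation and its trapezoidal discretization\<close>

lemma integral_exp:
  fixes c :: real
  assumes "c \<noteq> 0" "0 \<le> t"
  shows "((\<lambda>s. exp (c * s)) has_integral (exp (c * t) - 1) / c) {0..t}"
proof -
  have "((\<lambda>s. exp (c * s)) has_integral exp (c * t) / c - exp (c * 0) / c) {0..t}"
    using assms by (intro fundamental_theorem_of_calculus)
      (auto intro!: derivative_eq_intros simp: has_real_derivative_iff_has_vector_derivative[symmetric])
  then show ?thesis by (simp add: diff_divide_distrib)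
qed

text \<open>In the variable \<open>u t = exp (- (c * t)) *\<^sub>R z t\<close> with \<open>c = 2 * L\<close>, the integral operator is a
  contraction with factor \<open>1/2\<close> for the supremum norm, whatever the length of the interval. Functions
  on \<open>{0..T}\<close> are extended to the real line by clamping, so that Banach's fixed point theorem
  applies to the complete space of bounded continuous functions.\<close>

lemma volterra_exists_unique:
  fixes H :: "real \<Rightarrow> 'b::euclidean_space \<Rightarrow> 'b"
  assumes T: "T > 0" and L: "L > 0"
    and Hc: "\<And>z. continuous_on {0..T} z \<Longrightarrow> continuous_on {0..T} (\<lambda>t. H t (z t))"
    and lip: "\<And>t a b. t \<in> {0..T} \<Longrightarrow> norm (H t a - H t b) \<le> L * norm (a - b)"
  shows "\<exists>z. continuous_on {0..T} z \<and> (\<forall>t\<in>{0..T}. z t = v + integral {0..t} (\<lambda>s. H s (z s)))"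
    and "\<And>z z'. continuous_on {0..T} z \<Longrightarrow> (\<And>t. t \<in> {0..T} \<Longrightarrow> z t = v + integral {0..t} (\<lambda>s. H s (z s)))
      \<Longrightarrow> continuous_on {0..T} z' \<Longrightarrow> (\<And>t. t \<in> {0..T} \<Longrightarrow> z' t = v + integral {0..t} (\<lambda>s. H s (z' s)))
      \<Longrightarrow> t \<in> {0..T} \<Longrightarrow> z t = z' t"
proof -
  define c where "c = 2 * L"
  have c: "c > 0" using L by (simp add: c_def)
  define \<Phi> where "\<Phi> = (\<lambda>(u::real \<Rightarrow>\<^sub>C 'b) t. exp (- (c * t)) *\<^sub>R (v + integral {0..t} (\<lambda>s. H s (exp (c * s) *\<^sub>R u s))))"
  have Hu: "continuous_on {0..T} (\<lambda>s. H s (exp (c * s) *\<^sub>R apply_bcontfun u s))" for u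
    by (intro Hc continuous_intros continuous_on_apply_bcontfun)
  have Hi: "(\<lambda>s. H s (exp (c * s) *\<^sub>R apply_bcontfun u s)) integrable_on {0..t}" if "t \<in> {0..T}" for u t
    by (intro integrable_continuous_real continuous_on_subset[OF Hu]) (use that in auto)
  have clamp: "clamp 0 T x \<in> {0..T}" for x
    using clamp_in_interval[of 0 T x] T by simp
  have clamp_id: "clamp 0 T x = x" if "x \<in> {0..T}" for x
    using clamp_cancel_cbox[of x 0 T] that by simp
  have \<Phi>c: "continuous_on (cbox 0 T) (\<Phi> u)" for u
    unfolding \<Phi>_def using Hi[of T u] T
    by (intro continuous_intros) (auto intro!: indefinite_integral_continuous_1)
  have "\<forall>u. \<exists>g :: real \<Rightarrow>\<^sub>C 'b. \<forall>x. g x = \<Phi> u (clamp 0 T x)"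
    using continuous_on_cbox_bcontfunE[OF \<Phi>c] by metis
  then obtain op where op: "\<And>u x. apply_bcontfun (op u) x = \<Phi> u (clamp 0 T x)" by metis
  \<comment> \<open>The factor \<open>1/2\<close> is \<open>L / c\<close>, from the integral of \<open>L * exp (c * s)\<close>.\<close>
  have contr: "dist (op u) (op w) \<le> 1/2 * dist u w" for u w
  proof (rule dist_bound)
    fix x
    define t where "t = clamp 0 T x"
    have t: "t \<in> {0..T}" unfolding t_def by (rule clamp)
    have "norm (integral {0..t} (\<lambda>s. H s (exp (c * s) *\<^sub>R u s) - H s (exp (c * s) *\<^sub>R w s)))
      \<le> integral {0..t} (\<lambda>s. exp (c * s) * (L * dist u w))"
    proof (rule integral_norm_bound_integral)
      show "(\<lambda>s. H s (exp (c * s) *\<^sub>R u s) - H s (exp (c * s) *\<^sub>R w s)) integrable_on {0..t}"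
        by (intro integrable_diff Hi t)
      show "(\<lambda>s. exp (c * s) * (L * dist u w)) integrable_on {0..t}"
        by (intro integrable_continuous_real continuous_intros)
      fix s assume s: "s \<in> {0..t}"
      have "norm (H s (exp (c * s) *\<^sub>R u s) - H s (exp (c * s) *\<^sub>R w s)) \<le> L * norm (exp (c * s) *\<^sub>R u s - exp (c * s) *\<^sub>R w s)"
        by (rule lip) (use s t in auto)
      also have "\<dots> = exp (c * s) * (L * dist (u s) (w s))"
        by (simp add: scaleR_diff_right[symmetric] dist_norm)
      also have "\<dots> \<le> exp (c * s) * (L * dist u w)"
        using L by (intro mult_left_mono dist_bounded) auto
      finally show "norm (H s (exp (c * s) *\<^sub>R u s) - H s (exp (c * s) *\<^sub>R w s)) \<le> exp (c * s) * (L * dist u w)" .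
    qed
    also have "\<dots> = (exp (c * t) - 1) / c * (L * dist u w)"
      using has_integral_mult_left[OF integral_exp[of c t], of "L * dist u w"] c t by (intro integral_unique) auto
    also have "\<dots> = 1/2 * (exp (c * t) - 1) * dist u w" using L unfolding c_def by simp
    finally have I: "norm (integral {0..t} (\<lambda>s. H s (exp (c * s) *\<^sub>R u s) - H s (exp (c * s) *\<^sub>R w s)))
       \<le> 1/2 * (exp (c * t) - 1) * dist u w" .
    have "dist (op u x) (op w x) = exp (- (c * t)) * norm (integral {0..t} (\<lambda>s. H s (exp (c * s) *\<^sub>R u s) - H s (exp (c * s) *\<^sub>R w s)))"
      unfolding op t_def[symmetric] \<Phi>_def dist_norm integral_diff[OF Hi[OF t] Hi[OF t]]
      by (simp add: scaleR_diff_right[symmetric])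
    also have "\<dots> \<le> exp (- (c * t)) * (1/2 * (exp (c * t) - 1) * dist u w)"
      by (intro mult_left_mono I) auto
    also have "\<dots> = 1/2 * (1 - exp (- (c * t))) * dist u w"
      by (simp add: algebra_simps exp_minus)
    also have "\<dots> \<le> 1/2 * dist u w"
      by (intro mult_right_mono) auto
    finally show "dist (op u x) (op w x) \<le> 1/2 * dist u w" .
  qed
  have fix1: "\<exists>!u. op u = u"
    by (rule banach_fix_type[of "1/2"]) (use contr in auto)
  show "\<exists>z. continuous_on {0..T} z \<and> (\<forall>t\<in>{0..T}. z t = v + integral {0..t} (\<lambda>s. H s (z s)))"
  proof -
    obtain u where u: "op u = u" using fix1 by blast
    have "exp (c * t) *\<^sub>R u t = v + integral {0..t} (\<lambda>s. H s (exp (c * s) *\<^sub>R u s))" if t: "t \<in> {0..T}" for t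
    proof -
      have "apply_bcontfun u t = \<Phi> u t" using op[of u t] u clamp_id[OF t] by simp
      then show ?thesis unfolding \<Phi>_def by (simp add: exp_minus)
    qed
    then show ?thesis
      by (intro exI[of _ "\<lambda>t. exp (c * t) *\<^sub>R u t"]) (auto intro!: continuous_intros continuous_on_apply_bcontfun)
  qed
  fix z z' t
  assume z: "continuous_on {0..T} z" "\<And>t. t \<in> {0..T} \<Longrightarrow> z t = v + integral {0..t} (\<lambda>s. H s (z s))"
    and z': "continuous_on {0..T} z'" "\<And>t. t \<in> {0..T} \<Longrightarrow> z' t = v + integral {0..t} (\<lambda>s. H s (z' s))"
    and t: "t \<in> {0..T}"
  \<comment> \<open>Every solution gives a fixed point, so uniqueness carries over.\<close>
  have *: "\<exists>u. op u = u \<and> (\<forall>t\<in>{0..T}. u t = exp (- (c * t)) *\<^sub>R z t)"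
    if z: "continuous_on {0..T} z" "\<And>t. t \<in> {0..T} \<Longrightarrow> z t = v + integral {0..t} (\<lambda>s. H s (z s))" for z
  proof -
    have "continuous_on (cbox 0 T) (\<lambda>t. exp (- (c * t)) *\<^sub>R z t)" using z(1) by (auto intro!: continuous_intros)
    then obtain u :: "real \<Rightarrow>\<^sub>C 'b" where u: "\<And>t. t \<in> cbox 0 T \<Longrightarrow> u t = exp (- (c * t)) *\<^sub>R z t"
      "\<And>t. u t = exp (- (c * clamp 0 T t)) *\<^sub>R z (clamp 0 T t)"
      using continuous_on_cbox_bcontfunE by blast
    have e: "exp (c * s) *\<^sub>R u s = z s" if "s \<in> {0..T}" for s
      using u(1)[of s] that by (simp add: exp_minus)
    have "op u = u"
    proof (rule bcontfun_eqI)
      fix x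
      define t where "t = clamp 0 T x"
      have t: "t \<in> {0..T}" unfolding t_def by (rule clamp)
      have "integral {0..t} (\<lambda>s. H s (exp (c * s) *\<^sub>R u s)) = integral {0..t} (\<lambda>s. H s (z s))"
        by (rule integral_cong) (use e t in auto)
      then show "op u x = u x"
        unfolding op \<Phi>_def u(2) t_def[symmetric] using z(2)[OF t] by simp
    qed
    then show ?thesis using u(1) by auto
  qed
  obtain u u' where "op u = u" "op u' = u'"
    "\<forall>t\<in>{0..T}. u t = exp (- (c * t)) *\<^sub>R z t" "\<forall>t\<in>{0..T}. u' t = exp (- (c * t)) *\<^sub>R z' t"
    using *[OF z] *[OF z'] by blast
  moreover from this have "u = u'" using fix1 by blast
  ultimately have "exp (- (c * t)) *\<^sub>R z t = exp (- (c * t)) *\<^sub>R z' t" using t by metis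
  then show "z t = z' t" by simp
qed

text \<open>At the nodes, with \<open>u = L * d / 2 \<le> 1/2\<close> for a cell of length \<open>d\<close>, the implicit estimate reads
  \<open>(1 - u) * e' \<le> (1 + u) * e + d * b\<close>, and \<open>1 / (1 - u) \<le> 1 + 2 * u\<close> bounds the
  amplification by \<open>exp (4 * u)\<close>. Passing from the nodes to the interior of a cell costs the factor
  \<open>3\<close>.\<close>

lemma discrete_gronwall:
  fixes e :: "real \<Rightarrow> real"
  assumes P: "partition_of T N \<tau>" and L: "L \<ge> 0" "b \<ge> 0" and m: "\<And>k. k < N \<Longrightarrow> L * (\<tau> (Suc k) - \<tau> k) \<le> 1"
    and e0: "\<And>t. e t \<ge> 0"
    and e: "\<And>k t. k < N \<Longrightarrow> t \<in> {\<tau> k<..\<tau> (Suc k)} \<Longrightarrow>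
        e t \<le> e (\<tau> k) + (t - \<tau> k) * (L / 2 * (e (\<tau> k) + e (\<tau> (Suc k))) + b)"
    and t: "t \<in> {0..T}"
  shows "e t \<le> 3 * exp (2 * L * T) * (e 0 + 2 * T * b)"
proof -
  have T0: "0 \<le> T" using t by simp
  have nodes: "e (\<tau> k) \<le> exp (2 * L * \<tau> k) * (e 0 + 2 * \<tau> k * b)" if "k \<le> N" for k
    using that
  proof (induction k)
    case 0
    then show ?case using P by (simp add: partition_of_def)
  next
    case (Suc k)
    define d where "d = \<tau> (Suc k) - \<tau> k"
    have k: "k < N" using Suc by simp
    have d: "d > 0" using P k by (simp add: d_def partition_of_def)
    define u where "u = L * d / 2"
    have u: "0 \<le> u" "u \<le> 1/2" using L d m[OF k] by (auto simp: u_def d_def)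
    have r: "0 \<le> \<tau> k" using partition_range[OF P, of k] k by simp
    have "e (\<tau> (Suc k)) \<le> e (\<tau> k) + d * (L / 2 * (e (\<tau> k) + e (\<tau> (Suc k))) + b)"
      using e[OF k, of "\<tau> (Suc k)"] d by (simp add: d_def)
    then have *: "(1 - u) * e (\<tau> (Suc k)) \<le> (1 + u) * e (\<tau> k) + d * b"
      by (simp add: u_def algebra_simps)
    have "1 \<le> (1 + 2 * u) * (1 - u)"
      using mult_nonneg_nonneg[of u "1 - 2 * u"] u by (simp add: algebra_simps)
    then have "e (\<tau> (Suc k)) \<le> ((1 + 2 * u) * (1 - u)) * e (\<tau> (Suc k))"
      using mult_right_mono[of 1 "(1 + 2 * u) * (1 - u)"] e0[of "\<tau> (Suc k)"] by simp
    also have "\<dots> = (1 + 2 * u) * ((1 - u) * e (\<tau> (Suc k)))" by simp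
    also have "\<dots> \<le> (1 + 2 * u) * ((1 + u) * e (\<tau> k) + d * b)"
      by (rule mult_left_mono[OF *]) (use u in simp)
    also have "\<dots> = ((1 + 2 * u) * (1 + u)) * e (\<tau> k) + (1 + 2 * u) * (d * b)"
      by (simp add: algebra_simps)
    also have "\<dots> \<le> exp (4 * u) * e (\<tau> k) + exp (4 * u) * 2 * (d * b)"
    proof (intro add_mono mult_right_mono e0)
      have "(1 + 2 * u) * (1 + u) \<le> exp (2 * u) * exp u"
        using u by (intro mult_mono exp_ge_add_one_self) auto
      also have "\<dots> \<le> exp (4 * u)" using u by (simp add: exp_add[symmetric])
      finally show "(1 + 2 * u) * (1 + u) \<le> exp (4 * u)" .
      have "1 \<le> exp (4 * u)" using u by simp
      then show "1 + 2 * u \<le> exp (4 * u) * 2" using u by linarith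
      show "0 \<le> d * b" using d L by simp
    qed
    also have "\<dots> = exp (4 * u) * (e (\<tau> k) + 2 * (d * b))" by (simp add: algebra_simps)
    also have "\<dots> \<le> exp (4 * u) * (exp (2 * L * \<tau> k) * (e 0 + 2 * \<tau> k * b) + exp (2 * L * \<tau> k) * (2 * (d * b)))"
    proof (intro mult_left_mono add_mono)
      show "e (\<tau> k) \<le> exp (2 * L * \<tau> k) * (e 0 + 2 * \<tau> k * b)" using Suc by simp
      have "1 \<le> exp (2 * L * \<tau> k)" using L r by simp
      then have "1 * (2 * (d * b)) \<le> exp (2 * L * \<tau> k) * (2 * (d * b))" using d L by (intro mult_right_mono) auto
      then show "2 * (d * b) \<le> exp (2 * L * \<tau> k) * (2 * (d * b))" by simp
    qed simp
    also have "\<dots> = (exp (4 * u) * exp (2 * L * \<tau> k)) * (e 0 + 2 * (\<tau> k + d) * b)" by (simp add: algebra_simps)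
    also have "exp (4 * u) * exp (2 * L * \<tau> k) = exp (2 * L * \<tau> (Suc k))"
      unfolding exp_add[symmetric] u_def d_def by (simp add: field_simps)
    also have "\<tau> k + d = \<tau> (Suc k)" by (simp add: d_def)
    finally show ?case .
  qed
  define E where "E = exp (2 * L * T) * (e 0 + 2 * T * b)"
  have nE: "e (\<tau> k) \<le> E" if "k \<le> N" for k
  proof -
    have r: "0 \<le> \<tau> k" "\<tau> k \<le> T" using partition_range[OF P that] .
    note nodes[OF that]
    also have "exp (2 * L * \<tau> k) * (e 0 + 2 * \<tau> k * b) \<le> E" unfolding E_def
      using r L e0[of 0] by (intro mult_mono) (auto intro!: mult_left_mono mult_right_mono add_nonneg_nonneg)
    finally show ?thesis .
  qed
  have TE: "T * b \<le> E"
  proof -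
    have "T * b \<le> 1 * (e 0 + 2 * T * b)" using T0 L e0[of 0] by (simp add: mult_nonneg_nonneg)
    also have "\<dots> \<le> E" unfolding E_def using T0 L e0[of 0] by (intro mult_right_mono) auto
    finally show ?thesis .
  qed
  have E0: "0 \<le> E" using nE[of 0] e0 by (meson order_trans zero_le)
  show ?thesis
  proof (cases "t = 0")
    case True
    have "e 0 \<le> E" using nE[of 0] P by (simp add: partition_of_def)
    then show ?thesis using E0 True unfolding E_def by simp
  next
    case False
    then obtain k where k: "k < N" "t \<in> {\<tau> k<..\<tau> (Suc k)}" using partition_cell_exists[OF P, of t] t by auto
    have tT: "t - \<tau> k \<le> T" using partition_range[OF P, of k] k t by auto
    have "e t \<le> e (\<tau> k) + (t - \<tau> k) * (L / 2 * (e (\<tau> k) + e (\<tau> (Suc k))) + b)" by (rule e[OF k])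
    also have "\<dots> \<le> E + (t - \<tau> k) * (L / 2 * (E + E) + b)"
      using k L nE[of k] nE[of "Suc k"] by (intro add_mono mult_left_mono) auto
    also have "\<dots> = E + (L * (t - \<tau> k)) * E + (t - \<tau> k) * b" by (simp add: algebra_simps)
    also have "\<dots> \<le> E + 1 * E + T * b"
    proof (intro add_mono mult_right_mono order_refl)
      have "L * (t - \<tau> k) \<le> L * (\<tau> (Suc k) - \<tau> k)" using k L by (intro mult_left_mono) auto
      then show "L * (t - \<tau> k) \<le> 1" using m[OF k(1)] by linarith
    qed (use tT E0 L in auto)
    also have "\<dots> \<le> 3 * E" using TE by simp
    finally show ?thesis unfolding E_def by simp
  qed
qed

lemma dist_quadruple_le:
  "dist (a, b, c, d) (a', b', c', d') \<le> dist a a' + dist b b' + dist c c' + dist d d'"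
proof -
  have *: "dist (p, q) (p', q') \<le> dist p p' + dist q q'" for p p' :: "'s::metric_space" and q q' :: "'t::metric_space"
    unfolding dist_Pair_Pair by (rule sqrt_sum_squares_le_sum) auto
  show ?thesis using *[of a "(b, c, d)" a' "(b', c', d')"] *[of b "(c, d)" b' "(c', d')"] *[of c d c' d'] by simp
qed

lemma continuous_on_along_path:
  assumes "continuous_on ({0..T} \<times> UNIV \<times> UNIV \<times> S) (\<lambda>(t, x, z, \<theta>). q t x z \<theta>)"
    and "continuous_on {0..T} x" "continuous_on {0..T} z" "\<theta> \<in> S"
  shows "continuous_on {0..T} (\<lambda>t. q t (x t) (z t) \<theta>)"
proof -
  have "continuous_on {0..T} (\<lambda>t. case (t, x t, z t, \<theta>) of (t, x, z, \<theta>) \<Rightarrow> q t x z \<theta>)"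
    by (rule continuous_on_compose2[OF assms(1)]) (use assms in \<open>auto intro!: continuous_intros\<close>)
  then show ?thesis by simp
qed

text \<open>The property by which \<^const>\<open>trapezoidal_path\<close> is described.\<close>

definition trapezoidal_solution ::
  "real \<Rightarrow> (real \<Rightarrow> 'a \<Rightarrow> 'b::real_normed_vector \<Rightarrow> 'c \<Rightarrow> 'b) \<Rightarrow> nat \<Rightarrow> (nat \<Rightarrow> real)
    \<Rightarrow> (real \<Rightarrow> 'a) \<Rightarrow> 'b \<Rightarrow> 'c \<Rightarrow> (real \<Rightarrow> 'b) \<Rightarrow> bool" where
  "trapezoidal_solution T h N \<tau> x \<zeta> \<theta> z \<longleftrightarrow> z \<in> PL T N \<tau> \<and> z 0 = \<zeta> \<and>
     (\<forall>k<N. \<forall>t\<in>{\<tau> k<..\<tau> (Suc k)}.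
        z t = z (\<tau> k) + (1/2 * (t - \<tau> k)) *\<^sub>R
          (h (\<tau> k) (x (\<tau> k)) (z (\<tau> k)) \<theta> + h (\<tau> (Suc k)) (x (\<tau> (Suc k))) (z (\<tau> (Suc k))) \<theta>))"

context
  fixes T L :: real and h :: "real \<Rightarrow> 'a::euclidean_space \<Rightarrow> 'b::euclidean_space \<Rightarrow> 'c::euclidean_space \<Rightarrow> 'b"
    and S :: "'c set"
  assumes T: "T > 0" and L: "L > 0"
    and lip: "\<And>t x z z' \<theta>. t \<in> {0..T} \<Longrightarrow> \<theta> \<in> S \<Longrightarrow> norm (h t x z \<theta> - h t x z' \<theta>) \<le> L * norm (z - z')"
    and uc: "uniformly_continuous_on ({0..T} \<times> UNIV \<times> UNIV \<times> S) (\<lambda>(t, x, z, \<theta>). h t x z \<theta>)"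
begin

text \<open>A path in the Sobolev space has the weak derivative \<open>h t (x t) (z t) \<theta>\<close> iff it solves the
  Volterra equation, so the definite description is justified by the unique solvability of the
  latter.\<close>

lemma ode_path_solves:
  fixes v :: 'b
  assumes x: "continuous_on {0..T} x" and \<theta>: "\<theta> \<in> S"
  defines "z \<equiv> ode_path T h x v \<theta>"
  shows "z \<in> W2 T" "continuous_on {0..T} z" "\<And>t. t \<in> {0..T} \<Longrightarrow> z t = v + integral {0..t} (\<lambda>s. h s (x s) (z s) \<theta>)"
proof -
  let ?H = "\<lambda>t z. h t (x t) z \<theta>"
  have Hc: "continuous_on {0..T} (\<lambda>t. ?H t (z t))" if "continuous_on {0..T} z" for z
    by (rule continuous_on_along_path[OF uniformly_continuous_imp_continuous[OF uc] x that \<theta>])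
  have Hl: "norm (?H t a - ?H t b) \<le> L * norm (a - b)" if "t \<in> {0..T}" for t a b
    by (rule lip[OF that \<theta>])
  note V = volterra_exists_unique[where H="?H", OF T L Hc Hl]
  obtain y where y: "continuous_on {0..T} y" "\<forall>t\<in>{0..T}. y t = v + integral {0..t} (\<lambda>s. ?H s (y s))"
    using V(1) by metis
  define w where "w = (\<lambda>t\<in>{0..T}. y t)"
  have wy: "w t = y t" if "t \<in> {0..T}" for t using that by (simp add: w_def)
  have wc: "continuous_on {0..T} w" using y(1) wy by (subst continuous_on_cong[OF refl wy])
  have wi: "w t = v + integral {0..t} (\<lambda>s. ?H s (w s))" if t: "t \<in> {0..T}" for t
  proof -
    have "integral {0..t} (\<lambda>s. ?H s (y s)) = integral {0..t} (\<lambda>s. ?H s (w s))"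
      by (rule integral_cong) (use wy t in auto)
    then show ?thesis using y(2) t wy[OF t] by simp
  qed
  have kc: "continuous_on {0..T} (\<lambda>s. ?H s (w s))" by (rule Hc[OF wc])
  have wd: "weak_derivative T w (\<lambda>s. ?H s (w s))"
  proof (rule weak_derivative_piecewise_C1[OF wc finite.emptyI])
    fix t assume t: "t \<in> {0<..<T} - {}"
    have "((\<lambda>u. integral {0..u} (\<lambda>s. ?H s (w s))) has_vector_derivative ?H t (w t)) (at t within {0..T})"
      by (rule integral_has_vector_derivative[OF kc]) (use t in auto)
    then have "((\<lambda>u. v + integral {0..u} (\<lambda>s. ?H s (w s))) has_vector_derivative ?H t (w t)) (at t within {0..T})"
      by (auto intro!: derivative_eq_intros)
    then have "(w has_vector_derivative ?H t (w t)) (at t within {0..T})"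
      by (rule has_vector_derivative_transform[rotated 2]) (use t wi in auto)
    moreover have "at t within {0..T} = at t" by (rule at_within_interior) (use t in auto)
    ultimately show "(w has_vector_derivative ?H t (w t)) (at t)" by simp
  qed (use T kc in \<open>auto intro: absolutely_integrable_continuous_real\<close>)
  have wW: "w \<in> W2 T"
  proof (rule W2_I[OF T _ _ wd square_integrable_continuous[OF kc]])
    have "bounded ((\<lambda>s. ?H s (w s)) ` {0..T})" by (intro compact_imp_bounded compact_continuous_image kc) auto
    then obtain B where B: "\<And>s. s \<in> {0..T} \<Longrightarrow> norm (?H s (w s)) \<le> B" unfolding bounded_iff by blast
    have B0: "0 \<le> B" using B[of 0] T norm_ge_zero order_trans by (metis atLeastAtMost_iff less_imp_le order_refl)
    show "abs_continuous_path T w"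
    proof (rule abs_continuous_path_lipschitz[OF _ B0])
      fix s t assume st: "0 \<le> s" "s \<le> t" "t \<le> T"
      have ki: "(\<lambda>s. ?H s (w s)) integrable_on {a..b}" if "0 \<le> a" "b \<le> T" for a b
        by (intro integrable_continuous_real continuous_on_subset[OF kc]) (use that in auto)
      have "integral {0..s} (\<lambda>s. ?H s (w s)) + integral {s..t} (\<lambda>s. ?H s (w s)) = integral {0..t} (\<lambda>s. ?H s (w s))"
        using st by (intro Henstock_Kurzweil_Integration.integral_combine ki) auto
      then have "w t - w s = integral {s..t} (\<lambda>s. ?H s (w s))"
        using wi[of s] wi[of t] st by (simp add: algebra_simps)
      also have "norm \<dots> \<le> integral {s..t} (\<lambda>_. B)"
        by (intro integral_norm_bound_integral ki) (use st B in auto)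
      finally show "norm (w t - w s) \<le> B * (t - s)" using st by (simp add: mult.commute)
    qed
  qed (simp add: w_def)
  have w0: "w 0 = v" using wi[of 0] T by simp
  have "z = w"
    unfolding z_def ode_path_def
  proof (rule the_equality)
    show "w \<in> W2 T \<and> w 0 = v \<and> weak_derivative T w (\<lambda>t. h t (x t) (w t) \<theta>)" using wW w0 wd by simp
    fix z assume z: "z \<in> W2 T \<and> z 0 = v \<and> weak_derivative T z (\<lambda>t. h t (x t) (z t) \<theta>)"
    then have zc: "continuous_on {0..T} z" and ze: "z \<in> extensional {0..T}" using W2_D[OF T] by blast+
    have zi: "z t = v + integral {0..t} (\<lambda>s. ?H s (z s))" if "t \<in> {0..T}" for t
      using weak_derivative_imp_integral[OF _ zc T that] z by metis
    show "z = w"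
    proof (rule extensionalityI[OF ze])
      show "w \<in> extensional {0..T}" by (simp add: w_def)
      show "z t = w t" if "t \<in> {0..T}" for t using that
        by (rule V(2)[where z=z and z'=w and v=v, rotated -1]) (assumption | rule zc wc zi wi)+
    qed
  qed
  then show "z \<in> W2 T" "continuous_on {0..T} z" "\<And>t. t \<in> {0..T} \<Longrightarrow> z t = v + integral {0..t} (\<lambda>s. h s (x s) (z s) \<theta>)"
    using wW wc wi by auto
qed

text \<open>One implicit step is a fixed point equation with Lipschitz constant \<open>L * d / 2 < 1\<close>.\<close>

lemma implicit_step_unique:
  assumes \<theta>: "\<theta> \<in> S" and t: "t \<in> {0..T}" and d: "0 \<le> d" "L * d < 2"
  shows "\<exists>!w. w = a + (1/2 * d) *\<^sub>R (b + h t \<xi> w \<theta>)"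
proof -
  have "\<exists>!w. a + (1/2 * d) *\<^sub>R (b + h t \<xi> w \<theta>) = w"
  proof (rule banach_fix_type[of "L * d / 2"])
    show "\<forall>w w'. dist (a + (1/2 * d) *\<^sub>R (b + h t \<xi> w \<theta>)) (a + (1/2 * d) *\<^sub>R (b + h t \<xi> w' \<theta>)) \<le> L * d / 2 * dist w w'"
    proof (intro allI)
      fix w w'
      have "dist (a + (1/2 * d) *\<^sub>R (b + h t \<xi> w \<theta>)) (a + (1/2 * d) *\<^sub>R (b + h t \<xi> w' \<theta>))
         = d / 2 * norm (h t \<xi> w \<theta> - h t \<xi> w' \<theta>)"
        using d by (simp add: dist_norm scaleR_diff_right[symmetric])
      also have "\<dots> \<le> d / 2 * (L * norm (w - w'))" using d by (intro mult_left_mono lip t \<theta>) auto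
      finally show "dist (a + (1/2 * d) *\<^sub>R (b + h t \<xi> w \<theta>)) (a + (1/2 * d) *\<^sub>R (b + h t \<xi> w' \<theta>)) \<le> L * d / 2 * dist w w'"
        by (simp add: dist_norm mult_ac)
    qed
  qed (use L d in auto)
  then show ?thesis by metis
qed

text \<open>The node values \<open>Z\<close> are determined recursively by the implicit steps, and a path with
  trapezoidal increments is determined by its node values.\<close>

lemma trapezoidal_path_solves:
  assumes P: "partition_of T N \<tau>" and m: "L * mesh N \<tau> < 2" and \<theta>: "\<theta> \<in> S"
  shows "trapezoidal_solution T h N \<tau> x \<zeta> \<theta> (trapezoidal_path T h N \<tau> x \<zeta> \<theta>)"
proof -
  let ?step = "\<lambda>k a w. w = a + (1/2 * (\<tau> (Suc k) - \<tau> k)) *\<^sub>R (h (\<tau> k) (x (\<tau> k)) a \<theta> + h (\<tau> (Suc k)) (x (\<tau> (Suc k))) w \<theta>)"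
  have uniq: "\<exists>!w. ?step k a w" if k: "k < N" for k a
  proof (rule implicit_step_unique[OF \<theta>])
    show "\<tau> (Suc k) \<in> {0..T}" using partition_range[OF P, of "Suc k"] k by simp
    show "0 \<le> \<tau> (Suc k) - \<tau> k" using partition_mono[OF P, of k "Suc k"] k by simp
    have "L * (\<tau> (Suc k) - \<tau> k) \<le> L * mesh N \<tau>" using cell_le_mesh[OF k] L by (intro mult_left_mono) auto
    then show "L * (\<tau> (Suc k) - \<tau> k) < 2" using m by linarith
  qed
  define Z where "Z = rec_nat \<zeta> (\<lambda>k a. THE w. ?step k a w)"
  have Z0: "Z 0 = \<zeta>" unfolding Z_def by simp
  have ZS: "?step k (Z k) (Z (Suc k))" if "k < N" for k
  proof -
    have "Z (Suc k) = (THE w. ?step k (Z k) w)" unfolding Z_def by simp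
    then show ?thesis using theI'[OF uniq[OF that, of "Z k"]] by metis
  qed
  define c where "c = (\<lambda>k. (1/2) *\<^sub>R (h (\<tau> k) (x (\<tau> k)) (Z k) \<theta> + h (\<tau> (Suc k)) (x (\<tau> (Suc k))) (Z (Suc k)) \<theta>))"
  define p where "p = (\<lambda>t\<in>{0..T}. \<zeta> + integral {0..t} (step_fun N \<tau> c))"
  note p = PL_primitive[OF T P, where v=\<zeta> and c=c, folded p_def]
  have p0: "p 0 = \<zeta>" using T by (simp add: p_def)
  have pZ: "p (\<tau> k) = Z k" if "k \<le> N" for k
    using that
  proof (induction k)
    case 0 then show ?case using P p0 Z0 by (simp add: partition_of_def)
  next
    case (Suc k)
    then have k: "k < N" by simp
    have "p (\<tau> (Suc k)) = p (\<tau> k) + (\<tau> (Suc k) - \<tau> k) *\<^sub>R c k"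
      by (rule p(3)[OF k]) (use partition_mono[OF P, of k "Suc k"] k in simp)
    also have "\<dots> = Z k + (1/2 * (\<tau> (Suc k) - \<tau> k)) *\<^sub>R (h (\<tau> k) (x (\<tau> k)) (Z k) \<theta> + h (\<tau> (Suc k)) (x (\<tau> (Suc k))) (Z (Suc k)) \<theta>)"
      using Suc unfolding c_def by (simp add: mult.commute)
    also have "\<dots> = Z (Suc k)" using ZS[OF k] by simp
    finally show ?case .
  qed
  have sol: "trapezoidal_solution T h N \<tau> x \<zeta> \<theta> p"
    unfolding trapezoidal_solution_def
  proof (intro conjI allI impI ballI p(1) p0)
    fix k t assume k: "k < N" and t: "t \<in> {\<tau> k<..\<tau> (Suc k)}"
    have "p t = p (\<tau> k) + (t - \<tau> k) *\<^sub>R c k" by (rule p(3)[OF k]) (use t in auto)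
    also have "\<dots> = p (\<tau> k) + (1/2 * (t - \<tau> k)) *\<^sub>R
          (h (\<tau> k) (x (\<tau> k)) (p (\<tau> k)) \<theta> + h (\<tau> (Suc k)) (x (\<tau> (Suc k))) (p (\<tau> (Suc k))) \<theta>)"
      using k pZ[of k] pZ[of "Suc k"] unfolding c_def by (simp add: mult.commute)
    finally show "p t = \<dots>" .
  qed
  have "trapezoidal_path T h N \<tau> x \<zeta> \<theta> = p"
    unfolding trapezoidal_path_def
  proof (rule the_equality)
    show "p \<in> PL T N \<tau> \<and> p 0 = \<zeta> \<and> (\<forall>k<N. \<forall>t\<in>{\<tau> k<..\<tau> (Suc k)}. p t = p (\<tau> k) + (1/2 * (t - \<tau> k)) *\<^sub>R
             (h (\<tau> k) (x (\<tau> k)) (p (\<tau> k)) \<theta> + h (\<tau> (Suc k)) (x (\<tau> (Suc k))) (p (\<tau> (Suc k))) \<theta>))"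
      using sol unfolding trapezoidal_solution_def .
    fix q assume "q \<in> PL T N \<tau> \<and> q 0 = \<zeta> \<and> (\<forall>k<N. \<forall>t\<in>{\<tau> k<..\<tau> (Suc k)}. q t = q (\<tau> k) + (1/2 * (t - \<tau> k)) *\<^sub>R
             (h (\<tau> k) (x (\<tau> k)) (q (\<tau> k)) \<theta> + h (\<tau> (Suc k)) (x (\<tau> (Suc k))) (q (\<tau> (Suc k))) \<theta>))"
    then have q: "q \<in> PL T N \<tau>" "q 0 = \<zeta>"
      and qs: "\<And>k t. k < N \<Longrightarrow> t \<in> {\<tau> k<..\<tau> (Suc k)} \<Longrightarrow> q t = q (\<tau> k) + (1/2 * (t - \<tau> k)) *\<^sub>R
             (h (\<tau> k) (x (\<tau> k)) (q (\<tau> k)) \<theta> + h (\<tau> (Suc k)) (x (\<tau> (Suc k))) (q (\<tau> (Suc k))) \<theta>)" by blast+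
    have qZ: "q (\<tau> k) = Z k" if "k \<le> N" for k
      using that
    proof (induction k)
      case 0 then show ?case using P q Z0 by (simp add: partition_of_def)
    next
      case (Suc k)
      then have k: "k < N" by simp
      have "?step k (q (\<tau> k)) (q (\<tau> (Suc k)))"
        by (rule qs[OF k]) (use P k in \<open>simp add: partition_of_def\<close>)
      then have "?step k (Z k) (q (\<tau> (Suc k)))" using Suc by simp
      then show ?case using uniq[OF k, of "Z k"] ZS[OF k] by blast
    qed
    show "q = p"
    proof (rule extensionalityI)
      show "q \<in> extensional {0..T}" "p \<in> extensional {0..T}" using q p(1) by (auto simp: PL_def)
      fix t assume t: "t \<in> {0..T}"
      show "q t = p t"
      proof (cases "t = 0")
        case False
        then obtain k where k: "k < N" "t \<in> {\<tau> k<..\<tau> (Suc k)}" using partition_cell_exists[OF P, of t] t by auto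
        have "p t = p (\<tau> k) + (1/2 * (t - \<tau> k)) *\<^sub>R
             (h (\<tau> k) (x (\<tau> k)) (p (\<tau> k)) \<theta> + h (\<tau> (Suc k)) (x (\<tau> (Suc k))) (p (\<tau> (Suc k))) \<theta>)"
          using sol k unfolding trapezoidal_solution_def by blast
        then show ?thesis using qs[OF k] pZ[of k] pZ[of "Suc k"] qZ[of k] qZ[of "Suc k"] k by simp
      qed (use q p0 in simp)
    qed
  qed
  then show ?thesis using sol by simp
qed

text \<open>On a cell, \<open>z\<close> moves with a constant velocity \<open>c\<close> and \<open>y\<close> with velocity \<open>r\<close>; the error grows by
  the integral of \<open>c - r\<close>. Half of this difference comes from each endpoint, and each half splits into
  a propagated error, controlled by the Lipschitz constant, and the consistency error \<open>b\<close>.\<close>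

lemma trapezoidal_error_on_cell:
  assumes P: "partition_of T N \<tau>" and z: "trapezoidal_solution T h N \<tau> x \<zeta> \<theta> z" and \<theta>: "\<theta> \<in> S"
    and r: "continuous_on {0..T} r" "\<And>t. t \<in> {0..T} \<Longrightarrow> y t = v + integral {0..t} r"
    and k: "k < N" and t: "t \<in> {\<tau> k<..\<tau> (Suc k)}"
    and b: "\<And>s j. s \<in> {\<tau> k..\<tau> (Suc k)} \<Longrightarrow> j \<in> {k, Suc k} \<Longrightarrow> norm (h (\<tau> j) (x (\<tau> j)) (y (\<tau> j)) \<theta> - r s) \<le> b"
  shows "norm (z t - y t) \<le> norm (z (\<tau> k) - y (\<tau> k))
    + (t - \<tau> k) * (L / 2 * (norm (z (\<tau> k) - y (\<tau> k)) + norm (z (\<tau> (Suc k)) - y (\<tau> (Suc k)))) + b)"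
proof -
  let ?e = "\<lambda>j. norm (z (\<tau> j) - y (\<tau> j))"
  let ?h = "\<lambda>j. h (\<tau> j) (x (\<tau> j)) (z (\<tau> j)) \<theta>"
  have rg: "0 \<le> \<tau> k" "\<tau> (Suc k) \<le> T" using partition_range[OF P] k by auto
  have tj: "\<tau> j \<in> {0..T}" if "j \<in> {k, Suc k}" for j using partition_range[OF P, of j] k that by auto
  have ri: "r integrable_on {a..c}" if "0 \<le> a" "c \<le> T" for a c
    by (intro integrable_continuous_real continuous_on_subset[OF r(1)]) (use that in auto)
  have "integral {0..\<tau> k} r + integral {\<tau> k..t} r = integral {0..t} r"
    using rg t by (intro Henstock_Kurzweil_Integration.integral_combine ri) auto
  then have y: "y t = y (\<tau> k) + integral {\<tau> k..t} r"
    using r(2)[of t] r(2)[of "\<tau> k"] rg t by (simp add: algebra_simps)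
  define c where "c = (1/2) *\<^sub>R (?h k + ?h (Suc k))"
  have zt: "z t = z (\<tau> k) + (t - \<tau> k) *\<^sub>R c"
  proof -
    have "z t = z (\<tau> k) + (1/2 * (t - \<tau> k)) *\<^sub>R (?h k + ?h (Suc k))"
      using z k t unfolding trapezoidal_solution_def by blast
    also have "\<dots> = z (\<tau> k) + (t - \<tau> k) *\<^sub>R c" unfolding c_def scaleR_scaleR by (simp only: mult.commute)
    finally show ?thesis .
  qed
  have cint: "((\<lambda>_. c) has_integral (t - \<tau> k) *\<^sub>R c) {\<tau> k..t}"
    using has_integral_const_real[of c "\<tau> k" t] t by simp
  have "integral {\<tau> k..t} (\<lambda>s. c - r s) = (t - \<tau> k) *\<^sub>R c - integral {\<tau> k..t} r"
    using integral_diff[OF has_integral_integrable[OF cint] ri[of "\<tau> k" t]] integral_unique[OF cint] rg t by simp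
  then have "z t - y t = (z (\<tau> k) - y (\<tau> k)) + integral {\<tau> k..t} (\<lambda>s. c - r s)"
    unfolding zt y by simp
  then have "norm (z t - y t) \<le> ?e k + norm (integral {\<tau> k..t} (\<lambda>s. c - r s))"
    by (metis norm_triangle_ineq)
  also have "norm (integral {\<tau> k..t} (\<lambda>s. c - r s)) \<le> integral {\<tau> k..t} (\<lambda>s. L / 2 * (?e k + ?e (Suc k)) + b)"
  proof (rule integral_norm_bound_integral)
    show "(\<lambda>s. c - r s) integrable_on {\<tau> k..t}"
      using rg t by (intro integrable_diff ri) auto
    fix s assume s: "s \<in> {\<tau> k..t}"
    have h1: "norm (?h j - r s) \<le> L * ?e j + b" if j: "j \<in> {k, Suc k}" for j
    proof -
      have "norm (?h j - r s) \<le> norm (?h j - h (\<tau> j) (x (\<tau> j)) (y (\<tau> j)) \<theta>) + norm (h (\<tau> j) (x (\<tau> j)) (y (\<tau> j)) \<theta> - r s)"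
        using norm_triangle_ineq[of "?h j - h (\<tau> j) (x (\<tau> j)) (y (\<tau> j)) \<theta>" "h (\<tau> j) (x (\<tau> j)) (y (\<tau> j)) \<theta> - r s"] by simp
      also have "\<dots> \<le> L * ?e j + b"
        by (intro add_mono lip tj j \<theta> b) (use s t in auto)
      finally show ?thesis .
    qed
    have "c - r s = (1/2) *\<^sub>R (?h k - r s) + (1/2) *\<^sub>R (?h (Suc k) - r s)"
      unfolding c_def by (simp add: algebra_simps scaleR_2[symmetric])
    also have "norm \<dots> \<le> 1/2 * norm (?h k - r s) + 1/2 * norm (?h (Suc k) - r s)"
      by (rule norm_triangle_le) simp
    also have "\<dots> \<le> 1/2 * (L * ?e k + b) + 1/2 * (L * ?e (Suc k) + b)"
      by (intro add_mono mult_left_mono h1) auto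
    also have "\<dots> = L / 2 * (?e k + ?e (Suc k)) + b" by (simp add: algebra_simps)
    finally show "norm (c - r s) \<le> L / 2 * (?e k + ?e (Suc k)) + b" .
  qed (use rg t in auto)
  also have "integral {\<tau> k..t} (\<lambda>s. L / 2 * (?e k + ?e (Suc k)) + b) = (t - \<tau> k) * (L / 2 * (?e k + ?e (Suc k)) + b)"
    using t by simp
  finally show ?thesis by simp
qed

text \<open>The consistency error is made small by the uniform continuity of \<open>h\<close>, of the limit path and of
  the solution, and \<open>discrete_gronwall\<close> propagates it.\<close>

lemma trapezoidal_path_uniform_limit_ode_path:
  assumes P: "\<And>i::nat. partition_of T (N i) (\<tau> i)" and m: "(\<lambda>i. mesh (N i) (\<tau> i)) \<longlonglongrightarrow> 0"
    and m2: "\<And>i. L * mesh (N i) (\<tau> i) < 2"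
    and x: "continuous_on {0..T} x" and xi: "uniform_limit {0..T} \<xi> x sequentially"
    and \<theta>: "\<And>i. \<theta> i \<in> S" "\<eta> \<in> S" "\<theta> \<longlonglongrightarrow> \<eta>" and \<zeta>: "\<zeta> \<longlonglongrightarrow> v"
  shows "uniform_limit {0..T} (\<lambda>i. trapezoidal_path T h (N i) (\<tau> i) (\<xi> i) (\<zeta> i) (\<theta> i)) (ode_path T h x v \<eta>) sequentially"
proof (rule uniform_limitI)
  fix e :: real assume e: "e > 0"
  define \<epsilon> where "\<epsilon> = e / 2"
  have \<epsilon>: "\<epsilon> > 0" "\<epsilon> < e" using e by (auto simp: \<epsilon>_def)
  define y where "y = ode_path T h x v \<eta>"
  define z where "z = (\<lambda>i. trapezoidal_path T h (N i) (\<tau> i) (\<xi> i) (\<zeta> i) (\<theta> i))"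
  note Y = ode_path_solves[OF x \<theta>(2), where v=v, folded y_def]
  define r where "r = (\<lambda>s. h s (x s) (y s) \<eta>)"
  have rc: "continuous_on {0..T} r" unfolding r_def by (rule continuous_on_along_path[OF uniformly_continuous_imp_continuous[OF uc] x Y(2) \<theta>(2)])
  have y0: "y 0 = v" using Y(3)[of 0] T by simp
  define C where "C = 3 * exp (2 * L * T)"
  have C: "C > 0" unfolding C_def by simp
  define b where "b = \<epsilon> / (C * (1 + 2 * T))"
  have b: "b > 0" unfolding b_def using \<epsilon> C T by (auto intro!: divide_pos_pos mult_pos_pos)
  obtain d where d: "d > 0" and hd: "\<And>p q. p \<in> {0..T} \<times> UNIV \<times> UNIV \<times> S \<Longrightarrow> q \<in> {0..T} \<times> UNIV \<times> UNIV \<times> S \<Longrightarrow> dist p q < d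
     \<Longrightarrow> dist (case p of (t, x, z, \<theta>) \<Rightarrow> h t x z \<theta>) (case q of (t, x, z, \<theta>) \<Rightarrow> h t x z \<theta>) < b"
    using uc[unfolded uniformly_continuous_on_def, rule_format, OF b] by metis
  have ux: "uniformly_continuous_on {0..T} x" "uniformly_continuous_on {0..T} y"
    by (intro compact_uniformly_continuous x Y(2); simp)+
  have d6: "d / 6 > 0" using d by simp
  obtain d1 where d1: "d1 > 0" "\<And>s t. s \<in> {0..T} \<Longrightarrow> t \<in> {0..T} \<Longrightarrow> dist s t < d1 \<Longrightarrow> dist (x s) (x t) < d / 6"
    using ux(1)[unfolded uniformly_continuous_on_def, rule_format, OF d6] by metis
  obtain d2 where d2: "d2 > 0" "\<And>s t. s \<in> {0..T} \<Longrightarrow> t \<in> {0..T} \<Longrightarrow> dist s t < d2 \<Longrightarrow> dist (y s) (y t) < d / 6"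
    using ux(2)[unfolded uniformly_continuous_on_def, rule_format, OF d6] by metis
  \<comment> \<open>A mesh below \<open>\<mu>\<close> keeps each of the four contributions to the distance of the arguments of \<open>h\<close>
      below its share of \<open>d\<close>, and \<open>1 / L\<close> is the bound for the Gronwall estimate.\<close>
  define \<mu> where "\<mu> = min (d / 6) (min (min d1 d2) (1 / L))"
  have \<mu>: "\<mu> > 0" using d d1 d2 L by (simp add: \<mu>_def)
  have e1: "\<forall>\<^sub>F i in sequentially. mesh (N i) (\<tau> i) < \<mu>" by (rule order_tendstoD(2)[OF m \<mu>])
  have e2: "\<forall>\<^sub>F i in sequentially. dist (\<theta> i) \<eta> < d / 6" by (rule tendstoD[OF \<theta>(3) d6])
  have e3: "\<forall>\<^sub>F i in sequentially. dist (\<zeta> i) v < b" by (rule tendstoD[OF \<zeta> b])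
  show "\<forall>\<^sub>F i in sequentially. \<forall>t\<in>{0..T}. dist (trapezoidal_path T h (N i) (\<tau> i) (\<xi> i) (\<zeta> i) (\<theta> i) t) (ode_path T h x v \<eta> t) < e"
    using e1 e2 e3 uniform_limitD[OF xi d6]
  proof eventually_elim
    case (elim i)
    have sol: "trapezoidal_solution T h (N i) (\<tau> i) (\<xi> i) (\<zeta> i) (\<theta> i) (z i)"
      unfolding z_def by (rule trapezoidal_path_solves[OF P m2 \<theta>(1)])
    show ?case
    proof
      fix t assume t: "t \<in> {0..T}"
      have "norm (z i t - y t) \<le> 3 * exp (2 * L * T) * (norm (z i 0 - y 0) + 2 * T * b)"
      proof (rule discrete_gronwall[OF P _ _ _ _ _ t, where e = "\<lambda>t. norm (z i t - y t)"])
        show "L * (\<tau> i (Suc k) - \<tau> i k) \<le> 1" if "k < N i" for k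
        proof -
          have "L * (\<tau> i (Suc k) - \<tau> i k) \<le> L * (1 / L)"
            using cell_le_mesh[OF that, of "\<tau> i"] elim(1) L by (intro mult_left_mono) (auto simp: \<mu>_def)
          then show ?thesis using L by simp
        qed
        fix k t assume k: "k < N i" and t: "t \<in> {\<tau> i k<..\<tau> i (Suc k)}"
        show "norm (z i t - y t) \<le> norm (z i (\<tau> i k) - y (\<tau> i k)) +
           (t - \<tau> i k) * (L / 2 * (norm (z i (\<tau> i k) - y (\<tau> i k)) + norm (z i (\<tau> i (Suc k)) - y (\<tau> i (Suc k)))) + b)"
        proof (rule trapezoidal_error_on_cell[OF P sol \<theta>(1) rc _ k t])
          show "y t = v + integral {0..t} r" if "t \<in> {0..T}" for t using Y(3)[OF that] unfolding r_def .
          fix s j assume s: "s \<in> {\<tau> i k..\<tau> i (Suc k)}" and j: "j \<in> {k, Suc k}"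
          have tj: "\<tau> i j \<in> {0..T}" using partition_range[OF P, of j i] k j by auto
          have sT: "s \<in> {0..T}" using partition_range[OF P, of k i] partition_range[OF P, of "Suc k" i] k s by auto
          have "dist (\<tau> i j) s \<le> mesh (N i) (\<tau> i)"
            using cell_le_mesh[OF k, of "\<tau> i"] j s by (auto simp: dist_real_def)
          then have ds: "dist (\<tau> i j) s < \<mu>" using elim(1) by simp
          have "dist (\<xi> i (\<tau> i j)) (x s) \<le> dist (\<xi> i (\<tau> i j)) (x (\<tau> i j)) + dist (x (\<tau> i j)) (x s)" by (rule dist_triangle)
          also have "dist (\<xi> i (\<tau> i j)) (x (\<tau> i j)) < d / 6" using elim(4) tj by blast
          also have "dist (x (\<tau> i j)) (x s) < d / 6" by (rule d1(2)[OF tj sT]) (use ds in \<open>simp add: \<mu>_def\<close>)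
          finally have 1: "dist (\<xi> i (\<tau> i j)) (x s) < d / 6 + d / 6" by simp
          have 2: "dist (y (\<tau> i j)) (y s) < d / 6" by (rule d2(2)[OF tj sT]) (use ds in \<open>simp add: \<mu>_def\<close>)
          have 3: "dist (\<tau> i j) s < d / 6" using ds by (simp add: \<mu>_def)
          have "dist (\<tau> i j, \<xi> i (\<tau> i j), y (\<tau> i j), \<theta> i) (s, x s, y s, \<eta>) < d"
            using dist_quadruple_le[of "\<tau> i j" "\<xi> i (\<tau> i j)" "y (\<tau> i j)" "\<theta> i" s "x s" "y s" \<eta>] 1 2 3 elim(2) d by linarith
          from hd[OF _ _ this] show "norm (h (\<tau> i j) (\<xi> i (\<tau> i j)) (y (\<tau> i j)) (\<theta> i) - r s) \<le> b"
            using tj sT \<theta> by (simp add: r_def dist_norm)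
        qed
      qed (use L b in auto)
      also have "\<dots> \<le> C * (b + 2 * T * b)"
        using elim(3) C sol y0 T unfolding C_def trapezoidal_solution_def by (intro mult_left_mono add_mono) (simp_all add: dist_norm)
      also have "\<dots> = \<epsilon>"
      proof -
        have "C * (1 + 2 * T) \<noteq> 0" using C T by simp
        then have "C * (1 + 2 * T) * b = \<epsilon>" unfolding b_def by simp
        then show ?thesis by (simp add: algebra_simps)
      qed
      finally show "dist (trapezoidal_path T h (N i) (\<tau> i) (\<xi> i) (\<zeta> i) (\<theta> i) t) (ode_path T h x v \<eta> t) < e"
        unfolding z_def y_def dist_norm using \<epsilon> by linarith
    qed
  qed
qed

end

section \<open>Determinants close to the identity\<close>

text \<open>The diagonal product in the Leibniz formula, to first order and uniformly for bounded entries.\<close>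

lemma prod_near_one:
  assumes "finite I" "0 \<le> B"
  shows "\<exists>C\<ge>0. \<forall>(a::'i \<Rightarrow> real) d. 0 \<le> d \<longrightarrow> d \<le> 1 \<longrightarrow> (\<forall>i\<in>I. \<bar>a i\<bar> \<le> B) \<longrightarrow>
    \<bar>(\<Prod>i\<in>I. 1 + d * a i) - 1 - d * (\<Sum>i\<in>I. a i)\<bar> \<le> C * d\<^sup>2"
  using assms(1)
proof induction
  case empty
  then show ?case by (intro exI[of _ 0]) auto
next
  case (insert j I)
  then obtain C where C: "C \<ge> 0" "\<And>(a::'i \<Rightarrow> real) d. 0 \<le> d \<Longrightarrow> d \<le> 1 \<Longrightarrow> (\<forall>i\<in>I. \<bar>a i\<bar> \<le> B) \<Longrightarrow>
    \<bar>(\<Prod>i\<in>I. 1 + d * a i) - 1 - d * (\<Sum>i\<in>I. a i)\<bar> \<le> C * d\<^sup>2" by metis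
  let ?n = "real (card I)"
  show ?case
  proof (intro exI[of _ "C + B * (C + ?n * B)"] conjI allI impI)
    fix a :: "'i \<Rightarrow> real" and d :: real
    assume d: "0 \<le> d" "d \<le> 1" and a: "\<forall>i\<in>insert j I. \<bar>a i\<bar> \<le> B"
    define P where "P = (\<Prod>i\<in>I. 1 + d * a i)"
    define s where "s = (\<Sum>i\<in>I. a i)"
    have 1: "\<bar>P - 1 - d * s\<bar> \<le> C * d\<^sup>2" unfolding P_def s_def by (rule C(2)) (use d a in auto)
    have "\<bar>s\<bar> \<le> (\<Sum>i\<in>I. \<bar>a i\<bar>)" unfolding s_def by (rule sum_abs)
    also have "\<dots> \<le> ?n * B" using sum_bounded_above[of I "\<lambda>i. \<bar>a i\<bar>" B] a by simp
    finally have s: "\<bar>s\<bar> \<le> ?n * B" .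
    have "\<bar>P - 1\<bar> \<le> \<bar>P - 1 - d * s\<bar> + \<bar>d * s\<bar>" by linarith
    also have "\<dots> \<le> C * d\<^sup>2 + d * (?n * B)"
      using 1 s d by (intro add_mono) (auto simp: abs_mult intro: mult_left_mono)
    also have "\<dots> \<le> C * d + d * (?n * B)"
      using d C(1) by (intro add_right_mono mult_left_mono) (auto simp: power2_eq_square mult_left_le)
    finally have 2: "\<bar>P - 1\<bar> \<le> d * (C + ?n * B)" by (simp add: algebra_simps)
    have "(\<Prod>i\<in>insert j I. 1 + d * a i) - 1 - d * (\<Sum>i\<in>insert j I. a i) = (P - 1 - d * s) + (d * a j) * (P - 1)"
      using insert.hyps unfolding P_def s_def by (simp add: algebra_simps)
    also have "\<bar>\<dots>\<bar> \<le> \<bar>P - 1 - d * s\<bar> + \<bar>d * a j\<bar> * \<bar>P - 1\<bar>"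
      unfolding abs_mult[symmetric] by (rule abs_triangle_ineq)
    also have "\<dots> \<le> C * d\<^sup>2 + (d * B) * (d * (C + ?n * B))"
    proof (intro add_mono 1 mult_mono 2)
      show "\<bar>d * a j\<bar> \<le> d * B" using d a by (auto simp: abs_mult intro: mult_left_mono)
    qed (use d assms(2) in auto)
    also have "\<dots> = (C + B * (C + ?n * B)) * d\<^sup>2" by (simp add: power2_eq_square algebra_simps)
    finally show "\<bar>(\<Prod>i\<in>insert j I. 1 + d * a i) - 1 - d * (\<Sum>i\<in>insert j I. a i)\<bar> \<le> (C + B * (C + ?n * B)) * d\<^sup>2" .
  qed (use C(1) assms(2) in auto)
qed

text \<open>A permutation other than the identity moves at least two indices, so its term in the
  Leibniz formula is of second order.\<close>

lemma permutation_term_second_order: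
  fixes A :: "real^'n^'n"
  assumes p: "p permutes (UNIV :: 'n set)" "p \<noteq> id" and d: "0 \<le> d" "d \<le> 1" and B: "0 \<le> B" "\<And>i j. \<bar>A $ i $ j\<bar> \<le> B"
  shows "\<bar>\<Prod>i\<in>UNIV. (mat 1 - d *\<^sub>R A) $ i $ p i\<bar> \<le> (1 + B) ^ CARD('n) * d\<^sup>2"
proof -
  \<comment> \<open>Rows \<open>i\<close> and \<open>j\<close> each contribute an off-diagonal entry, which carries a factor \<open>d\<close>.\<close>
  obtain i where i: "p i \<noteq> i" using p(2) by fastforce
  define j where "j = p i"
  have j: "p j \<noteq> j" "j \<noteq> i" using i permutes_inj[OF p(1)] by (auto simp: j_def inj_eq)
  have "\<bar>(mat 1 - d *\<^sub>R A) $ k $ p k\<bar> \<le> (if k = i then d else 1) * (if k = j then d else 1) * (1 + B)" for k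
  proof (cases "p k = k")
    case True
    then have "k \<noteq> i" "k \<noteq> j" using i j by auto
    have "\<bar>1 - d * A $ k $ k\<bar> \<le> 1 + d * B"
      using d B(2)[of k k] mult_left_mono[OF B(2)[of k k] d(1)] abs_triangle_ineq4[of 1 "d * A $ k $ k"]
      by (simp add: abs_mult)
    also have "\<dots> \<le> 1 + B" using d B(1) by (simp add: mult_left_le_one_le)
    finally show ?thesis using True \<open>k \<noteq> i\<close> \<open>k \<noteq> j\<close> by (simp add: mat_def)
  next
    case False
    then have "\<bar>(mat 1 - d *\<^sub>R A) $ k $ p k\<bar> = d * \<bar>A $ k $ p k\<bar>" using d by (simp add: mat_def abs_mult)
    also have "\<dots> \<le> d * (1 + B)" using d B(2)[of k "p k"] by (intro mult_left_mono) auto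
    also have "\<dots> \<le> (if k = i then d else 1) * (if k = j then d else 1) * (1 + B)"
      using j(2) d B(1) by (intro mult_right_mono) auto
    finally show ?thesis .
  qed
  then have "(\<Prod>k\<in>UNIV. \<bar>(mat 1 - d *\<^sub>R A) $ k $ p k\<bar>) \<le> (\<Prod>k\<in>UNIV. (if k = i then d else 1) * (if k = j then d else 1) * (1 + B))"
    by (intro prod_mono) auto
  also have "\<dots> = d * d * (1 + B) ^ CARD('n)"
    by (simp add: prod.distrib)
  finally show ?thesis by (simp add: abs_prod power2_eq_square mult_ac)
qed

text \<open>In the Leibniz formula, the identity contributes \<open>1 - d * trace A\<close> up to second order, and every
  other permutation is of second order.\<close>

lemma det_near_identity:
  assumes B: "0 \<le> B"
  shows "\<exists>C\<ge>0. \<forall>(A::real^'n^'n) d. 0 \<le> d \<longrightarrow> d \<le> 1 \<longrightarrow> (\<forall>i j. \<bar>A $ i $ j\<bar> \<le> B) \<longrightarrow>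
    \<bar>det (mat 1 - d *\<^sub>R A) - 1 + d * trace A\<bar> \<le> C * d\<^sup>2"
proof -
  obtain C where C: "C \<ge> 0" "\<And>(a::'n \<Rightarrow> real) d. 0 \<le> d \<Longrightarrow> d \<le> 1 \<Longrightarrow> (\<forall>i\<in>UNIV. \<bar>a i\<bar> \<le> B) \<Longrightarrow>
    \<bar>(\<Prod>i\<in>UNIV. 1 + d * a i) - 1 - d * (\<Sum>i\<in>UNIV. a i)\<bar> \<le> C * d\<^sup>2"
    using prod_near_one[of "UNIV :: 'n set", OF finite_class.finite_UNIV B] by metis
  let ?R = "{p. p permutes (UNIV :: 'n set)} - {id}"
  let ?K = "real (card ?R) * (1 + B) ^ CARD('n)"
  show ?thesis
  proof (intro exI[of _ "C + ?K"] conjI allI impI)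
    fix A :: "real^'n^'n" and d :: real
    assume d: "0 \<le> d" "d \<le> 1" and A: "\<forall>i j. \<bar>A $ i $ j\<bar> \<le> B"
    let ?t = "\<lambda>p. of_int (sign p) * (\<Prod>i\<in>UNIV. (mat 1 - d *\<^sub>R A) $ i $ p i)"
    have "det (mat 1 - d *\<^sub>R A) = ?t id + sum ?t ?R"
      unfolding det_def by (rule sum.remove) (auto simp: permutes_id)
    moreover have "?t id = (\<Prod>i\<in>UNIV. 1 + d * (- (A $ i $ i)))" by (simp add: sign_id mat_def)
    moreover have "trace A = - (\<Sum>i\<in>UNIV. - (A $ i $ i))" by (simp add: trace_def sum_negf)
    ultimately have eq: "det (mat 1 - d *\<^sub>R A) - 1 + d * trace A
       = ((\<Prod>i\<in>UNIV. 1 + d * (- (A $ i $ i))) - 1 - d * (\<Sum>i\<in>UNIV. - (A $ i $ i))) + sum ?t ?R"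
      by simp
    have "\<bar>det (mat 1 - d *\<^sub>R A) - 1 + d * trace A\<bar>
      \<le> \<bar>(\<Prod>i\<in>UNIV. 1 + d * (- (A $ i $ i))) - 1 - d * (\<Sum>i\<in>UNIV. - (A $ i $ i))\<bar> + \<bar>sum ?t ?R\<bar>"
      unfolding eq by (rule abs_triangle_ineq)
    also have "\<dots> \<le> C * d\<^sup>2 + ?K * d\<^sup>2"
    proof (intro add_mono C(2) d)
      have "\<bar>sum ?t ?R\<bar> \<le> (\<Sum>p\<in>?R. \<bar>?t p\<bar>)" by (rule sum_abs)
      also have "\<dots> \<le> real (card ?R) * ((1 + B) ^ CARD('n) * d\<^sup>2)"
      proof (rule sum_bounded_above)
        fix p assume "p \<in> ?R"
        then show "\<bar>?t p\<bar> \<le> (1 + B) ^ CARD('n) * d\<^sup>2"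
          using permutation_term_second_order[OF _ _ d B, of p A] A by (simp add: abs_mult sign_def)
      qed
      finally show "\<bar>sum ?t ?R\<bar> \<le> ?K * d\<^sup>2" by (simp add: mult.assoc)
    qed (use A in auto)
    also have "\<dots> = (C + ?K) * d\<^sup>2" by (simp add: algebra_simps)
    finally show "\<bar>det (mat 1 - d *\<^sub>R A) - 1 + d * trace A\<bar> \<le> (C + ?K) * d\<^sup>2" .
  qed (use C B in auto)
qed

lemma ln_det_near_identity:
  assumes B: "0 \<le> B"
  shows "\<exists>K d0. 0 \<le> K \<and> 0 < d0 \<and> (\<forall>(A::real^'n^'n) d. 0 \<le> d \<longrightarrow> d \<le> d0 \<longrightarrow> (\<forall>i j. \<bar>A $ i $ j\<bar> \<le> B) \<longrightarrow>
    0 < det (mat 1 - d *\<^sub>R A) \<and> \<bar>ln (det (mat 1 - d *\<^sub>R A)) + d * trace A\<bar> \<le> K * d\<^sup>2)"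
proof -
  obtain C where C: "C \<ge> 0" "\<And>(A::real^'n^'n) d. 0 \<le> d \<Longrightarrow> d \<le> 1 \<Longrightarrow> (\<forall>i j. \<bar>A $ i $ j\<bar> \<le> B) \<Longrightarrow>
    \<bar>det (mat 1 - d *\<^sub>R A) - 1 + d * trace A\<bar> \<le> C * d\<^sup>2"
    using det_near_identity[OF B, where 'n='n] by metis
  define M where "M = C + real CARD('n) * B + 1"
  have M: "M > 0" "M \<ge> 1" unfolding M_def using C B by (auto intro!: add_nonneg_pos)
  show ?thesis
  proof (rule exI[of _ "2 * M\<^sup>2 + C"], rule exI[of _ "1 / (2 * M)"], intro conjI allI impI)
    fix A :: "real^'n^'n" and d :: real
    assume d: "0 \<le> d" "d \<le> 1 / (2 * M)" and A: "\<forall>i j. \<bar>A $ i $ j\<bar> \<le> B"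
    have dM: "d * M \<le> 1/2" using d M by (simp add: field_simps)
    have d1: "d \<le> 1" using dM M d mult_left_mono[of 1 M d] by simp
    define u where "u = det (mat 1 - d *\<^sub>R A) - 1"
    have *: "\<bar>u + d * trace A\<bar> \<le> C * d\<^sup>2" unfolding u_def by (rule C(2)[OF d(1) d1 A])
    have "\<bar>trace A\<bar> \<le> (\<Sum>i\<in>UNIV. \<bar>A $ i $ i\<bar>)" unfolding trace_def by (rule sum_abs)
    also have "\<dots> \<le> real CARD('n) * B" using A by (intro sum_bounded_above) auto
    finally have tr: "\<bar>d * trace A\<bar> \<le> d * (real CARD('n) * B)" using d by (simp add: abs_mult mult_left_mono)
    have "C * d\<^sup>2 \<le> C * d" using C(1) d d1 by (intro mult_left_mono) (auto simp: power2_eq_square mult_left_le)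
    then have "\<bar>u\<bar> \<le> C * d + d * (real CARD('n) * B)" using * tr by linarith
    also have "\<dots> \<le> d * M" unfolding M_def using d by (simp add: algebra_simps)
    finally have uM: "\<bar>u\<bar> \<le> d * M" .
    then have u: "\<bar>u\<bar> \<le> 1/2" using dM by linarith
    then show "0 < det (mat 1 - d *\<^sub>R A)" unfolding u_def by linarith
    have "\<bar>ln (1 + u) - u\<bar> \<le> 2 * u\<^sup>2" by (rule abs_ln_one_plus_x_minus_x_bound[OF u])
    also have "u\<^sup>2 \<le> (d * M)\<^sup>2" using power_mono[OF uM, of 2] by simp
    finally have "\<bar>ln (1 + u) - u\<bar> \<le> 2 * (d * M)\<^sup>2" by simp
    then have "\<bar>ln (1 + u) + d * trace A\<bar> \<le> 2 * (d * M)\<^sup>2 + C * d\<^sup>2" using * by linarith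
    then show "\<bar>ln (det (mat 1 - d *\<^sub>R A)) + d * trace A\<bar> \<le> (2 * M\<^sup>2 + C) * d\<^sup>2"
      unfolding u_def by (simp add: power_mult_distrib algebra_simps)
  qed (use M C in auto)
qed

section \<open>Extended logarithms, supports and path spaces\<close>

lemma eln_less_PInf: "eln r \<noteq> \<infinity>"
  by (simp add: eln_def)

text \<open>With values in the extended reals, the logarithm is continuous on the closed half-line.\<close>

lemma tendsto_eln:
  assumes r: "(r \<longlongrightarrow> l) F" and l: "0 \<le> l"
  shows "((\<lambda>i. eln (r i)) \<longlongrightarrow> eln l) F"
proof (cases "l = 0")
  case True
  have "((\<lambda>i. eln (r i)) \<longlongrightarrow> - \<infinity>) F"
    unfolding tendsto_MInfty
  proof
    fix b :: real
    have "\<forall>\<^sub>F i in F. r i < exp b" by (rule order_tendstoD(2)[OF r]) (simp add: True)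
    then show "\<forall>\<^sub>F i in F. eln (r i) < ereal b"
    proof (rule eventually_mono)
      fix i assume "r i < exp b"
      then have "ln (r i) < b" if "r i > 0" using that ln_less_cancel_iff[of "r i" "exp b"] by simp
      then show "eln (r i) < ereal b" by (auto simp: eln_def not_le)
    qed
  qed
  then show ?thesis using True by (simp add: eln_def)
next
  case False
  then have l: "l > 0" using l by simp
  have "((\<lambda>i. ereal (ln (r i))) \<longlongrightarrow> ereal (ln l)) F"
    by (intro tendsto_intros r) (use l in simp)
  moreover have "\<forall>\<^sub>F i in F. ereal (ln (r i)) = eln (r i)"
    using order_tendstoD(1)[OF r l] by (rule eventually_mono) (simp add: eln_def)
  ultimately have "((\<lambda>i. eln (r i)) \<longlongrightarrow> ereal (ln l)) F"
    by (rule Lim_transform_eventually)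
  then show ?thesis using l by (simp add: eln_def)
qed

lemma closed_topological_support: "closed (topological_support \<mu>)"
proof -
  have "- topological_support \<mu> = \<Union>{U. open U \<and> \<not> emeasure \<mu> U > 0}"
    unfolding topological_support_def by auto
  then show ?thesis unfolding closed_def by auto
qed

text \<open>By continuity the density is positive on a nonempty open set of triples with last component in any
  given neighbourhood of \<open>\<theta>\<close>, and such a set has positive Lebesgue measure.\<close>

lemma density_pos_imp_in_support:
  fixes X :: "'w \<Rightarrow> 'a::euclidean_space" and Z :: "'w \<Rightarrow> 'b::euclidean_space" and \<Theta> :: "'w \<Rightarrow> 'c::euclidean_space"
  assumes dens: "distributed M lborel (\<lambda>\<omega>. (X \<omega>, Z \<omega>, \<Theta> \<omega>)) (\<lambda>(x, z, \<theta>). ennreal (\<pi> x z \<theta>))"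
    and cont: "continuous_on UNIV (\<lambda>(x, z, \<theta>). \<pi> x z \<theta>)" and pos: "\<pi> x z \<theta> > 0"
  shows "\<theta> \<in> topological_support (distr M borel \<Theta>)"
  unfolding topological_support_def
proof (intro CollectI allI impI)
  fix U :: "'c set" assume U: "open U" "\<theta> \<in> U"
  let ?V = "\<lambda>\<omega>. (X \<omega>, Z \<omega>, \<Theta> \<omega>)" and ?g = "\<lambda>(x, z, \<theta>). ennreal (\<pi> x z \<theta>)"
  have Vm: "?V \<in> borel_measurable M" and gm: "?g \<in> borel_measurable lborel"
    using dens unfolding distributed_def by auto
  have "(\<lambda>\<omega>. snd (snd (?V \<omega>))) \<in> borel_measurable M"
    by (rule measurable_compose[OF Vm]) (intro borel_measurable_continuous_onI continuous_intros)
  then have \<Theta>m: "\<Theta> \<in> borel_measurable M" by simp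
  define A where "A = (UNIV :: 'a set) \<times> (UNIV :: 'b set) \<times> U"
  have "open A" unfolding A_def by (intro open_Times open_UNIV U(1))
  have W: "open ({v. 0 < (case v of (x, z, \<theta>) \<Rightarrow> \<pi> x z \<theta>)} \<inter> A)" (is "open ?W")
    by (intro open_Int \<open>open A\<close> open_Collect_less continuous_on_const cont)
  have "(x, z, \<theta>) \<in> ?W" using pos U by (simp add: A_def)
  then have "\<not> negligible ?W" using open_not_negligible[OF W] by blast
  then have W0: "emeasure lborel ?W \<noteq> 0"
    using W by (auto simp: negligible_iff_emeasure0)
  have "emeasure (distr M borel \<Theta>) U = emeasure M (?V -` A \<inter> space M)"
    using \<Theta>m U by (subst emeasure_distr) (auto simp: A_def intro!: arg_cong[of _ _ "emeasure M"])
  also have "\<dots> = (\<integral>\<^sup>+v. ?g v * indicator A v \<partial>lborel)"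
    by (rule distributed_emeasure[OF dens]) (use \<open>open A\<close> in simp)
  also have "\<dots> > 0"
  proof (rule ccontr)
    assume "\<not> 0 < (\<integral>\<^sup>+v. ?g v * indicator A v \<partial>lborel)"
    then have "(\<integral>\<^sup>+v. ?g v * indicator A v \<partial>lborel) = 0" by simp
    then have "AE v in lborel. ?g v * indicator A v = 0"
      using gm \<open>open A\<close> by (subst (asm) nn_integral_0_iff_AE) auto
    then have "AE v in lborel. v \<notin> ?W"
      by (rule eventually_mono) (auto simp: indicator_def split: if_splits)
    then have "emeasure lborel ?W = 0"
      using W by (subst (asm) AE_iff_measurable[of ?W]) auto
    then show False using W0 by simp
  qed
  finally show "0 < emeasure (distr M borel \<Theta>) U" .
qed

lemma cpaths_iff:
  "x \<in> mspace (cpaths T) \<longleftrightarrow> x \<in> extensional {0..T} \<and> continuous_on {0..T} x"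
  for x :: "real \<Rightarrow> 'a::metric_space"
proof -
  have "bounded (x ` {0..T})" if "continuous_on {0..T} x"
    by (intro compact_imp_bounded compact_continuous_image that) auto
  then show ?thesis
    unfolding cpaths_def by (auto simp: Met_TC.mbounded_def mbounded_iff_bounded)
qed

lemma limitin_cpaths:
  fixes x :: "nat \<Rightarrow> real \<Rightarrow> 'a::real_normed_vector"
  assumes "\<And>i. x i \<in> mspace (cpaths T)" "y \<in> mspace (cpaths T)"
    and lim: "uniform_limit {0..T} x y sequentially"
  shows "limitin (mtopology_of (cpaths T)) x y sequentially"
  unfolding mtopology_of_def Metric_space.limitin_metric[OF Metric_space_mspace_mdist]
proof (intro conjI allI impI assms(2))
  fix e :: real assume e: "e > 0"
  then have "\<forall>\<^sub>F i in sequentially. \<forall>t\<in>{0..T}. dist (x i t) (y t) < e / 2" by (intro uniform_limitD[OF lim]) simp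
  then show "\<forall>\<^sub>F i in sequentially. x i \<in> mspace (cpaths T) \<and> mdist (cpaths T) (x i) y < e"
  proof (rule eventually_mono)
    fix i assume i: "\<forall>t\<in>{0..T}. dist (x i t) (y t) < e / 2"
    have "mdist (cpaths T) (x i) y \<le> e / 2"
      unfolding cpaths_def by (rule mdist_cfunspace_le) (use e i in \<open>auto intro: less_imp_le\<close>)
    then show "x i \<in> mspace (cpaths T) \<and> mdist (cpaths T) (x i) y < e" using assms(1) e by auto
  qed
qed

lemma limitin_path_topology:
  fixes x :: "nat \<Rightarrow> real \<Rightarrow> 'a::real_normed_vector" and z :: "nat \<Rightarrow> real \<Rightarrow> 'b::real_normed_vector"
  assumes "\<And>i. x i \<in> mspace (cpaths T)" "x' \<in> mspace (cpaths T)"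
    and "uniform_limit {0..T} x x' sequentially"
    and "\<And>i. z i \<in> mspace (cpaths T)" "z' \<in> mspace (cpaths T)"
    and "uniform_limit {0..T} z z' sequentially"
    and "\<theta> \<longlonglongrightarrow> \<theta>'"
  shows "limitin (path_topology T) (\<lambda>i. (x i, z i, \<theta> i)) (x', z', \<theta>') sequentially"
  unfolding path_topology_def limitin_pairwise o_def
  using limitin_cpaths[OF assms(1,2,3)] limitin_cpaths[OF assms(4,5,6)] assms(7) by simp

section \<open>Convergence of the discretized log-posterior\<close>

lemma sqrt_sq_integral_add_le:
  assumes "square_integrable T u" "square_integrable T v"
  shows "sqrt (sq_integral T (\<lambda>t. u t + v t)) \<le> sqrt (sq_integral T u) + sqrt (sq_integral T v)"
  by (rule sqrt_le_sqrt_add_sqrt[OF sq_integral_nonneg sq_integral_nonneg sq_integral_add_le[OF assms]])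

lemma sq_integral_tendsto:
  assumes u: "\<And>i. square_integrable T (u i)" and v: "square_integrable T v"
    and lim: "((\<lambda>i. sq_integral T (\<lambda>t. u i t - v t)) \<longlongrightarrow> 0) F"
  shows "((\<lambda>i. sq_integral T (u i)) \<longlongrightarrow> sq_integral T v) F"
proof -
  have "((\<lambda>i. sqrt (sq_integral T (\<lambda>t. u i t - v t))) \<longlongrightarrow> 0) F"
    using tendsto_real_sqrt[OF lim] by simp
  then have "((\<lambda>i. sqrt (sq_integral T (u i)) - sqrt (sq_integral T v)) \<longlongrightarrow> 0) F"
  proof (rule Lim_null_comparison[rotated], intro always_eventually allI)
    fix i
    have d: "square_integrable T (\<lambda>t. u i t - v t)" "square_integrable T (\<lambda>t. v t - u i t)"
      by (intro square_integrable_diff u v)+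
    have 1: "sqrt (sq_integral T (u i)) \<le> sqrt (sq_integral T (\<lambda>t. u i t - v t)) + sqrt (sq_integral T v)"
      using sqrt_sq_integral_add_le[OF d(1) v] by simp
    have 2: "sqrt (sq_integral T v) \<le> sqrt (sq_integral T (\<lambda>t. v t - u i t)) + sqrt (sq_integral T (u i))"
      using sqrt_sq_integral_add_le[OF d(2) u[of i]] by simp
    have 3: "sq_integral T (\<lambda>t. v t - u i t) = sq_integral T (\<lambda>t. u i t - v t)"
      unfolding sq_integral_def by (simp add: norm_minus_commute)
    show "norm (sqrt (sq_integral T (u i)) - sqrt (sq_integral T v)) \<le> sqrt (sq_integral T (\<lambda>t. u i t - v t))"
      using 1 2 unfolding 3 real_norm_def by linarith
  qed
  then have "((\<lambda>i. sqrt (sq_integral T (u i))) \<longlongrightarrow> sqrt (sq_integral T v)) F"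
    by (simp add: LIM_zero_iff)
  from tendsto_power[OF this, of 2] show ?thesis by (simp add: sq_integral_nonneg)
qed

lemma sq_integral_linear_le:
  fixes A :: "'a::euclidean_space \<Rightarrow> 'b::euclidean_space"
  assumes "bounded_linear A"
  obtains C where "\<And>u. square_integrable T u \<Longrightarrow> sq_integral T (\<lambda>t. A (u t)) \<le> C * sq_integral T u"
proof -
  interpret bounded_linear A by fact
  obtain K where K: "\<And>v. norm (A v) \<le> norm v * K" using bounded by blast
  show thesis
  proof (rule that[of "K\<^sup>2"])
    fix u :: "real \<Rightarrow> 'a" assume u: "square_integrable T u"
    have "sq_integral T (\<lambda>t. A (u t)) \<le> integral {0..T} (\<lambda>t. K\<^sup>2 * (norm (u t))\<^sup>2)"
      unfolding sq_integral_def
    proof (rule integral_le)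
      show "(\<lambda>t. (norm (A (u t)))\<^sup>2) integrable_on {0..T}"
        using square_integrable_linear[OF u assms] by (simp add: square_integrable_def)
      show "(\<lambda>t. K\<^sup>2 * (norm (u t))\<^sup>2) integrable_on {0..T}"
        by (rule integrable_on_mult_right) (use u in \<open>simp add: square_integrable_def\<close>)
      show "(norm (A (u t)))\<^sup>2 \<le> K\<^sup>2 * (norm (u t))\<^sup>2" for t
        using power_mono[OF K[of "u t"], of 2] by (simp add: power_mult_distrib mult.commute)
    qed
    then show "sq_integral T (\<lambda>t. A (u t)) \<le> K\<^sup>2 * sq_integral T u" by (simp add: sq_integral_def)
  qed
qed

lemma uniform_limit_eval_tendsto:
  fixes x' :: "real \<Rightarrow> 'a::metric_space"
  assumes u: "uniform_limit S x x' F" and c: "continuous_on S x'" and t: "(s \<longlongrightarrow> t) F" "t \<in> S" "\<And>i. s i \<in> S"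
  shows "((\<lambda>i. x i (s i)) \<longlongrightarrow> x' t) F"
proof (rule tendstoI)
  fix e :: real assume e: "e > 0"
  have "((\<lambda>i. x' (s i)) \<longlongrightarrow> x' t) F"
    by (rule continuous_on_tendsto_compose[OF c t(1,2)]) (use t(3) in simp)
  then have "\<forall>\<^sub>F i in F. dist (x' (s i)) (x' t) < e / 2" by (rule tendstoD) (use e in simp)
  moreover have "\<forall>\<^sub>F i in F. \<forall>r\<in>S. dist (x i r) (x' r) < e / 2" by (rule uniform_limitD[OF u]) (use e in simp)
  ultimately show "\<forall>\<^sub>F i in F. dist (x i (s i)) (x' t) < e"
  proof eventually_elim
    case (elim i)
    then show ?case using t(3)[of i] dist_triangle[of "x i (s i)" "x' t" "x' (s i)"] by fastforce
  qed
qed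

lemma uniform_limit_imp_eventually_bounded:
  fixes x' :: "real \<Rightarrow> 'a::real_normed_vector"
  assumes u: "uniform_limit {0..T} x x' F" and c: "continuous_on {0..T} x'"
  obtains R where "\<forall>\<^sub>F i in F. \<forall>t\<in>{0..T}. norm (x i t) \<le> R"
proof -
  have "bounded (x' ` {0..T})" by (intro compact_imp_bounded compact_continuous_image c) auto
  then obtain B where B: "\<And>t. t \<in> {0..T} \<Longrightarrow> norm (x' t) \<le> B" unfolding bounded_iff by blast
  have "\<forall>\<^sub>F i in F. \<forall>t\<in>{0..T}. dist (x i t) (x' t) < 1" by (rule uniform_limitD[OF u]) simp
  then have "\<forall>\<^sub>F i in F. \<forall>t\<in>{0..T}. norm (x i t) \<le> B + 1"
  proof (rule eventually_mono, intro ballI)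
    fix i t assume "\<forall>t\<in>{0..T}. dist (x i t) (x' t) < 1" "t \<in> {0..T}"
    then have "norm (x i t - x' t) < 1" "norm (x' t) \<le> B" using B by (auto simp: dist_norm)
    then show "norm (x i t) \<le> B + 1" using norm_triangle_sub[of "x i t" "x' t"] by linarith
  qed
  then show thesis by (rule that)
qed

text \<open>The arguments of \<open>q\<close> eventually stay in a compact set. This supplies the constant bounds for
  dominated convergence.\<close>

lemma eventually_bounded_along_paths:
  fixes q :: "real \<Rightarrow> 'a::euclidean_space \<Rightarrow> 'b::euclidean_space \<Rightarrow> 'c::euclidean_space \<Rightarrow> 'd::real_normed_vector"
  assumes q: "continuous_on ({0..T} \<times> UNIV \<times> UNIV \<times> S) (\<lambda>(t, x, z, \<theta>). q t x z \<theta>)" and S: "closed S"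
    and x: "uniform_limit {0..T} x x' sequentially" "continuous_on {0..T} x'"
    and z: "uniform_limit {0..T} z z' sequentially" "continuous_on {0..T} z'"
    and \<theta>: "\<theta> \<longlonglongrightarrow> \<eta>" "\<And>i. \<theta> i \<in> S"
  obtains B where "B \<ge> 0" "\<forall>\<^sub>F i in sequentially. \<forall>t\<in>{0..T}. norm (q t (x i t) (z i t) (\<theta> i)) \<le> B"
proof -
  obtain R1 where R1: "\<forall>\<^sub>F i in sequentially. \<forall>t\<in>{0..T}. norm (x i t) \<le> R1"
    by (rule uniform_limit_imp_eventually_bounded[OF x])
  obtain R2 where R2: "\<forall>\<^sub>F i in sequentially. \<forall>t\<in>{0..T}. norm (z i t) \<le> R2"
    by (rule uniform_limit_imp_eventually_bounded[OF z])
  obtain R3 where R3: "\<And>i. norm (\<theta> i) \<le> R3"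
    using convergent_imp_Bseq[OF convergentI[OF \<theta>(1)]] unfolding Bseq_def by blast
  let ?K = "{0..T} \<times> cball 0 R1 \<times> cball 0 R2 \<times> (S \<inter> cball 0 R3)"
  have "bounded ((\<lambda>(t, x, z, \<theta>). q t x z \<theta>) ` ?K)"
    by (intro compact_imp_bounded compact_continuous_image continuous_on_subset[OF q] compact_Times
        compact_cball closed_Int_compact S) auto
  then obtain B where B: "\<And>p. p \<in> ?K \<Longrightarrow> norm (case p of (t, x, z, \<theta>) \<Rightarrow> q t x z \<theta>) \<le> B" unfolding bounded_iff by blast
  show thesis
  proof (rule that[of "max 0 B"])
    show "\<forall>\<^sub>F i in sequentially. \<forall>t\<in>{0..T}. norm (q t (x i t) (z i t) (\<theta> i)) \<le> max 0 B"
      using R1 R2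
    proof (eventually_elim, intro ballI)
      fix i t assume i: "\<forall>t\<in>{0..T}. norm (x i t) \<le> R1" "\<forall>t\<in>{0..T}. norm (z i t) \<le> R2" and t: "t \<in> {0..T}"
      have "norm (q t (x i t) (z i t) (\<theta> i)) \<le> B"
        using B[of "(t, x i t, z i t, \<theta> i)"] i t \<theta>(2) R3 by simp
      then show "norm (q t (x i t) (z i t) (\<theta> i)) \<le> max 0 B" by simp
    qed
  qed simp
qed

lemma tendsto_along_paths:
  fixes q :: "real \<Rightarrow> 'a::metric_space \<Rightarrow> 'b::metric_space \<Rightarrow> 'c::metric_space \<Rightarrow> 'd::metric_space"
  assumes q: "continuous_on ({0..T} \<times> UNIV \<times> UNIV \<times> S) (\<lambda>(t, x, z, \<theta>). q t x z \<theta>)"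
    and x: "uniform_limit {0..T} x x' F" "continuous_on {0..T} x'"
    and z: "uniform_limit {0..T} z z' F" "continuous_on {0..T} z'"
    and \<theta>: "(\<theta> \<longlongrightarrow> \<eta>) F" "\<And>i. \<theta> i \<in> S" "\<eta> \<in> S"
    and s: "(s \<longlongrightarrow> t) F" "t \<in> {0..T}" "\<And>i. s i \<in> {0..T}"
  shows "((\<lambda>i. q (s i) (x i (s i)) (z i (s i)) (\<theta> i)) \<longlongrightarrow> q t (x' t) (z' t) \<eta>) F"
proof -
  have "((\<lambda>i. (s i, x i (s i), z i (s i), \<theta> i)) \<longlongrightarrow> (t, x' t, z' t, \<eta>)) F"
    by (intro tendsto_Pair s(1) \<theta>(1) uniform_limit_eval_tendsto[OF x s] uniform_limit_eval_tendsto[OF z s])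
  from continuous_on_tendsto_compose[OF q this] show ?thesis using s \<theta> by simp
qed

lemma tendsto_ereal_plus_real:
  fixes a :: "'i \<Rightarrow> ereal"
  assumes "(a \<longlongrightarrow> A) F" "(r \<longlongrightarrow> R) F"
  shows "((\<lambda>i. a i + ereal (r i)) \<longlongrightarrow> A + ereal R) F"
  by (rule tendsto_add_ereal_general1[OF _ assms(1)]) (use assms(2) in auto)

lemma jacobian_eq_matrix:
  assumes "(g has_derivative g') (at x)"
  shows "jacobian g (at x) = matrix g'"
  unfolding jacobian_def using frechet_derivative_at[OF assms] by simp

lemma matrix_blinfun_entry_le:
  fixes b :: "(real^'n) \<Rightarrow>\<^sub>L (real^'n)"
  shows "\<bar>matrix (blinfun_apply b) $ i $ j\<bar> \<le> norm b"
proof -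
  have "\<bar>matrix (blinfun_apply b) $ i $ j\<bar> \<le> norm (blinfun_apply b (axis j 1))"
    unfolding matrix_def by (simp add: component_le_norm_cart)
  also have "\<dots> \<le> norm b" using norm_blinfun[of b "axis j 1"] by simp
  finally show ?thesis .
qed

lemma continuous_on_trace_matrix_blinfun:
  fixes b :: "'x::topological_space \<Rightarrow> (real^'n) \<Rightarrow>\<^sub>L (real^'n)"
  assumes "continuous_on X b"
  shows "continuous_on X (\<lambda>p. trace (matrix (blinfun_apply (b p))))"
  unfolding trace_def matrix_def by (simp, intro continuous_intros assms)

lemma abs_trace_le:
  fixes A :: "real^'n^'n"
  assumes "\<And>i j. \<bar>A $ i $ j\<bar> \<le> B"
  shows "\<bar>trace A\<bar> \<le> real CARD('n) * B"
proof -
  have "\<bar>trace A\<bar> \<le> (\<Sum>i\<in>UNIV. \<bar>A $ i $ i\<bar>)" unfolding trace_def by (rule sum_abs)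
  also have "\<dots> \<le> real CARD('n) * B" using assms by (intro sum_bounded_above) auto
  finally show ?thesis .
qed

lemma partition_sum_squares_le:
  assumes P: "partition_of T N \<tau>"
  shows "(\<Sum>k<N. (\<tau> (Suc k) - \<tau> k)\<^sup>2) \<le> mesh N \<tau> * T"
proof -
  have "(\<Sum>k<N. (\<tau> (Suc k) - \<tau> k)\<^sup>2) \<le> (\<Sum>k<N. mesh N \<tau> * (\<tau> (Suc k) - \<tau> k))"
  proof (rule sum_mono)
    fix k assume "k \<in> {..<N}"
    then show "(\<tau> (Suc k) - \<tau> k)\<^sup>2 \<le> mesh N \<tau> * (\<tau> (Suc k) - \<tau> k)"
      unfolding power2_eq_square using partition_mono[OF P, of k "Suc k"]
      by (intro mult_right_mono cell_le_mesh) auto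
  qed
  also have "\<dots> = mesh N \<tau> * (\<tau> N - \<tau> 0)"
    unfolding sum_distrib_left[symmetric] by (simp only: sum_lessThan_telescope)
  finally show ?thesis using P by (simp add: partition_of_def)
qed

text \<open>The Riemann sums are integrals of step functions, so dominated convergence applies.\<close>

lemma riemann_sum_tendsto:
  fixes q :: "real \<Rightarrow> 'd::euclidean_space" and c :: "nat \<Rightarrow> nat \<Rightarrow> 'd"
  assumes P: "\<And>i::nat. partition_of T (N i) (\<tau> i)" and T: "T \<ge> 0"
    and B: "\<forall>\<^sub>F i in sequentially. \<forall>k<N i. norm (c i k) \<le> B" "B \<ge> 0"
    and lim: "\<And>t. t \<in> {0<..T} \<Longrightarrow> (\<lambda>i. step_fun (N i) (\<tau> i) (c i) t) \<longlonglongrightarrow> q t"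
  shows "(\<lambda>i. \<Sum>k<N i. (\<tau> i (Suc k) - \<tau> i k) *\<^sub>R c i k) \<longlonglongrightarrow> integral {0..T} q"
proof -
  obtain i0 where i0: "\<And>i k. i \<ge> i0 \<Longrightarrow> k < N i \<Longrightarrow> norm (c i k) \<le> B"
    using B(1) unfolding eventually_sequentially by blast
  have "(\<lambda>i. integral {0..T} (step_fun (N (i + i0)) (\<tau> (i + i0)) (c (i + i0)))) \<longlonglongrightarrow> integral {0..T} q"
  proof (rule dominated_convergence_negligible(2)[OF negligible_sing[of 0]])
    show "step_fun (N (i + i0)) (\<tau> (i + i0)) (c (i + i0)) integrable_on {0..T}" for i
      using step_fun_has_integral[OF P] by blast
    show "(\<lambda>t. B) integrable_on {0..T}" by (rule integrable_const_ivl)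
    show "norm (step_fun (N (i + i0)) (\<tau> (i + i0)) (c (i + i0)) t) \<le> B" if "t \<in> {0..T} - {0}" for i t
      by (rule step_fun_norm_le[OF P i0 B(2)]) (use that in auto)
    show "(\<lambda>i. step_fun (N (i + i0)) (\<tau> (i + i0)) (c (i + i0)) t) \<longlonglongrightarrow> q t" if "t \<in> {0..T} - {0}" for t
      using LIMSEQ_ignore_initial_segment[OF lim, of t i0] that by auto
  qed
  then have "(\<lambda>i. integral {0..T} (step_fun (N i) (\<tau> i) (c i))) \<longlonglongrightarrow> integral {0..T} q"
    by (rule LIMSEQ_offset)
  then show ?thesis by (simp only: integral_unique[OF step_fun_has_integral[OF P]])
qed

lemma step_fun_sq_integral_tendsto:
  fixes q :: "real \<Rightarrow> 'd::euclidean_space" and c :: "nat \<Rightarrow> nat \<Rightarrow> 'd"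
  assumes P: "\<And>i::nat. partition_of T (N i) (\<tau> i)" and T: "T \<ge> 0"
    and B: "\<forall>\<^sub>F i in sequentially. \<forall>k<N i. norm (c i k) \<le> B" "B \<ge> 0"
    and lim: "\<And>t. t \<in> {0<..T} \<Longrightarrow> (\<lambda>i. step_fun (N i) (\<tau> i) (c i) t) \<longlonglongrightarrow> q t"
    and q: "continuous_on {0..T} q"
  shows "(\<lambda>i. sq_integral T (\<lambda>t. step_fun (N i) (\<tau> i) (c i) t - q t)) \<longlonglongrightarrow> 0"
proof -
  obtain i0 where i0: "\<And>i k. i \<ge> i0 \<Longrightarrow> k < N i \<Longrightarrow> norm (c i k) \<le> B"
    using B(1) unfolding eventually_sequentially by blast
  have "bounded (q ` {0..T})" by (intro compact_imp_bounded compact_continuous_image q) auto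
  then obtain B' where B': "\<And>t. t \<in> {0..T} \<Longrightarrow> norm (q t) \<le> B'" unfolding bounded_iff by blast
  have "(\<lambda>i. sq_integral T (\<lambda>t. step_fun (N (i + i0)) (\<tau> (i + i0)) (c (i + i0)) t - q t)) \<longlonglongrightarrow> 0"
  proof (rule sq_integral_tendsto_0[OF negligible_sing[of 0]])
    show "square_integrable T (\<lambda>t. step_fun (N (i + i0)) (\<tau> (i + i0)) (c (i + i0)) t - q t)" for i
      by (intro square_integrable_diff square_integrable_step_fun[OF P T] square_integrable_continuous q)
    show "(\<lambda>t. (B + B')\<^sup>2) integrable_on {0..T}" by (rule integrable_const_ivl)
    fix t assume t: "t \<in> {0..T} - {0}"
    show "(norm (step_fun (N (i + i0)) (\<tau> (i + i0)) (c (i + i0)) t - q t))\<^sup>2 \<le> (B + B')\<^sup>2" for i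
    proof (rule power_mono)
      have "norm (step_fun (N (i + i0)) (\<tau> (i + i0)) (c (i + i0)) t) \<le> B"
        by (rule step_fun_norm_le[OF P i0 B(2)]) (use t in auto)
      then show "norm (step_fun (N (i + i0)) (\<tau> (i + i0)) (c (i + i0)) t - q t) \<le> B + B'"
        using B'[of t] t norm_triangle_ineq4[of "step_fun (N (i + i0)) (\<tau> (i + i0)) (c (i + i0)) t" "q t"] by auto
    qed simp
    have "(\<lambda>i. step_fun (N (i + i0)) (\<tau> (i + i0)) (c (i + i0)) t) \<longlonglongrightarrow> q t"
      using LIMSEQ_ignore_initial_segment[OF lim, of t i0] t by auto
    from tendsto_diff[OF this tendsto_const, of "q t"]
    show "(\<lambda>i. step_fun (N (i + i0)) (\<tau> (i + i0)) (c (i + i0)) t - q t) \<longlonglongrightarrow> 0" by simp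
  qed
  then show ?thesis by (rule LIMSEQ_offset)
qed

text \<open>The expansion of each log-determinant leaves an error of the order of the squared length of the cell;
  these errors add up to at most the order of the mesh.\<close>

lemma log_det_sum_tendsto:
  fixes J :: "nat \<Rightarrow> nat \<Rightarrow> real^'n^'n"
  assumes P: "\<And>i::nat. partition_of T (N i) (\<tau> i)" and m: "(\<lambda>i. mesh (N i) (\<tau> i)) \<longlonglongrightarrow> 0"
    and B: "\<forall>\<^sub>F i in sequentially. \<forall>k<N i. \<forall>a b. \<bar>J i k $ a $ b\<bar> \<le> B" "B \<ge> 0"
    and lim: "(\<lambda>i. \<Sum>k<N i. (\<tau> i (Suc k) - \<tau> i k) * trace (J i k)) \<longlonglongrightarrow> I"
  shows "(\<lambda>i. \<Sum>k<N i. eln (det (mat 1 - (1/2 * (\<tau> i (Suc k) - \<tau> i k)) *\<^sub>R J i k))) \<longlonglongrightarrow> ereal (- (1/2 * I))"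
proof -
  obtain K d0 where K: "0 \<le> K" "0 < d0" "\<And>(A::real^'n^'n) d. 0 \<le> d \<Longrightarrow> d \<le> d0 \<Longrightarrow> (\<forall>i j. \<bar>A $ i $ j\<bar> \<le> B) \<Longrightarrow>
    0 < det (mat 1 - d *\<^sub>R A) \<and> \<bar>ln (det (mat 1 - d *\<^sub>R A)) + d * trace A\<bar> \<le> K * d\<^sup>2"
    using ln_det_near_identity[OF B(2), where 'n='n] by metis
  let ?d = "\<lambda>i k. 1/2 * (\<tau> i (Suc k) - \<tau> i k)"
  let ?ln = "\<lambda>i. \<Sum>k<N i. ln (det (mat 1 - ?d i k *\<^sub>R J i k))"
  let ?tr = "\<lambda>i. \<Sum>k<N i. ?d i k * trace (J i k)"
  have "\<forall>\<^sub>F i in sequentially. mesh (N i) (\<tau> i) < d0" by (rule order_tendstoD(2)[OF m K(2)])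
  with B(1) have ev: "\<forall>\<^sub>F i in sequentially. \<forall>k<N i. 0 < det (mat 1 - ?d i k *\<^sub>R J i k) \<and>
      \<bar>ln (det (mat 1 - ?d i k *\<^sub>R J i k)) + ?d i k * trace (J i k)\<bar> \<le> K * (?d i k)\<^sup>2"
  proof (eventually_elim, intro allI impI)
    fix i k assume i: "\<forall>k<N i. \<forall>a b. \<bar>J i k $ a $ b\<bar> \<le> B" "mesh (N i) (\<tau> i) < d0" and k: "k < N i"
    show "0 < det (mat 1 - ?d i k *\<^sub>R J i k) \<and>
      \<bar>ln (det (mat 1 - ?d i k *\<^sub>R J i k)) + ?d i k * trace (J i k)\<bar> \<le> K * (?d i k)\<^sup>2"
    proof (rule K(3))
      have d: "0 \<le> \<tau> i (Suc k) - \<tau> i k" using partition_mono[OF P, of k "Suc k" i] k by simp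
      then show "0 \<le> ?d i k" by simp
      show "?d i k \<le> d0" using d cell_le_mesh[OF k, of "\<tau> i"] i(2) by simp
    qed (use i(1) k in blast)
  qed
  have "(\<lambda>i. ?ln i + ?tr i) \<longlonglongrightarrow> 0"
  proof (rule Lim_null_comparison)
    show "(\<lambda>i. K * (1/4 * (mesh (N i) (\<tau> i) * T))) \<longlonglongrightarrow> 0"
      using m by (auto intro!: tendsto_mult_right_zero tendsto_mult_left_zero)
    show "\<forall>\<^sub>F i in sequentially. norm (?ln i + ?tr i) \<le> K * (1/4 * (mesh (N i) (\<tau> i) * T))"
      using ev
    proof eventually_elim
      case (elim i)
      have "norm (?ln i + ?tr i) \<le> (\<Sum>k<N i. \<bar>ln (det (mat 1 - ?d i k *\<^sub>R J i k)) + ?d i k * trace (J i k)\<bar>)"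
        unfolding sum.distrib[symmetric] real_norm_def by (rule sum_abs)
      also have "\<dots> \<le> (\<Sum>k<N i. K * (?d i k)\<^sup>2)" using elim by (intro sum_mono) auto
      also have "\<dots> = K * (1/4 * (\<Sum>k<N i. (\<tau> i (Suc k) - \<tau> i k)\<^sup>2))"
        by (simp add: sum_distrib_left power_mult_distrib power_divide)
      also have "\<dots> \<le> K * (1/4 * (mesh (N i) (\<tau> i) * T))"
        using K(1) by (intro mult_left_mono partition_sum_squares_le P) auto
      finally show ?case .
    qed
  qed
  moreover have "?tr \<longlonglongrightarrow> 1/2 * I"
    using tendsto_mult_left[OF lim, of "1/2"] by (simp add: sum_distrib_left mult.assoc)
  ultimately have "(\<lambda>i. (?ln i + ?tr i) - ?tr i) \<longlonglongrightarrow> 0 - 1/2 * I" by (rule tendsto_diff)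
  then have "(\<lambda>i. ereal (?ln i)) \<longlonglongrightarrow> ereal (- (1/2 * I))" by simp
  moreover have "\<forall>\<^sub>F i in sequentially. ereal (?ln i) = (\<Sum>k<N i. eln (det (mat 1 - ?d i k *\<^sub>R J i k)))"
    using ev
  proof eventually_elim
    case (elim i)
    have "(\<Sum>k<N i. eln (det (mat 1 - ?d i k *\<^sub>R J i k))) = (\<Sum>k<N i. ereal (ln (det (mat 1 - ?d i k *\<^sub>R J i k))))"
      by (rule sum.cong) (use elim in \<open>auto simp: eln_def not_le\<close>)
    then show ?case by (simp add: sum_ereal)
  qed
  ultimately show ?thesis by (rule Lim_transform_eventually)
qed

text \<open>Almost everywhere, the weak derivative of a piecewise linear path is the step function of its
  slopes.\<close>

lemma wderiv_PL_sq_integral: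
  fixes x :: "real \<Rightarrow> 'a::euclidean_space" and A :: "'a \<Rightarrow> 'b::euclidean_space"
  assumes T: "T > 0" and P: "partition_of T N \<tau>" and x: "x \<in> PL T N \<tau>" and A: "bounded_linear A"
  shows "(\<Sum>k<N. (\<tau> (Suc k) - \<tau> k) * (norm (A (slope \<tau> x k - c k)))\<^sup>2)
    = sq_integral T (\<lambda>t. A (wderiv T x t - step_fun N \<tau> c t))"
proof -
  obtain E where E: "negligible E" "\<And>t. t \<in> {0..T} - E \<Longrightarrow> wderiv T x t = step_fun N \<tau> (slope \<tau> x) t"
    using wderiv_spike[OF T PL_weak_derivative[OF T P x]] by blast
  have "sq_integral T (\<lambda>t. A (wderiv T x t - step_fun N \<tau> c t))
      = integral {0..T} (step_fun N \<tau> (\<lambda>k. (norm (A (slope \<tau> x k - c k)))\<^sup>2))"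
    unfolding sq_integral_def
  proof (rule integral_spike[of "insert 0 E"])
    show "negligible (insert 0 E)" using E(1) by simp
    fix t assume t: "t \<in> {0..T} - insert 0 E"
    then have "t \<in> {0<..T}" by auto
    then obtain k where k: "k < N" "t \<in> {\<tau> k<..\<tau> (Suc k)}" by (rule partition_cell_exists[OF P])
    show "step_fun N \<tau> (\<lambda>k. (norm (A (slope \<tau> x k - c k)))\<^sup>2) t = (norm (A (wderiv T x t - step_fun N \<tau> c t)))\<^sup>2"
      using E(2)[of t] t unfolding step_fun_on_cell[OF P k] by simp
  qed
  then show ?thesis unfolding integral_unique[OF step_fun_has_integral[OF P]] by simp
qed

context
  fixes T Lh :: real
    and f :: "real \<Rightarrow> real^'n \<Rightarrow> real^'q \<Rightarrow> real^'m \<Rightarrow> real^'n"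
    and h :: "real \<Rightarrow> real^'n \<Rightarrow> real^'q \<Rightarrow> real^'m \<Rightarrow> real^'q"
    and G :: "real^'n^'n"
    and \<pi> :: "real^'n \<Rightarrow> real^'q \<Rightarrow> real^'m \<Rightarrow> real"
    and \<psi> :: "'y \<Rightarrow> (real \<Rightarrow> real^'n) \<Rightarrow> (real \<Rightarrow> real^'q) \<Rightarrow> real^'m \<Rightarrow> real" and y :: 'y
    and S :: "(real^'m) set"
    and fx :: "real \<Rightarrow> real^'n \<Rightarrow> real^'q \<Rightarrow> real^'m \<Rightarrow> (real^'n) \<Rightarrow>\<^sub>L (real^'n)"
  assumes T: "T > 0" and Lh: "Lh > 0" and S: "closed S"
    and f_cont: "continuous_on ({0..T} \<times> UNIV \<times> UNIV \<times> S) (\<lambda>(t, x, z, \<theta>). f t x z \<theta>)"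
    and fx_deriv: "\<And>t x z \<theta>. t \<in> {0..T} \<Longrightarrow> \<theta> \<in> S \<Longrightarrow> ((\<lambda>\<xi>. f t \<xi> z \<theta>) has_derivative blinfun_apply (fx t x z \<theta>)) (at x)"
    and fx_cont: "continuous_on ({0..T} \<times> UNIV \<times> UNIV \<times> S) (\<lambda>(t, x, z, \<theta>). fx t x z \<theta>)"
    and h_uc: "uniformly_continuous_on ({0..T} \<times> UNIV \<times> UNIV \<times> S) (\<lambda>(t, x, z, \<theta>). h t x z \<theta>)"
    and h_lip: "\<And>t x z z' \<theta>. t \<in> {0..T} \<Longrightarrow> \<theta> \<in> S \<Longrightarrow> norm (h t x z \<theta> - h t x z' \<theta>) \<le> Lh * norm (z - z')"
    and \<pi>_cont: "continuous_on UNIV (\<lambda>(x, z, \<theta>). \<pi> x z \<theta>)"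
    and \<pi>_nonneg: "\<And>x z \<theta>. \<pi> x z \<theta> \<ge> 0"
    and \<psi>_cont: "continuous_map (path_topology T) euclideanreal (\<lambda>(x, z, \<theta>). \<psi> y x z \<theta>)"
    and \<psi>_nonneg: "\<And>x z \<theta>. x \<in> mspace (cpaths T) \<Longrightarrow> z \<in> mspace (cpaths T) \<Longrightarrow> \<psi> y x z \<theta> \<ge> 0"
begin

text \<open>A single formula for both branches of the definition: where \<open>\<pi>\<close> vanishes, its logarithm is
  \<open>-\<infinity>\<close> and absorbs the other terms, none of which is \<open>\<infinity>\<close>.\<close>

lemma log_posterior_eq:
  fixes v :: "real^'q"
  assumes x: "x \<in> W2 T" and \<theta>: "\<theta> \<in> S"
  defines "z \<equiv> ode_path T h x v \<theta>"
  shows "log_posterior T f h G \<pi> \<psi> y (x, v, \<theta>) = eln (\<psi> y x z \<theta>) + eln (\<pi> (x 0) v \<theta>)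
     + ereal (- (1/2 * integral {0..T} (\<lambda>t. trace (matrix (blinfun_apply (fx t (x t) (z t) \<theta>))))))
     + ereal (- (1/2 * sq_integral T (\<lambda>t. matrix_inv G *v (wderiv T x t - f t (x t) (z t) \<theta>))))"
proof -
  have xc: "continuous_on {0..T} x" by (rule W2_D(1)[OF T x])
  have zc: "continuous_on {0..T} z" unfolding z_def by (rule ode_path_solves(2)[OF T Lh h_lip h_uc xc \<theta>])
  have tr: "(LINT t:{0..T}|lebesgue. trace (jacobian (\<lambda>\<xi>. f t \<xi> (z t) \<theta>) (at (x t))))
     = integral {0..T} (\<lambda>t. trace (matrix (blinfun_apply (fx t (x t) (z t) \<theta>))))"
  proof -
    have "(LINT t:{0..T}|lebesgue. trace (jacobian (\<lambda>\<xi>. f t \<xi> (z t) \<theta>) (at (x t))))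
      = (LINT t:{0..T}|lebesgue. trace (matrix (blinfun_apply (fx t (x t) (z t) \<theta>))))"
      by (rule set_lebesgue_integral_cong) (simp_all add: jacobian_eq_matrix[OF fx_deriv] \<theta>)
    also have "\<dots> = integral {0..T} (\<lambda>t. trace (matrix (blinfun_apply (fx t (x t) (z t) \<theta>))))"
      by (intro set_lebesgue_integral_eq_integral(2) absolutely_integrable_continuous_real
          continuous_on_trace_matrix_blinfun continuous_on_along_path[OF fx_cont xc zc \<theta>])
    finally show ?thesis .
  qed
  have sq: "square_integrable T (\<lambda>t. matrix_inv G *v (wderiv T x t - f t (x t) (z t) \<theta>))"
    by (intro square_integrable_linear[OF _ matrix_vector_mul_bounded_linear] square_integrable_diff W2_D(3)[OF T x]
        square_integrable_continuous continuous_on_along_path[OF f_cont xc zc \<theta>])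
  have nm: "norm (matrix_inv G *v (a - b)) = norm (matrix_inv G *v (b - a))" for a b
    by (metis matrix_vector_mult_diff_distrib norm_minus_commute)
  have pen: "(LINT t:{0..T}|lebesgue. (norm (matrix_inv G *v (f t (x t) (z t) \<theta> - wderiv T x t)))\<^sup>2)
     = sq_integral T (\<lambda>t. matrix_inv G *v (wderiv T x t - f t (x t) (z t) \<theta>))"
    unfolding lebesgue_integral_norm_sq[OF sq, symmetric] by (subst nm) simp
  show ?thesis
  proof (cases "\<pi> (x 0) v \<theta> = 0")
    case True
    then show ?thesis by (simp add: log_posterior_def eln_def)
  next
    case False
    have "e - ereal a - ereal b = e + ereal (- b) + ereal (- a)" for e a b
      by (cases e) auto
    then show ?thesis
      using False unfolding log_posterior_def by (simp add: Let_def z_def[symmetric] tr pen)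
  qed
qed

text \<open>The discrete sum of squares as an integral, to be compared with the one in \<open>log_posterior_eq\<close>.\<close>

lemma trapezoidal_log_posterior_eq:
  fixes v :: "real^'q"
  assumes P: "partition_of T N \<tau>" and x: "x \<in> PL T N \<tau>" and \<theta>: "\<theta> \<in> S" and \<pi>: "\<pi> (x 0) v \<theta> \<noteq> 0"
  defines "z \<equiv> trapezoidal_path T h N \<tau> x v \<theta>"
  defines "F \<equiv> \<lambda>k. f (\<tau> k) (x (\<tau> k)) (z (\<tau> k)) \<theta>"
  shows "trapezoidal_log_posterior T f h G \<pi> \<psi> y N \<tau> (x, v, \<theta>) = eln (\<psi> y x z \<theta>) + eln (\<pi> (x 0) v \<theta>)
     + (\<Sum>k<N. eln (det (mat 1 - (1/2 * (\<tau> (Suc k) - \<tau> k)) *\<^sub>R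
         matrix (blinfun_apply (fx (\<tau> (Suc k)) (x (\<tau> (Suc k))) (z (\<tau> (Suc k))) \<theta>)))))
     + ereal (- (1/2 * sq_integral T (\<lambda>t. matrix_inv G *v (wderiv T x t - step_fun N \<tau> (\<lambda>k. (1/2) *\<^sub>R F k + (1/2) *\<^sub>R F (Suc k)) t))))"
proof -
  have J: "(\<Sum>k<N. eln (det (mat 1 - (1/2 * (\<tau> (Suc k) - \<tau> k)) *\<^sub>R
         jacobian (\<lambda>\<xi>. f (\<tau> (Suc k)) \<xi> (z (\<tau> (Suc k))) \<theta>) (at (x (\<tau> (Suc k)))))))
    = (\<Sum>k<N. eln (det (mat 1 - (1/2 * (\<tau> (Suc k) - \<tau> k)) *\<^sub>R
         matrix (blinfun_apply (fx (\<tau> (Suc k)) (x (\<tau> (Suc k))) (z (\<tau> (Suc k))) \<theta>)))))"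
  proof (rule sum.cong[OF refl])
    fix k assume "k \<in> {..<N}"
    then have t: "\<tau> (Suc k) \<in> {0..T}" using partition_range[OF P, of "Suc k"] by simp
    show "eln (det (mat 1 - (1/2 * (\<tau> (Suc k) - \<tau> k)) *\<^sub>R
         jacobian (\<lambda>\<xi>. f (\<tau> (Suc k)) \<xi> (z (\<tau> (Suc k))) \<theta>) (at (x (\<tau> (Suc k))))))
      = eln (det (mat 1 - (1/2 * (\<tau> (Suc k) - \<tau> k)) *\<^sub>R
         matrix (blinfun_apply (fx (\<tau> (Suc k)) (x (\<tau> (Suc k))) (z (\<tau> (Suc k))) \<theta>))))"
      unfolding jacobian_eq_matrix[OF fx_deriv[OF t \<theta>]] ..
  qed
  have Q: "(\<Sum>k<N. (\<tau> (Suc k) - \<tau> k) * (norm (matrix_inv G *v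
        ((x (\<tau> (Suc k)) - x (\<tau> k)) /\<^sub>R (\<tau> (Suc k) - \<tau> k) - (1/2) *\<^sub>R F k - (1/2) *\<^sub>R F (Suc k))))\<^sup>2)
    = sq_integral T (\<lambda>t. matrix_inv G *v (wderiv T x t - step_fun N \<tau> (\<lambda>k. (1/2) *\<^sub>R F k + (1/2) *\<^sub>R F (Suc k)) t))"
    unfolding wderiv_PL_sq_integral[OF T P x matrix_vector_mul_bounded_linear, symmetric] slope_def diff_diff_add ..
  have "trapezoidal_log_posterior T f h G \<pi> \<psi> y N \<tau> (x, v, \<theta>) = eln (\<psi> y x z \<theta>) + eln (\<pi> (x 0) v \<theta>)
     + (\<Sum>k<N. eln (det (mat 1 - (1/2 * (\<tau> (Suc k) - \<tau> k)) *\<^sub>R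
         jacobian (\<lambda>\<xi>. f (\<tau> (Suc k)) \<xi> (z (\<tau> (Suc k))) \<theta>) (at (x (\<tau> (Suc k)))))))
     - ereal (1/2 * (\<Sum>k<N. (\<tau> (Suc k) - \<tau> k) * (norm (matrix_inv G *v
        ((x (\<tau> (Suc k)) - x (\<tau> k)) /\<^sub>R (\<tau> (Suc k) - \<tau> k) - (1/2) *\<^sub>R F k - (1/2) *\<^sub>R F (Suc k))))\<^sup>2))"
    using x \<pi> unfolding trapezoidal_log_posterior_def Let_def z_def F_def prod.case by (simp only: if_False not_True_eq_False de_Morgan_disj simp_thms)
  then show ?thesis unfolding J Q by (simp add: minus_ereal_def)
qed

text \<open>Strong convergence of the paths makes every term converge; no term of the limit is \<open>\<infinity>\<close>, so the
  limits may be added.\<close>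

lemma trapezoidal_log_posterior_tendsto:
  assumes P: "\<And>i::nat. partition_of T (N i) (\<tau> i)" and m: "(\<lambda>i. mesh (N i) (\<tau> i)) \<longlonglongrightarrow> 0"
    and m2: "\<And>i. Lh * mesh (N i) (\<tau> i) < 2"
    and x: "\<And>i. x i \<in> PL T (N i) (\<tau> i)" and x': "x' \<in> W2 T" and xl: "(\<lambda>i. W2_dist T (x i) x') \<longlonglongrightarrow> 0"
    and \<zeta>: "\<zeta> \<longlonglongrightarrow> v" and \<theta>: "\<theta> \<longlonglongrightarrow> \<eta>" "\<And>i. \<theta> i \<in> S" and \<pi>: "\<And>i. \<pi> (x i 0) (\<zeta> i) (\<theta> i) \<noteq> 0"
  shows "(\<lambda>i. trapezoidal_log_posterior T f h G \<pi> \<psi> y (N i) (\<tau> i) (x i, \<zeta> i, \<theta> i))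
    \<longlonglongrightarrow> log_posterior T f h G \<pi> \<psi> y (x', v, \<eta>)"
proof -
  have T0: "0 \<le> T" using T by simp
  have \<eta>: "\<eta> \<in> S" using closed_sequentially[OF S \<theta>(2,1)] .
  have xW: "x i \<in> W2 T" for i using PL_subset_W2[OF T P] x by blast
  have xc: "continuous_on {0..T} x'" by (rule W2_D(1)[OF T x'])
  have xu: "uniform_limit {0..T} x x' sequentially" by (rule W2_tendsto_imp_uniform_limit[OF T xW x' xl])
  define z where "z = (\<lambda>i. trapezoidal_path T h (N i) (\<tau> i) (x i) (\<zeta> i) (\<theta> i))"
  define z' where "z' = ode_path T h x' v \<eta>"
  have zu: "uniform_limit {0..T} z z' sequentially" unfolding z_def z'_def
    by (rule trapezoidal_path_uniform_limit_ode_path[OF T Lh h_lip h_uc P m m2 xc xu \<theta>(2) \<eta> \<theta>(1) \<zeta>])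
  have z'W: "z' \<in> W2 T" unfolding z'_def by (rule ode_path_solves(1)[OF T Lh h_lip h_uc xc \<eta>])
  have zc: "continuous_on {0..T} z'" unfolding z'_def by (rule ode_path_solves(2)[OF T Lh h_lip h_uc xc \<eta>])
  have zPL: "z i \<in> PL T (N i) (\<tau> i)" for i
    using trapezoidal_path_solves[OF T Lh h_lip h_uc P m2 \<theta>(2)] unfolding z_def trapezoidal_solution_def by blast
  have PLc: "p \<in> mspace (cpaths T)" if "p \<in> PL T n s" for p :: "real \<Rightarrow> 'e::euclidean_space" and n s
    using that unfolding cpaths_iff PL_def by blast
  have W2c: "p \<in> mspace (cpaths T)" if "p \<in> W2 T" for p :: "real \<Rightarrow> 'e::euclidean_space"
    using W2_D(1,4)[OF T that] unfolding cpaths_iff by blast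
  have zer: "(0::real) \<in> {0..T}" using T by simp
  \<comment> \<open>Likelihood and prior are continuous, and their arguments converge.\<close>
  have "limitin (path_topology T) (\<lambda>i. (x i, z i, \<theta> i)) (x', z', \<eta>) sequentially"
    by (rule limitin_path_topology[OF PLc[OF x] W2c[OF x'] xu PLc[OF zPL] W2c[OF z'W] zu \<theta>(1)])
  from continuous_map_limit[OF \<psi>_cont this]
  have "(\<lambda>i. \<psi> y (x i) (z i) (\<theta> i)) \<longlonglongrightarrow> \<psi> y x' z' \<eta>" by (simp add: o_def)
  then have l1: "(\<lambda>i. eln (\<psi> y (x i) (z i) (\<theta> i))) \<longlonglongrightarrow> eln (\<psi> y x' z' \<eta>)"
    by (rule tendsto_eln[OF _ \<psi>_nonneg[OF W2c[OF x'] W2c[OF z'W]]])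
  have "(\<lambda>i. (x i 0, \<zeta> i, \<theta> i)) \<longlonglongrightarrow> (x' 0, v, \<eta>)"
    by (intro tendsto_Pair \<zeta> \<theta>(1) tendsto_uniform_limitI[OF xu zer])
  from continuous_on_tendsto_compose[OF \<pi>_cont this]
  have "(\<lambda>i. \<pi> (x i 0) (\<zeta> i) (\<theta> i)) \<longlonglongrightarrow> \<pi> (x' 0) v \<eta>" by simp
  then have l2: "(\<lambda>i. eln (\<pi> (x i 0) (\<zeta> i) (\<theta> i))) \<longlonglongrightarrow> eln (\<pi> (x' 0) v \<eta>)"
    by (rule tendsto_eln[OF _ \<pi>_nonneg])
  have l12: "(\<lambda>i. eln (\<psi> y (x i) (z i) (\<theta> i)) + eln (\<pi> (x i 0) (\<zeta> i) (\<theta> i)))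
     \<longlonglongrightarrow> eln (\<psi> y x' z' \<eta>) + eln (\<pi> (x' 0) v \<eta>)"
    by (rule tendsto_add_ereal_general[OF _ l1 l2]) (simp_all add: eln_less_PInf)
  have nodes: "\<tau> i k \<in> {0..T}" if "k \<le> N i" for i k using partition_range[OF P that] by simp
  \<comment> \<open>The Jacobians are bounded along the sequence, and their traces at the right endpoints of the
      cells form a Riemann sum.\<close>
  define J where "J = (\<lambda>i k. matrix (blinfun_apply (fx (\<tau> i (Suc k)) (x i (\<tau> i (Suc k))) (z i (\<tau> i (Suc k))) (\<theta> i))))"
  define I where "I = integral {0..T} (\<lambda>t. trace (matrix (blinfun_apply (fx t (x' t) (z' t) \<eta>))))"
  obtain B where B: "B \<ge> 0" "\<forall>\<^sub>F i in sequentially. \<forall>t\<in>{0..T}. norm (fx t (x i t) (z i t) (\<theta> i)) \<le> B"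
    by (rule eventually_bounded_along_paths[OF fx_cont S xu xc zu zc \<theta>])
  from B(2) have JB: "\<forall>\<^sub>F i in sequentially. \<forall>k<N i. \<forall>a b. \<bar>J i k $ a $ b\<bar> \<le> B"
  proof (eventually_elim, intro allI impI)
    fix i k a b assume i: "\<forall>t\<in>{0..T}. norm (fx t (x i t) (z i t) (\<theta> i)) \<le> B" and k: "k < N i"
    show "\<bar>J i k $ a $ b\<bar> \<le> B" unfolding J_def
      by (rule order_trans[OF matrix_blinfun_entry_le]) (use i nodes[of "Suc k" i] k in auto)
  qed
  have trc: "continuous_on ({0..T} \<times> UNIV \<times> UNIV \<times> S) (\<lambda>(t, x, z, \<theta>). trace (matrix (blinfun_apply (fx t x z \<theta>))))"
    using continuous_on_trace_matrix_blinfun[OF fx_cont] by (simp add: case_prod_unfold)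
  have "(\<lambda>i. \<Sum>k<N i. (\<tau> i (Suc k) - \<tau> i k) *\<^sub>R trace (J i k)) \<longlonglongrightarrow> I"
    unfolding I_def
  proof (rule riemann_sum_tendsto[OF P T0])
    show "\<forall>\<^sub>F i in sequentially. \<forall>k<N i. norm (trace (J i k)) \<le> real CARD('n) * B"
      using JB by eventually_elim (auto intro!: abs_trace_le)
    show "0 \<le> real CARD('n) * B" using B by simp
    fix t assume t: "t \<in> {0<..T}"
    obtain k where k: "\<And>i. k i < N i" "\<And>i. t \<in> {\<tau> i (k i)<..\<tau> i (Suc (k i))}" "(\<lambda>i. \<tau> i (Suc (k i))) \<longlonglongrightarrow> t"
      using step_fun_endpoints_tendsto[OF P m t] by metis
    have "(\<lambda>i. trace (J i (k i))) \<longlonglongrightarrow> trace (matrix (blinfun_apply (fx t (x' t) (z' t) \<eta>)))"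
      unfolding J_def
      by (rule tendsto_along_paths[OF trc xu xc zu zc \<theta> \<eta> k(3)]) (use t nodes k(1) in \<open>auto simp: Suc_le_eq\<close>)
    then show "(\<lambda>i. step_fun (N i) (\<tau> i) (\<lambda>k. trace (J i k)) t) \<longlonglongrightarrow> trace (matrix (blinfun_apply (fx t (x' t) (z' t) \<eta>)))"
      unfolding step_fun_on_cell[OF P k(1,2)] .
  qed
  then have l3: "(\<lambda>i. \<Sum>k<N i. eln (det (mat 1 - (1/2 * (\<tau> i (Suc k) - \<tau> i k)) *\<^sub>R J i k))) \<longlonglongrightarrow> ereal (- (1/2 * I))"
    by (intro log_det_sum_tendsto[OF P m JB B(1)]) simp
  \<comment> \<open>The averaged drifts converge in \<open>L\<^sup>2\<close>, as do the derivatives of the paths; hence so does the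
      linear image of their difference.\<close>
  define F where "F = (\<lambda>i k. f (\<tau> i k) (x i (\<tau> i k)) (z i (\<tau> i k)) (\<theta> i))"
  define c where "c = (\<lambda>i k. (1/2) *\<^sub>R F i k + (1/2) *\<^sub>R F i (Suc k))"
  define F' where "F' = (\<lambda>t. f t (x' t) (z' t) \<eta>)"
  have F'c: "continuous_on {0..T} F'" unfolding F'_def by (rule continuous_on_along_path[OF f_cont xc zc \<eta>])
  obtain B' where B': "B' \<ge> 0" "\<forall>\<^sub>F i in sequentially. \<forall>t\<in>{0..T}. norm (f t (x i t) (z i t) (\<theta> i)) \<le> B'"
    by (rule eventually_bounded_along_paths[OF f_cont S xu xc zu zc \<theta>])
  have Fl: "(\<lambda>i. sq_integral T (\<lambda>t. step_fun (N i) (\<tau> i) (c i) t - F' t)) \<longlonglongrightarrow> 0"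
  proof (rule step_fun_sq_integral_tendsto[OF P T0 _ B'(1) _ F'c])
    from B'(2) show "\<forall>\<^sub>F i in sequentially. \<forall>k<N i. norm (c i k) \<le> B'"
    proof (eventually_elim, intro allI impI)
      fix i k assume i: "\<forall>t\<in>{0..T}. norm (f t (x i t) (z i t) (\<theta> i)) \<le> B'" and k: "k < N i"
      have "norm (F i k) \<le> B'" "norm (F i (Suc k)) \<le> B'"
        unfolding F_def using i nodes[of k i] nodes[of "Suc k" i] k by auto
      then show "norm (c i k) \<le> B'" unfolding c_def by (intro norm_triangle_le) simp
    qed
    fix t assume t: "t \<in> {0<..T}"
    obtain k where k: "\<And>i. k i < N i" "\<And>i. t \<in> {\<tau> i (k i)<..\<tau> i (Suc (k i))}"
        "(\<lambda>i. \<tau> i (k i)) \<longlonglongrightarrow> t" "(\<lambda>i. \<tau> i (Suc (k i))) \<longlonglongrightarrow> t"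
      using step_fun_endpoints_tendsto[OF P m t] by metis
    have "(\<lambda>i. F i (k i)) \<longlonglongrightarrow> F' t" "(\<lambda>i. F i (Suc (k i))) \<longlonglongrightarrow> F' t"
      unfolding F_def F'_def
      by (rule tendsto_along_paths[OF f_cont xu xc zu zc \<theta> \<eta> k(3)], use t nodes k(1) in \<open>auto simp: less_imp_le\<close>)
         (rule tendsto_along_paths[OF f_cont xu xc zu zc \<theta> \<eta> k(4)], use t nodes k(1) in \<open>auto simp: Suc_le_eq\<close>)
    then have "(\<lambda>i. c i (k i)) \<longlonglongrightarrow> (1/2) *\<^sub>R F' t + (1/2) *\<^sub>R F' t"
      unfolding c_def by (intro tendsto_intros)
    then have "(\<lambda>i. c i (k i)) \<longlonglongrightarrow> F' t" by (simp add: scaleR_left_distrib[symmetric])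
    then show "(\<lambda>i. step_fun (N i) (\<tau> i) (c i) t) \<longlonglongrightarrow> F' t" unfolding step_fun_on_cell[OF P k(1,2)] .
  qed
  let ?A = "\<lambda>w. matrix_inv G *v w"
  have A: "bounded_linear ?A" by (rule matrix_vector_mul_bounded_linear)
  have ws: "square_integrable T (wderiv T (x i))" "square_integrable T (wderiv T x')" for i
    by (rule W2_D(3)[OF T xW], rule W2_D(3)[OF T x'])
  have ss: "square_integrable T (step_fun (N i) (\<tau> i) (c i))" for i by (rule square_integrable_step_fun[OF P T0])
  have Fs: "square_integrable T F'" by (rule square_integrable_continuous[OF F'c])
  let ?u = "\<lambda>i t. wderiv T (x i) t - step_fun (N i) (\<tau> i) (c i) t" and ?u' = "\<lambda>t. wderiv T x' t - F' t"
  have us: "square_integrable T (?u i)" "square_integrable T ?u'" for i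
    by (intro square_integrable_diff ws ss Fs)+
  have "(\<lambda>i. sq_integral T (\<lambda>t. ?A (?u i t))) \<longlonglongrightarrow> sq_integral T (\<lambda>t. ?A (?u' t))"
  proof (rule sq_integral_tendsto)
    show "square_integrable T (\<lambda>t. ?A (?u i t))" for i by (rule square_integrable_linear[OF us(1) A])
    show "square_integrable T (\<lambda>t. ?A (?u' t))" by (rule square_integrable_linear[OF us(2) A])
    obtain C where C: "\<And>u. square_integrable T u \<Longrightarrow> sq_integral T (\<lambda>t. ?A (u t)) \<le> C * sq_integral T u"
      using sq_integral_linear_le[OF A] by blast
    let ?a = "\<lambda>i t. wderiv T (x i) t - wderiv T x' t" and ?b = "\<lambda>i t. step_fun (N i) (\<tau> i) (c i) t - F' t"
    have ab: "square_integrable T (?a i)" "square_integrable T (\<lambda>t. - ?b i t)" for i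
      using square_integrable_diff[OF Fs ss[of i]] by (auto intro!: square_integrable_diff ws)
    have wl: "(\<lambda>i. sq_integral T (?a i)) \<longlonglongrightarrow> 0" by (rule W2_tendsto_imp_wderiv_tendsto[OF T xW x' xl])
    show "(\<lambda>i. sq_integral T (\<lambda>t. ?A (?u i t) - ?A (?u' t))) \<longlonglongrightarrow> 0"
    proof (rule Lim_null_comparison)
      show "(\<lambda>i. \<bar>C\<bar> * (2 * sq_integral T (?a i) + 2 * sq_integral T (?b i))) \<longlonglongrightarrow> 0"
        using tendsto_mult_left[OF tendsto_add[OF tendsto_mult_left[OF wl, of 2] tendsto_mult_left[OF Fl, of 2]], of "\<bar>C\<bar>"] by simp
      show "\<forall>\<^sub>F i in sequentially. norm (sq_integral T (\<lambda>t. ?A (?u i t) - ?A (?u' t)))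
          \<le> \<bar>C\<bar> * (2 * sq_integral T (?a i) + 2 * sq_integral T (?b i))"
      proof (intro always_eventually allI)
        fix i
        have eq: "?A (?u i t) - ?A (?u' t) = ?A (?a i t + - ?b i t)" for t
          unfolding matrix_vector_mult_diff_distrib[symmetric] by (simp add: algebra_simps)
        have "sq_integral T (\<lambda>t. ?A (?u i t) - ?A (?u' t)) \<le> C * sq_integral T (\<lambda>t. ?a i t + - ?b i t)"
          unfolding eq by (rule C[OF square_integrable_add[OF ab]])
        also have "\<dots> \<le> \<bar>C\<bar> * sq_integral T (\<lambda>t. ?a i t + - ?b i t)"
          by (intro mult_right_mono sq_integral_nonneg) simp
        also have "\<dots> \<le> \<bar>C\<bar> * ((1 + 1) * sq_integral T (?a i) + (1 + 1/1) * sq_integral T (\<lambda>t. - ?b i t))"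
          by (intro mult_left_mono sq_integral_add_le[OF ab]) simp_all
        also have "sq_integral T (\<lambda>t. - ?b i t) = sq_integral T (?b i)"
          unfolding sq_integral_def by (simp add: norm_minus_commute)
        finally show "norm (sq_integral T (\<lambda>t. ?A (?u i t) - ?A (?u' t)))
          \<le> \<bar>C\<bar> * (2 * sq_integral T (?a i) + 2 * sq_integral T (?b i))"
          by (simp add: sq_integral_nonneg)
      qed
    qed
  qed
  then have l4: "(\<lambda>i. - (1/2 * sq_integral T (\<lambda>t. ?A (?u i t)))) \<longlonglongrightarrow> - (1/2 * sq_integral T (\<lambda>t. ?A (?u' t)))"
    by (intro tendsto_intros)
  have l123: "(\<lambda>i. eln (\<psi> y (x i) (z i) (\<theta> i)) + eln (\<pi> (x i 0) (\<zeta> i) (\<theta> i))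
      + (\<Sum>k<N i. eln (det (mat 1 - (1/2 * (\<tau> i (Suc k) - \<tau> i k)) *\<^sub>R J i k))))
     \<longlonglongrightarrow> eln (\<psi> y x' z' \<eta>) + eln (\<pi> (x' 0) v \<eta>) + ereal (- (1/2 * I))"
    by (rule tendsto_add_ereal_general1[OF _ l12 l3]) simp
  show ?thesis
    unfolding log_posterior_eq[OF x' \<eta>] trapezoidal_log_posterior_eq[OF P x \<theta>(2) \<pi>]
    using tendsto_ereal_plus_real[OF l123 l4]
    unfolding J_def I_def c_def F_def F'_def z_def z'_def .
qed

end

theorem theorem3p14:
  fixes tf :: real
    and M :: "'w measure" and F :: "real \<Rightarrow> 'w measure" and W :: "real \<Rightarrow> 'w \<Rightarrow> real^'n"
    and X :: "real \<Rightarrow> 'w \<Rightarrow> real^'n" and Z :: "real \<Rightarrow> 'w \<Rightarrow> real^'q" and \<Theta> :: "'w \<Rightarrow> real^'m"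
    and f :: "real \<Rightarrow> real^'n \<Rightarrow> real^'q \<Rightarrow> real^'m \<Rightarrow> real^'n"
    and h :: "real \<Rightarrow> real^'n \<Rightarrow> real^'q \<Rightarrow> real^'m \<Rightarrow> real^'q"
    and G :: "real^'n^'n"
    and \<pi> :: "real^'n \<Rightarrow> real^'q \<Rightarrow> real^'m \<Rightarrow> real"
    and Y :: "'w \<Rightarrow> 'y::metric_space" and y :: 'y and \<nu> :: "'y measure"
    and \<psi> :: "'y \<Rightarrow> (real \<Rightarrow> real^'n) \<Rightarrow> (real \<Rightarrow> real^'q) \<Rightarrow> real^'m \<Rightarrow> real"
    and K :: "(real \<Rightarrow> real^'n) \<Rightarrow> (real \<Rightarrow> real^'q) \<Rightarrow> real^'m \<Rightarrow> 'y measure"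
    and Lf Lh :: real
    and N :: "nat \<Rightarrow> nat" and \<tau> :: "nat \<Rightarrow> nat \<Rightarrow> real"
    and S :: "(real^'m) set" and D :: "(real \<times> (real^'n) \<times> (real^'q) \<times> (real^'m)) set"
  assumes S: "S = topological_support (distr M borel \<Theta>)"
    and D: "D = {0..tf} \<times> UNIV \<times> UNIV \<times> S"
    and tf: "tf > 0"
    and prob: "prob_space M"
    and filt_sub: "\<And>t. 0 \<le> t \<Longrightarrow> subalgebra M (F t)"
    and filt_mono: "\<And>s t. 0 \<le> s \<Longrightarrow> s \<le> t \<Longrightarrow> sets (F s) \<subseteq> sets (F t)"
    and wiener: "wiener_process M F W"
    and X_adapted: "\<And>t. t \<in> {0..tf} \<Longrightarrow> X t \<in> borel_measurable (F t)"
    and Z_adapted: "\<And>t. t \<in> {0..tf} \<Longrightarrow> Z t \<in> borel_measurable (F t)"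
    and X_cont: "\<And>\<omega>. \<omega> \<in> space M \<Longrightarrow> continuous_on {0..tf} (\<lambda>t. X t \<omega>)"
    and Z_cont: "\<And>\<omega>. \<omega> \<in> space M \<Longrightarrow> continuous_on {0..tf} (\<lambda>t. Z t \<omega>)"
    and X_sde: "AE \<omega> in M. \<forall>t\<in>{0..tf}. X t \<omega> = X 0 \<omega>
        + (LINT s:{0..t}|lborel. f s (X s \<omega>) (Z s \<omega>) (\<Theta> \<omega>)) + G *v (W t \<omega> - W 0 \<omega>)"
    and Z_ode: "AE \<omega> in M. \<forall>t\<in>{0..tf}. Z t \<omega> = Z 0 \<omega>
        + (LINT s:{0..t}|lborel. h s (X s \<omega>) (Z s \<omega>) (\<Theta> \<omega>))"
    and A1: "X 0 \<in> borel_measurable (F 0)" "Z 0 \<in> borel_measurable (F 0)"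
      "\<Theta> \<in> borel_measurable (F 0)"
    and A2_density: "distributed M lborel (\<lambda>\<omega>. (X 0 \<omega>, Z 0 \<omega>, \<Theta> \<omega>))
        (\<lambda>(x, z, \<theta>). ennreal (\<pi> x z \<theta>))"
    and A2_nonneg: "\<And>x z \<theta>. \<pi> x z \<theta> \<ge> 0"
    and A2_cont: "continuous_on UNIV (\<lambda>(x, z, \<theta>). \<pi> x z \<theta>)"
    and A3_f: "uniformly_continuous_on D (\<lambda>(t, x, z, \<theta>). f t x z \<theta>)"
    and A3_h: "uniformly_continuous_on D (\<lambda>(t, x, z, \<theta>). h t x z \<theta>)"
    and A4_f: "\<And>\<theta>. \<theta> \<in> S \<Longrightarrow> \<exists>L. \<forall>t\<in>{0..tf}. L-lipschitz_on UNIV (\<lambda>(x, z). f t x z \<theta>)"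
    and A4_h: "\<And>\<theta>. \<theta> \<in> S \<Longrightarrow> \<exists>L. \<forall>t\<in>{0..tf}. L-lipschitz_on UNIV (\<lambda>(x, z). h t x z \<theta>)"
    and A5: "\<exists>(fx :: real \<Rightarrow> real^'n \<Rightarrow> real^'q \<Rightarrow> real^'m \<Rightarrow> (real^'n) \<Rightarrow>\<^sub>L (real^'n))
        (fxx :: real \<Rightarrow> real^'n \<Rightarrow> real^'q \<Rightarrow> real^'m \<Rightarrow> (real^'n) \<Rightarrow>\<^sub>L (real^'n) \<Rightarrow>\<^sub>L (real^'n))
        (ft :: real \<Rightarrow> real^'n \<Rightarrow> real^'q \<Rightarrow> real^'m \<Rightarrow> real^'n)
        (fz :: real \<Rightarrow> real^'n \<Rightarrow> real^'q \<Rightarrow> real^'m \<Rightarrow> (real^'q) \<Rightarrow>\<^sub>L (real^'n)).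
        (\<forall>(t, x, z, \<theta>)\<in>D.
           ((\<lambda>\<xi>. f t \<xi> z \<theta>) has_derivative blinfun_apply (fx t x z \<theta>)) (at x) \<and>
           ((\<lambda>\<xi>. fx t \<xi> z \<theta>) has_derivative blinfun_apply (fxx t x z \<theta>)) (at x) \<and>
           ((\<lambda>s. f s x z \<theta>) has_vector_derivative ft t x z \<theta>) (at t within {0..tf}) \<and>
           ((\<lambda>\<zeta>. f t x \<zeta> \<theta>) has_derivative blinfun_apply (fz t x z \<theta>)) (at z)) \<and>
        continuous_on D (\<lambda>(t, x, z, \<theta>). fx t x z \<theta>) \<and>
        continuous_on D (\<lambda>(t, x, z, \<theta>). fxx t x z \<theta>) \<and>
        continuous_on D (\<lambda>(t, x, z, \<theta>). ft t x z \<theta>) \<and>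
        continuous_on D (\<lambda>(t, x, z, \<theta>). fz t x z \<theta>)"
    and A6: "rank G = CARD('n)"
    and A7: "(\<integral>\<^sup>+\<omega>. ennreal (exp (LINT t:{0..tf}|lborel.
        (norm (matrix_inv G *v f t (X t \<omega>) (Z t \<omega>) (\<Theta> \<omega>)))\<^sup>2)) \<partial>M) < \<infinity>"
    and A8_pos: "Lf > 0" "Lh > 0"
    and A8_f: "\<And>t x' x'' z' z'' \<theta>. t \<in> {0..tf} \<Longrightarrow> \<theta> \<in> S \<Longrightarrow>
        norm (f t x' z' \<theta> - f t x'' z'' \<theta>) \<le> Lf * (norm (x' - x'') + norm (z' - z''))"
    and A8_h: "\<And>t x' x'' z' z'' \<theta>. t \<in> {0..tf} \<Longrightarrow> \<theta> \<in> S \<Longrightarrow>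
        norm (h t x' z' \<theta> - h t x'' z'' \<theta>) \<le> Lh * (norm (x' - x'') + norm (z' - z''))"
    and B1: "Y \<in> borel_measurable M"
    and B2_sets: "sets \<nu> = sets borel"
    and B2_nonneg: "\<And>y' x z \<theta>. x \<in> mspace (cpaths tf) \<Longrightarrow> z \<in> mspace (cpaths tf) \<Longrightarrow>
        \<psi> y' x z \<theta> \<ge> 0"
    and B2_meas: "\<And>x z \<theta>. x \<in> mspace (cpaths tf) \<Longrightarrow> z \<in> mspace (cpaths tf) \<Longrightarrow>
        (\<lambda>y'. \<psi> y' x z \<theta>) \<in> borel_measurable \<nu>"
    and B2_law: "conditional_law M tf X Z \<Theta> Y K"
    and B2: "\<And>B x z \<theta>. B \<in> sets borel \<Longrightarrow> x \<in> mspace (cpaths tf) \<Longrightarrow> z \<in> mspace (cpaths tf) \<Longrightarrow>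
        emeasure (K x z \<theta>) B = (\<integral>\<^sup>+y'\<in>B. ennreal (\<psi> y' x z \<theta>) \<partial>\<nu>)"
    and B3: "continuous_map (path_topology tf) euclideanreal (\<lambda>(x, z, \<theta>). \<psi> y x z \<theta>)"
    and B4: "(\<integral>\<^sup>+\<omega>. ennreal (\<psi> y (sample_path tf X \<omega>) (sample_path tf Z \<omega>) (\<Theta> \<omega>)) \<partial>M) > 0"
    and part: "\<And>i. partition_of tf (N i) (\<tau> i)"
    and nested: "\<And>i. \<tau> i ` {..N i} \<subseteq> \<tau> (Suc i) ` {..N (Suc i)}"
    and mesh_lim: "(\<lambda>i. mesh (N i) (\<tau> i)) \<longlonglongrightarrow> 0"
    and mesh_small: "\<And>i. (Lf + Lh) * mesh (N i) (\<tau> i) < 2"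
  shows "hypo_converges
      (prod_topology (W2_topology tf) (prod_topology euclidean euclidean))
      (\<lambda>i. trapezoidal_log_posterior tf f h G \<pi> \<psi> y (N i) (\<tau> i))
      (log_posterior tf f h G \<pi> \<psi> y)"
  proof -
  interpret prob_space M by (rule prob)
  obtain fx :: "real \<Rightarrow> real^'n \<Rightarrow> real^'q \<Rightarrow> real^'m \<Rightarrow> (real^'n) \<Rightarrow>\<^sub>L (real^'n)"
    where fx: "\<And>t x z \<theta>. (t, x, z, \<theta>) \<in> D \<Longrightarrow> ((\<lambda>\<xi>. f t \<xi> z \<theta>) has_derivative blinfun_apply (fx t x z \<theta>)) (at x)"
      and fxc: "continuous_on D (\<lambda>(t, x, z, \<theta>). fx t x z \<theta>)"
    using A5 by (elim exE conjE) (rule that, fast+)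
  have Sc: "closed S" unfolding S by (rule closed_topological_support)
  have fxd: "((\<lambda>\<xi>. f t \<xi> z \<theta>) has_derivative blinfun_apply (fx t x z \<theta>)) (at x)" if "t \<in> {0..tf}" "\<theta> \<in> S" for t x z \<theta>
    by (rule fx) (use that in \<open>simp add: D\<close>)
  have hl: "norm (h t x z \<theta> - h t x z' \<theta>) \<le> Lh * norm (z - z')" if "t \<in> {0..tf}" "\<theta> \<in> S" for t x z z' \<theta>
    using A8_h[OF that, of x z x z'] by simp
  have in_S: "\<theta> \<in> S" if "\<pi> x z \<theta> \<noteq> 0" for x z \<theta>
    unfolding S
    by (rule density_pos_imp_in_support[OF A2_density A2_cont, of x z]) (use that A2_nonneg[of x z \<theta>] in simp)
  \<comment> \<open>Dropping \<open>Lf\<close> needs a nonnegative mesh, hence a partition with at least one cell.\<close>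
  have mesh_h: "Lh * mesh (N i) (\<tau> i) < 2" for i
  proof -
    have "N i \<noteq> 0" using part[of i] tf unfolding partition_of_def by (metis less_irrefl)
    then have "0 \<le> mesh (N i) (\<tau> i)"
      using cell_le_mesh[of 0 "N i" "\<tau> i"] partition_mono[OF part, of 0 "Suc 0" i] by simp
    then have "Lh * mesh (N i) (\<tau> i) \<le> (Lf + Lh) * mesh (N i) (\<tau> i)"
      using A8_pos by (intro mult_right_mono) auto
    then show ?thesis using mesh_small[of i] by simp
  qed
  have core: "(\<lambda>i. trapezoidal_log_posterior tf f h G \<pi> \<psi> y (N' i) (\<tau>' i) (x i, \<zeta> i, \<theta> i))
      \<longlonglongrightarrow> log_posterior tf f h G \<pi> \<psi> y (x', v, \<eta>)"
    if "\<And>i::nat. partition_of tf (N' i) (\<tau>' i)" "(\<lambda>i. mesh (N' i) (\<tau>' i)) \<longlonglongrightarrow> 0"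
      "\<And>i. Lh * mesh (N' i) (\<tau>' i) < 2" "\<And>i. x i \<in> PL tf (N' i) (\<tau>' i)"
      "x' \<in> W2 tf" "(\<lambda>i. W2_dist tf (x i) x') \<longlonglongrightarrow> 0" "\<zeta> \<longlonglongrightarrow> v" "\<theta> \<longlonglongrightarrow> \<eta>"
      "\<And>i. \<pi> (x i 0) (\<zeta> i) (\<theta> i) \<noteq> 0" for N' \<tau>' x x' \<zeta> v \<theta> \<eta>
    by (rule trapezoidal_log_posterior_tendsto[where f=f and h=h and \<pi>=\<pi> and \<psi>=\<psi> and y=y and S=S and fx=fx, OF tf A8_pos(2) Sc
          uniformly_continuous_imp_continuous[OF A3_f[unfolded D]] fxd fxc[unfolded D] A3_h[unfolded D]
          hl A2_cont A2_nonneg B3 B2_nonneg])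
       (assumption | rule that in_S[OF that(9)])+
  let ?X = "prod_topology (W2_topology tf) (prod_topology euclidean euclidean) :: ((real \<Rightarrow> real^'n) \<times> (real^'q) \<times> (real^'m)) topology"
  let ?g = "\<lambda>i. trapezoidal_log_posterior tf f h G \<pi> \<psi> y (N i) (\<tau> i)"
  let ?l = "log_posterior tf f h G \<pi> \<psi> y"
  show ?thesis
    unfolding hypo_converges_def
  proof (intro conjI allI impI ballI)
    fix u :: "nat \<Rightarrow> (real \<Rightarrow> real^'n) \<times> (real^'q) \<times> (real^'m)" and v
    assume u: "\<forall>i. u i \<in> topspace ?X" and lim: "limitin ?X u v sequentially"
    define x where "x = (\<lambda>i. fst (u i))"
    define \<zeta> where "\<zeta> = (\<lambda>i. fst (snd (u i)))"
    define \<theta> where "\<theta> = (\<lambda>i. snd (snd (u i)))"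
    have ueq: "u i = (x i, \<zeta> i, \<theta> i)" for i by (simp add: x_def \<zeta>_def \<theta>_def)
    obtain x' z\<^sub>0 \<eta> where v: "v = (x', z\<^sub>0, \<eta>)" by (cases v)
    have xW: "x i \<in> W2 tf" for i using u[rule_format, of i] by (simp add: ueq topspace_W2_topology[OF tf])
    have "limitin (W2_topology tf) x x' sequentially" and \<zeta>: "\<zeta> \<longlonglongrightarrow> z\<^sub>0" and \<theta>: "\<theta> \<longlonglongrightarrow> \<eta>"
      using lim unfolding limitin_pairwise v by (simp_all add: o_def x_def \<zeta>_def \<theta>_def)
    then have x': "x' \<in> W2 tf" and xl: "(\<lambda>i. W2_dist tf (x i) x') \<longlonglongrightarrow> 0"
      using limitin_W2_iff[OF tf xW] by auto
    show "limsup (\<lambda>i. ?g i (u i)) \<le> ?l v"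
      unfolding Limsup_le_iff
    proof (intro allI impI, rule ccontr)
      fix b assume b: "?l v < b" and "\<not> (\<forall>\<^sub>F i in sequentially. ?g i (u i) < b)"
      then obtain r :: "nat \<Rightarrow> nat" where r: "strict_mono r" "\<And>n. \<not> ?g (r n) (u (r n)) < b"
        using not_eventually_sequentiallyD by blast
      \<comment> \<open>The values are at least \<open>b > -\<infinity>\<close>, which excludes the first branch of the definition.\<close>
      have fin: "x (r n) \<in> PL tf (N (r n)) (\<tau> (r n)) \<and> \<pi> (x (r n) 0) (\<zeta> (r n)) (\<theta> (r n)) \<noteq> 0" for n
      proof (rule ccontr)
        assume "\<not> ?thesis"
        then have "?g (r n) (u (r n)) = - \<infinity>" unfolding ueq trapezoidal_log_posterior_def by auto
        then show False using r(2)[of n] b by (cases b) auto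
      qed
      have sub: "(\<lambda>n. q (r n)) \<longlonglongrightarrow> l" if "q \<longlonglongrightarrow> l" for q :: "nat \<Rightarrow> 'e::topological_space" and l
        using LIMSEQ_subseq_LIMSEQ[OF that r(1)] by (simp add: o_def)
      have "(\<lambda>n. ?g (r n) (x (r n), \<zeta> (r n), \<theta> (r n))) \<longlonglongrightarrow> ?l (x', z\<^sub>0, \<eta>)"
        by (rule core[OF part sub[OF mesh_lim] mesh_h _ x' sub[OF xl] sub[OF \<zeta>] sub[OF \<theta>]]) (use fin in auto)
      then have "(\<lambda>n. ?g (r n) (u (r n))) \<longlonglongrightarrow> ?l v" unfolding ueq v .
      then have "\<forall>\<^sub>F n in sequentially. ?g (r n) (u (r n)) < b" using b by (rule order_tendstoD(2))
      then show False using r(2) by simp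
    qed
  next
    fix v assume v: "v \<in> topspace ?X"
    obtain x z\<^sub>0 \<theta> where veq: "v = (x, z\<^sub>0, \<theta>)" by (cases v)
    have x: "x \<in> W2 tf" using v by (simp add: veq topspace_W2_topology[OF tf])
    show "\<exists>u. (\<forall>i. u i \<in> topspace ?X) \<and> limitin ?X u v sequentially \<and> ?l v \<le> liminf (\<lambda>i. ?g i (u i))"
    proof (cases "\<pi> (x 0) z\<^sub>0 \<theta> = 0")
      case True
      then have "?l v = - \<infinity>" by (simp add: veq log_posterior_def)
      then show ?thesis by (intro exI[of _ "\<lambda>_. v"]) (use v in simp)
    next
      case False
      obtain p where p: "\<And>i. p i \<in> PL tf (N i) (\<tau> i)" "\<And>i. p i 0 = x 0" "(\<lambda>i. W2_dist tf (p i) x) \<longlonglongrightarrow> 0"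
        using PL_dense[OF tf part mesh_lim x] by blast
      have pW: "p i \<in> W2 tf" for i using PL_subset_W2[OF tf part] p(1) by blast
      have "(\<lambda>i. ?g i (p i, z\<^sub>0, \<theta>)) \<longlonglongrightarrow> ?l (x, z\<^sub>0, \<theta>)"
        by (rule core[OF part mesh_lim mesh_h p(1) x p(3)]) (use False p(2) in auto)
      then have "liminf (\<lambda>i. ?g i (p i, z\<^sub>0, \<theta>)) = ?l v" unfolding veq by (intro lim_imp_Liminf) auto
      moreover have "limitin ?X (\<lambda>i. (p i, z\<^sub>0, \<theta>)) v sequentially"
        unfolding limitin_pairwise veq using limitin_W2_iff[OF tf pW] x p(3) by (simp add: o_def)
      ultimately show ?thesis
        by (intro exI[of _ "\<lambda>i. (p i, z\<^sub>0, \<theta>)"]) (use pW in \<open>simp add: topspace_W2_topology[OF tf]\<close>)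
    qed
  qed
qed

end
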